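(* Let $B$ be a bounded real-valued random variable on $(\Omega,\mathcal F,P)$ and set $U_T(x,\omega):=U(x-B(\omega))$. Suppose that $S$ satisfies (NA), that Assumption A (well-posedness, for the recursion started from this $U_T$) holds, and that $U$ satisfies either Assumption B or Assumption C. Then for every $c\in\mathbb{R}$ there exists a strategy $\phi^*=\phi^*(c)\in\Phi(U,c,B)$ such that $$u(B,c)=E\,U(V_T^{c,\phi^*}-B)<\infty,\qquad\text{where } u(B,c):=\sup_{\phi\in\Phi(U,c,B)}E\,U(V_T^{c,\phi}-B),$$ and $\Phi(U,c,B)$ is the set of strategies $\phi\in\Phi$ such that the expectation $EU(V_T^{c,\phi}-B)$ is well defined.
   Context: Market: $(\Omega,\mathcal F,P)$ is a probability space with a filtration $(\mathcal F_t)_{0\le t\le T}$ ($T$ a finite integer horizon), $\mathcal F_0$ contains all $P$-null sets, and $(S_t)_{0\le t\le T}$ is an $\mathbb{R}^d$-valued adapted process; $\Delta S_t:=S_t-S_{t-1}$. $\Xi_t$ is the set of $\mathcal F_t$-measurable $\mathbb{R}^d$-valued random variables. A strategy is a predictable process $\phi=(\phi_t)_{1\le t\le T}$, i.e. $\phi_t\in\Xi_{t-1}$; $\Phi$ is the set of all strategies. For $c\in\mathbb{R}$, $V_t^{c,\phi}:=c+\sum_{i=1}^t\langle\phi_i,\Delta S_i\rangle$. $U:\mathbb{R}\to\mathbb{R}$ is a (deterministic) concave nondecreasing function. Conditional expectations are in the generalized sense ($E(X|\mathcal G)=E(X^+|\mathcal G)-E(X^-|\mathcal G)$ whenever this is not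 $\infty-\infty$). (NA): for all $\phi\in\Phi$, if $V_T^{0,\phi}\ge 0$ a.s. then $V_T^{0,\phi}=0$ a.s. Assumption A: with $U_T(x,\omega)=U(x-B(\omega))$, the following random functions are well defined: for $0\le t<T$, $x\in\mathbb{R}$, $U_t(x):=\operatorname{ess\,sup}_{\xi\in\Xi_t}E(U_{t+1}(x+\langle\xi,\Delta S_{t+1}\rangle)|\mathcal F_t)<\infty$ a.s. (where regular versions of $U_{t+1}$, i.e. a.s. nondecreasing, concave and finite-valued in $x$, are used), and $EU_0(x)<\infty$ for all $x\in\mathbb{R}$. Assumption B: $U$ is concave, nondecreasing, $U(0)=0$, and there exist $\tilde x>0$ and $0<\gamma<1$ such that $U(\lambda x)\le\lambda^\gamma U(x)$ for all $x\ge\tilde x$ and all $\lambda\ge1$. Assumption C: $U$ is concave, nondecreasing, $U(0)=0$, and there exist $\alpha>0$ and $\tilde x\le0$ such that $U(\lambda x)\le\lambda^{1+\alpha}U(x)$ for all $x\le\tilde x$ and all $\lambda\ge1$. *)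

theory Defs
  imports "HOL-Probability.Probability"
begin

section \<open>Generalized expectation and conditional expectation\<close>

text \<open>
  For real \<open>x\<close>, \<^term>\<open>ennreal x\<close> truncates at \<open>0\<close>, so \<^term>\<open>ennreal (X \<omega>)\<close> and
  \<^term>\<open>ennreal (- X \<omega>)\<close> are the positive and the negative part of \<open>X\<close>.  The values of
  \<open>gen_expectation\<close> and \<open>gen_cond_exp\<close> are meaningful only together with
  \<open>expectation_defined\<close> and \<open>cond_exp_defined\<close>, which exclude \<open>\<infinity> - \<infinity>\<close> and the zero that
  \<^const>\<open>nn_cond_exp\<close> returns on non-measurable arguments.
\<close>

definition expectation_defined :: "'a measure \<Rightarrow> ('a \<Rightarrow> real) \<Rightarrow> bool" where
  "expectation_defined M X \<longleftrightarrow>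
     X \<in> borel_measurable M \<and>
     ((\<integral>\<^sup>+ \<omega>. ennreal (X \<omega>) \<partial>M) < \<infinity> \<or> (\<integral>\<^sup>+ \<omega>. ennreal (- X \<omega>) \<partial>M) < \<infinity>)"

definition gen_expectation :: "'a measure \<Rightarrow> ('a \<Rightarrow> real) \<Rightarrow> ereal" where
  "gen_expectation M X =
     enn2ereal (\<integral>\<^sup>+ \<omega>. ennreal (X \<omega>) \<partial>M) - enn2ereal (\<integral>\<^sup>+ \<omega>. ennreal (- X \<omega>) \<partial>M)"

definition cond_exp_defined :: "'a measure \<Rightarrow> 'a measure \<Rightarrow> ('a \<Rightarrow> real) \<Rightarrow> bool" where
  "cond_exp_defined M G X \<longleftrightarrow>
     X \<in> borel_measurable M \<and>
     (AE \<omega> in M. nn_cond_exp M G (\<lambda>\<omega>. ennreal (X \<omega>)) \<omega> < \<infinity> \<or>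
                 nn_cond_exp M G (\<lambda>\<omega>. ennreal (- X \<omega>)) \<omega> < \<infinity>)"

definition gen_cond_exp :: "'a measure \<Rightarrow> 'a measure \<Rightarrow> ('a \<Rightarrow> real) \<Rightarrow> 'a \<Rightarrow> ereal" where
  "gen_cond_exp M G X \<omega> =
     enn2ereal (nn_cond_exp M G (\<lambda>\<omega>. ennreal (X \<omega>)) \<omega>) -
     enn2ereal (nn_cond_exp M G (\<lambda>\<omega>. ennreal (- X \<omega>)) \<omega>)"

text \<open>
  \<open>Y\<close> is (a version of) the essential supremum of the family \<open>\<X>\<close> of random variables.
  The library's \<^const>\<open>esssup\<close> is a different notion: the essential supremum of the values of a
  single function.
\<close>

definition is_ess_sup :: "'a measure \<Rightarrow> ('a \<Rightarrow> ereal) set \<Rightarrow> ('a \<Rightarrow> ereal) \<Rightarrow> bool" where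
  "is_ess_sup M \<X> Y \<longleftrightarrow>
     Y \<in> borel_measurable M \<and>
     (\<forall>X\<in>\<X>. AE \<omega> in M. X \<omega> \<le> Y \<omega>) \<and>
     (\<forall>Z\<in>borel_measurable M. (\<forall>X\<in>\<X>. AE \<omega> in M. X \<omega> \<le> Z \<omega>) \<longrightarrow> (AE \<omega> in M. Y \<omega> \<le> Z \<omega>))"

section \<open>The market model\<close>

text \<open>
  All processes are indexed by \<^typ>\<open>nat\<close>, but only times \<open>t \<le> T\<close> matter; of each \<open>F t\<close> only the
  \<open>\<sigma>\<close>-algebra is used, the probability is always that of \<open>M\<close>.
\<close>

locale market = prob_space M
  for M :: "'a measure" +
  fixes F :: "nat \<Rightarrow> 'a measure"
    and T :: nat
    and S :: "nat \<Rightarrow> 'a \<Rightarrow> real ^ 'd"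
  assumes filtration_subalgebra: "\<And>t. t \<le> T \<Longrightarrow> subalgebra M (F t)"
    and filtration_mono: "\<And>s t. s \<le> t \<Longrightarrow> t \<le> T \<Longrightarrow> sets (F s) \<subseteq> sets (F t)"
    and null_sets_F0: "null_sets M \<subseteq> sets (F 0)"
    and adapted: "\<And>t. t \<le> T \<Longrightarrow> S t \<in> borel_measurable (F t)"

definition price_increment :: "(nat \<Rightarrow> 'a \<Rightarrow> real ^ 'd) \<Rightarrow> nat \<Rightarrow> 'a \<Rightarrow> real ^ 'd" where
  "price_increment S t \<omega> = S t \<omega> - S (t - 1) \<omega>"

definition strategies :: "(nat \<Rightarrow> 'a measure) \<Rightarrow> nat \<Rightarrow> (nat \<Rightarrow> 'a \<Rightarrow> real ^ 'd) set" where
  "strategies F T = {\<phi>. \<forall>t\<in>{1..T}. \<phi> t \<in> borel_measurable (F (t - 1))}"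

definition wealth ::
  "(nat \<Rightarrow> 'a \<Rightarrow> real ^ 'd) \<Rightarrow> real \<Rightarrow> (nat \<Rightarrow> 'a \<Rightarrow> real ^ 'd) \<Rightarrow> nat \<Rightarrow> 'a \<Rightarrow> real" where
  "wealth S c \<phi> t \<omega> = c + (\<Sum>i=1..t. \<phi> i \<omega> \<bullet> price_increment S i \<omega>)"

definition no_arbitrage ::
  "'a measure \<Rightarrow> (nat \<Rightarrow> 'a measure) \<Rightarrow> nat \<Rightarrow> (nat \<Rightarrow> 'a \<Rightarrow> real ^ 'd) \<Rightarrow> bool" where
  "no_arbitrage M F T S \<longleftrightarrow>
     (\<forall>\<phi>\<in>strategies F T.
        (AE \<omega> in M. wealth S 0 \<phi> T \<omega> \<ge> 0) \<longrightarrow> (AE \<omega> in M. wealth S 0 \<phi> T \<omega> = 0))"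

section \<open>Assumptions on the utility\<close>

text \<open>
  Well-posedness of the dynamic programming recursion started from \<open>U\<^sub>T x \<omega> = U (x - B \<omega>)\<close>.
  The random function \<open>V t x \<omega>\<close> is the regular version of \<open>U\<^sub>t x \<omega>\<close>; as a version it is determined
  only almost surely, hence the existential quantifier.  Since it is real-valued, the
  essential-supremum clause also says that the essential supremum is finite almost surely.
\<close>

definition well_posed ::
  "'a measure \<Rightarrow> (nat \<Rightarrow> 'a measure) \<Rightarrow> nat \<Rightarrow> (nat \<Rightarrow> 'a \<Rightarrow> real ^ 'd) \<Rightarrow>
   (real \<Rightarrow> real) \<Rightarrow> ('a \<Rightarrow> real) \<Rightarrow> bool" where
  "well_posed M F T S U B \<longleftrightarrow>
     (\<exists>V :: nat \<Rightarrow> real \<Rightarrow> 'a \<Rightarrow> real.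
        (\<forall>x. \<forall>\<omega>. V T x \<omega> = U (x - B \<omega>)) \<and>
        (\<forall>t<T.
           (\<forall>x. \<forall>\<xi>\<in>borel_measurable (F t). cond_exp_defined M (F t)
              (\<lambda>\<omega>. V (Suc t) (x + \<xi> \<omega> \<bullet> price_increment S (Suc t) \<omega>) \<omega>)) \<and>
           (\<forall>x. V t x \<in> borel_measurable (F t)) \<and>
           (\<forall>x. is_ess_sup M
              ((\<lambda>\<xi>. gen_cond_exp M (F t)
                  (\<lambda>\<omega>. V (Suc t) (x + \<xi> \<omega> \<bullet> price_increment S (Suc t) \<omega>) \<omega>))
                ` borel_measurable (F t))
              (\<lambda>\<omega>. ereal (V t x \<omega>))) \<and>
           (AE \<omega> in M. mono (\<lambda>x. V t x \<omega>) \<and> concave_on UNIV (\<lambda>x. V t x \<omega>))) \<and>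
        (\<forall>x. expectation_defined M (V 0 x) \<and> gen_expectation M (V 0 x) < \<infinity>))"

definition growth_at_plus_infinity :: "(real \<Rightarrow> real) \<Rightarrow> bool" where
  "growth_at_plus_infinity U \<longleftrightarrow>
     concave_on UNIV U \<and> mono U \<and> U 0 = 0 \<and>
     (\<exists>x0 \<gamma>. 0 < x0 \<and> 0 < \<gamma> \<and> \<gamma> < 1 \<and>
        (\<forall>x\<ge>x0. \<forall>l\<ge>1. U (l * x) \<le> l powr \<gamma> * U x))"

definition growth_at_minus_infinity :: "(real \<Rightarrow> real) \<Rightarrow> bool" where
  "growth_at_minus_infinity U \<longleftrightarrow>
     concave_on UNIV U \<and> mono U \<and> U 0 = 0 \<and>
     (\<exists>\<alpha> x0. 0 < \<alpha> \<and> x0 \<le> 0 \<and>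
        (\<forall>x\<le>x0. \<forall>l\<ge>1. U (l * x) \<le> l powr (1 + \<alpha>) * U x))"

section \<open>The optimization problem\<close>

definition admissible_strategies ::
  "'a measure \<Rightarrow> (nat \<Rightarrow> 'a measure) \<Rightarrow> nat \<Rightarrow> (nat \<Rightarrow> 'a \<Rightarrow> real ^ 'd) \<Rightarrow>
   (real \<Rightarrow> real) \<Rightarrow> real \<Rightarrow> ('a \<Rightarrow> real) \<Rightarrow> (nat \<Rightarrow> 'a \<Rightarrow> real ^ 'd) set" where
  "admissible_strategies M F T S U c B =
     {\<phi> \<in> strategies F T. expectation_defined M (\<lambda>\<omega>. U (wealth S c \<phi> T \<omega> - B \<omega>))}"

definition expected_utility ::
  "'a measure \<Rightarrow> nat \<Rightarrow> (nat \<Rightarrow> 'a \<Rightarrow> real ^ 'd) \<Rightarrow>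
   (real \<Rightarrow> real) \<Rightarrow> real \<Rightarrow> ('a \<Rightarrow> real) \<Rightarrow> (nat \<Rightarrow> 'a \<Rightarrow> real ^ 'd) \<Rightarrow> ereal" where
  "expected_utility M T S U c B \<phi> = gen_expectation M (\<lambda>\<omega>. U (wealth S c \<phi> T \<omega> - B \<omega>))"

definition optimal_utility ::
  "'a measure \<Rightarrow> (nat \<Rightarrow> 'a measure) \<Rightarrow> nat \<Rightarrow> (nat \<Rightarrow> 'a \<Rightarrow> real ^ 'd) \<Rightarrow>
   (real \<Rightarrow> real) \<Rightarrow> ('a \<Rightarrow> real) \<Rightarrow> real \<Rightarrow> ereal" where
  "optimal_utility M F T S U B c =
     (SUP \<phi>\<in>admissible_strategies M F T S U c B. expected_utility M T S U c B \<phi>)"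

end

theory Submission
  imports Defs
begin

text \<open>
  Dynamic programming, without regular conditional distributions.  Both growth conditions give
  \<open>0 \<le> p < q\<close> and \<open>C\<close> such that \<open>U\<^sub>T (x / 2) \<ge> max (p * U\<^sub>T x) (q * U\<^sub>T x) - C\<close>, and the recursion
  passes this on to every \<open>U\<^sub>t\<close>.  Since halving a position damps losses more than gains, the
  conditional expected gain, and then also the conditional expected loss, of a nearly optimal
  position is bounded.  Under (NA) this makes nearly optimal strategies of almost minimal norm
  bounded almost surely, so a random subsequence converges and Fatou's lemma gives a one-step
  optimizer.  The same bound shows by forward induction that the value process along the optimizers
  is integrable; hence the resulting strategy is admissible and attains the value
  \<open>E U\<^sub>0 c\<close>, which bounds the expected utility of every admissible strategy.
\<close>

section \<open>Concave utilities and growth\<close>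

text \<open>Halving is the comparison that concavity supplies by itself: with \<open>U 0 = 0\<close>
  at least half of a gain survives and at most half of a loss. Each growth condition improves one of
  these two factors, and the bounded claim only enlarges \<open>C\<close>; afterwards just the gap
  \<open>p < q\<close> matters. The obstacle is that \<open>U\<^sub>t\<close> is an essential
  supremum for each constant capital separately, while optimizers must be measurable and start from
  random wealth. In place of conditional distributions, countably many positions are glued along a
  measurable index, which commutes with conditional expectation; random wealth is reached through a
  grid and continuity. Bounded losses restrict limiting directions only if the utility falls to
  minus infinity on the left. This unboundedness therefore travels through the recursion together
  with the growth inequalities, and a constant utility is treated apart. Its proof lets the capital
  itself diverge, which is why capital and position are normalised jointly. Since positive and
  negative parts may be infinite, the key estimates are proved as relations between sums in
  \<open>ennreal\<close>.\<close>

lemma concave_on_UNIV_ineq: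
  fixes U :: "real \<Rightarrow> real"
  assumes "concave_on UNIV U" "0 \<le> t" "t \<le> 1"
  shows "(1 - t) * U x + t * U y \<le> U ((1 - t) * x + t * y)"
  using assms concave_onD[OF assms(1), of t x y] by simp

text \<open>Left of a strict increase from \<open>u\<close> to \<open>v\<close> the graph lies below
  the line through these two points, and that line has positive slope.\<close>

lemma concave_mono_unbounded_below:
  fixes U :: "real \<Rightarrow> real"
  assumes conc: "concave_on UNIV U" and "mono U" and "U v \<noteq> U w"
  shows "\<exists>x. U x < a"
proof -
  obtain u v where uv: "u < v" "U u < U v"
  proof (cases "v < w")
    case True
    then show ?thesis using that[of v w] monoD[OF \<open>mono U\<close>, of v w] \<open>U v \<noteq> U w\<close> by auto
  next
    case False
    then have "w < v" using \<open>U v \<noteq> U w\<close> by (cases "v = w") auto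
    then show ?thesis using that[of w v] monoD[OF \<open>mono U\<close>, of w v] \<open>U v \<noteq> U w\<close> by auto
  qed
  define s where "s = (U v - U u) / (v - u)"
  have s: "0 < s" using uv by (simp add: s_def)
  have bound: "U x \<le> U u - (u - x) * s" if "x < u" for x
  proof -
    define t where "t = (u - x) / (v - x)"
    have t: "0 \<le> t" "t \<le> 1" using that uv by (auto simp: t_def divide_simps)
    have u: "(1 - t) * x + t * v = u"
    proof -
      have "t * (v - x) = u - x" using that uv by (simp add: t_def)
      then show ?thesis by (simp add: algebra_simps)
    qed
    have "(1 - t) * U x + t * U v \<le> U u"
      using concave_on_UNIV_ineq[OF conc t, of x v] u by simp
    moreover have "1 - t = (v - u) / (v - x)"
      using that uv by (simp add: t_def field_simps)
    ultimately have "(v - u) / (v - x) * U x + (u - x) / (v - x) * U v \<le> U u"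
      by (simp add: t_def)
    then have "((v - u) * U x + (u - x) * U v) / (v - x) \<le> U u"
      by (simp add: add_divide_distrib)
    then have "(v - u) * U x + (u - x) * U v \<le> U u * (v - x)"
      using that uv by (simp add: pos_divide_le_eq)
    then have "(v - u) * U x \<le> (v - u) * U u - (u - x) * (U v - U u)"
      by (simp add: algebra_simps)
    also have "\<dots> = (v - u) * (U u - (u - x) * s)"
      using uv by (simp add: s_def field_simps)
    finally show ?thesis using uv by (simp add: mult_le_cancel_left_pos)
  qed
  \<comment> \<open>At this point the line has dropped by \<open>\<bar>U u - a\<bar> + 1\<close>
    below \<open>U u\<close>, which puts it below \<open>a\<close>.\<close>
  define x where "x = u - (\<bar>U u - a\<bar> + 1) / s"
  have "x < u" using s by (simp add: x_def add_pos_nonneg add.commute)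
  then have "U x \<le> U u - (\<bar>U u - a\<bar> + 1)"
    using bound[of x] s by (simp add: x_def)
  then show ?thesis by (intro exI[of _ x]) linarith
qed

text \<open>The point \<open>x / 2 - \<beta>\<close> is the midpoint of \<open>x - \<beta>\<close>
  and \<open>- \<beta>\<close>. The error \<open>U (- b)\<close> may replace
  \<open>U (- \<beta>) / 2\<close> because it is at most \<open>U (- \<beta>)\<close> and at most
  \<open>0\<close>.\<close>

lemma concave_halving:
  fixes U :: "real \<Rightarrow> real"
  assumes "concave_on UNIV U" "mono U" "U 0 = 0" "\<bar>\<beta>\<bar> \<le> b"
  shows "U (x - \<beta>) / 2 + U (- b) \<le> U (x / 2 - \<beta>)"
proof -
  have "(1 - 1 / 2) * U (x - \<beta>) + 1 / 2 * U (- \<beta>) \<le> U ((1 - 1 / 2) * (x - \<beta>) + 1 / 2 * (- \<beta>))"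
    by (rule concave_on_UNIV_ineq[OF assms(1)]) auto
  moreover have "(1 - 1 / 2) * (x - \<beta>) + 1 / 2 * (- \<beta>) = x / 2 - \<beta>"
    by (simp add: field_simps)
  moreover have "U (- b) \<le> U (- \<beta>)" "U (- b) \<le> U 0"
    using assms(4) by (auto intro!: monoD[OF \<open>mono U\<close>])
  ultimately show ?thesis using \<open>U 0 = 0\<close> by simp
qed

text \<open>Both \<open>s\<close> and \<open>t\<close> lie between \<open>0\<close> and
  \<open>s + t\<close>, so by concavity and \<open>U 0 = 0\<close> each carries at least its
  proportional share of \<open>U (s + t)\<close>.\<close>

lemma concave_subadditive:
  fixes U :: "real \<Rightarrow> real"
  assumes conc: "concave_on UNIV U" and "U 0 = 0" and st: "0 \<le> s" "0 \<le> t"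
  shows "U (s + t) \<le> U s + U t"
proof (cases "s + t = 0")
  case True
  then show ?thesis using st \<open>U 0 = 0\<close> by (auto simp: add_nonneg_eq_0_iff)
next
  case False
  then have pos: "0 < s + t" using st by auto
  have scaled: "r / (s + t) * U (s + t) \<le> U r" if "0 \<le> r" "r \<le> s + t" for r
    using concave_on_UNIV_ineq[OF conc, of "r / (s + t)" 0 "s + t"] that pos \<open>U 0 = 0\<close>
    by (simp add: divide_simps)
  have "U (s + t) = (s / (s + t) + t / (s + t)) * U (s + t)"
    using pos by (simp flip: add_divide_distrib)
  also have "\<dots> = s / (s + t) * U (s + t) + t / (s + t) * U (s + t)"
    by (rule distrib_right)
  also have "\<dots> \<le> U s + U t"
    using scaled[of s] scaled[of t] st by (intro add_mono) auto
  finally show ?thesis .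
qed

text \<open>Both growth conditions are reduced to a pair of inequalities that are linear in \<open>U\<close> and hence
  stable under conditional expectation and essential suprema.\<close>

lemma growth_plus_halving:
  assumes "growth_at_plus_infinity U" and b: "0 \<le> b"
  shows "\<exists>p q C. 0 \<le> p \<and> p < q \<and> 0 \<le> C \<and> (\<forall>x \<beta>. \<bar>\<beta>\<bar> \<le> b \<longrightarrow>
    p * U (x - \<beta>) - C \<le> U (x / 2 - \<beta>) \<and> q * U (x - \<beta>) - C \<le> U (x / 2 - \<beta>))"
proof -
  obtain x0 \<gamma> where conc: "concave_on UNIV U" and mono: "mono U" and U0: "U 0 = 0"
    and x0: "0 < x0" and \<gamma>: "0 < \<gamma>" "\<gamma> < 1"
    and growth: "\<And>x l. x0 \<le> x \<Longrightarrow> 1 \<le> l \<Longrightarrow> U (l * x) \<le> l powr \<gamma> * U x"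
    using assms(1) unfolding growth_at_plus_infinity_def by blast
  \<comment> \<open>Beyond \<open>x0\<close>, doubling the argument multiplies \<open>U\<close> by
    at most \<open>2 powr \<gamma>\<close>, so halving keeps at least the fraction
    \<open>q > 1 / 2\<close> of a large gain. The companion \<open>p = 1 / 2\<close> is the factor
    of \<open>concave_halving\<close>.\<close>
  define q where "q = 2 powr (- \<gamma>)"
  \<comment> \<open>The terms absorb, in this order, the error of \<open>concave_halving\<close>,
    the shift of the argument by \<open>b\<close>, and the small gains to which the growth condition
    does not apply.\<close>
  define C where "C = - U (- b) + U b + U (2 * x0 + b)"
  have signs: "0 \<le> - U (- b)" "0 \<le> U b" "0 \<le> U (2 * x0 + b)"
    using monoD[OF mono, of "- b" 0] monoD[OF mono, of 0 b] monoD[OF mono, of 0 "2 * x0 + b"] U0 b x0 by auto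
  have q: "1 / 2 < q" "q \<le> 1"
  proof -
    have "2 powr (- 1) < 2 powr (- \<gamma>)" using \<gamma> by (intro powr_less_mono) auto
    then show "1 / 2 < q" by (simp add: q_def powr_minus_divide)
    have "2 powr (- \<gamma>) \<le> 2 powr 0" using \<gamma> by (intro powr_mono) auto
    then show "q \<le> 1" by (simp add: q_def)
  qed
  have main: "1 / 2 * U (x - \<beta>) - C \<le> U (x / 2 - \<beta>) \<and> q * U (x - \<beta>) - C \<le> U (x / 2 - \<beta>)"
    if \<beta>: "\<bar>\<beta>\<bar> \<le> b" for x \<beta>
  proof -
    define y where "y = x - \<beta>"
    have half: "U y / 2 + U (- b) \<le> U (x / 2 - \<beta>)"
      unfolding y_def by (rule concave_halving[OF conc mono U0 \<beta>])
    consider "U y \<le> 0" | "0 < U y" "2 * x0 \<le> y - b" | "0 < U y" "y - b < 2 * x0" by linarith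
    then have "q * U y - C \<le> U (x / 2 - \<beta>)"
    proof cases
      case 1
      then have "q * U y \<le> 1 / 2 * U y"
        using q by (intro mult_right_mono_neg) auto
      then show ?thesis using half signs by (simp add: C_def)
    next
      case 2
      \<comment> \<open>As \<open>x / 2 - \<beta> = (y - \<beta>) / 2\<close>, the halved argument
        is at least \<open>(y - b) / 2\<close>, where growth applies with factor \<open>2\<close>.
        Subadditivity then trades \<open>y - b\<close> for \<open>y\<close> at the cost of
        \<open>U b\<close>.\<close>
      have "U (2 * ((y - b) / 2)) \<le> 2 powr \<gamma> * U ((y - b) / 2)"
        using 2 by (intro growth) auto
      moreover have e: "2 * ((y - b) / 2) = y - b" by simp
      ultimately have "U (y - b) \<le> 2 powr \<gamma> * U ((y - b) / 2)"
        by (simp only: e)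
      then have "q * U (y - b) \<le> q * (2 powr \<gamma> * U ((y - b) / 2))"
        using q by (intro mult_left_mono) simp_all
      also have "\<dots> = U ((y - b) / 2)"
        by (simp add: q_def powr_minus)
      also have "\<dots> \<le> U (x / 2 - \<beta>)"
        using \<beta> by (intro monoD[OF mono]) (auto simp: y_def field_simps)
      finally have *: "q * U (y - b) \<le> U (x / 2 - \<beta>)" .
      have "q * U y \<le> q * (U (y - b) + U b)"
        using concave_subadditive[OF conc U0, of "y - b" b] 2 b q x0 by (intro mult_left_mono) auto
      also have "\<dots> \<le> q * U (y - b) + 1 * U b"
        unfolding distrib_left using q signs by (intro add_left_mono mult_right_mono) auto
      finally show ?thesis using * signs by (simp add: C_def)
    next
      case 3
      have "q * U y \<le> 1 * U y" using q 3 by (intro mult_right_mono) auto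
      also have "U y \<le> U (2 * x0 + b)" using 3 by (intro monoD[OF mono]) auto
      finally show ?thesis using half signs 3 by (simp add: C_def)
    qed
    then show ?thesis using half signs by (simp add: y_def C_def)
  qed
  have "0 \<le> C" using signs by (simp add: C_def)
  then show ?thesis
    using q main by (intro exI[of _ "1 / 2"] exI[of _ q] exI[of _ C]) auto
qed

text \<open>Here losses improve: \<open>q = 1 / 2\<close> comes from concavity and
  \<open>p < 1 / 2\<close> from growth. Because of the shift by \<open>\<beta>\<close>, a loss at
  \<open>y\<close> is compared with one at \<open>(y - b) / 2\<close>, a ratio that can be slightly
  below \<open>2\<close>. A ratio of at least \<open>\<theta> < 2\<close> suffices, since
  \<open>\<theta>\<close> is chosen so that
  \<open>\<theta> powr (1 + \<alpha>) = 2 powr (1 + \<alpha> / 2)\<close> still exceeds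
  \<open>2\<close>.\<close>

lemma growth_minus_halving:
  assumes "growth_at_minus_infinity U" and b: "0 \<le> b"
  shows "\<exists>p q C. 0 \<le> p \<and> p < q \<and> 0 \<le> C \<and> (\<forall>x \<beta>. \<bar>\<beta>\<bar> \<le> b \<longrightarrow>
    p * U (x - \<beta>) - C \<le> U (x / 2 - \<beta>) \<and> q * U (x - \<beta>) - C \<le> U (x / 2 - \<beta>))"
proof -
  obtain \<alpha> x0 where conc: "concave_on UNIV U" and mono: "mono U" and U0: "U 0 = 0"
    and \<alpha>: "0 < \<alpha>" and x0: "x0 \<le> 0"
    and growth: "\<And>x l. x \<le> x0 \<Longrightarrow> 1 \<le> l \<Longrightarrow> U (l * x) \<le> l powr (1 + \<alpha>) * U x"
    using assms(1) unfolding growth_at_minus_infinity_def by blast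
  define \<theta> where "\<theta> = 2 powr ((1 + \<alpha> / 2) / (1 + \<alpha>))"
  define p where "p = 2 powr (- (1 + \<alpha> / 2))"
  have \<theta>: "1 \<le> \<theta>" "\<theta> < 2"
  proof -
    have "2 powr 0 \<le> 2 powr ((1 + \<alpha> / 2) / (1 + \<alpha>))" using \<alpha> by (intro powr_mono) auto
    then show "1 \<le> \<theta>" by (simp add: \<theta>_def)
    have "2 powr ((1 + \<alpha> / 2) / (1 + \<alpha>)) < 2 powr 1" using \<alpha> by (intro powr_less_mono) (auto simp: field_simps)
    then show "\<theta> < 2" by (simp add: \<theta>_def)
  qed
  have \<theta>_powr: "\<theta> powr (1 + \<alpha>) = 2 powr (1 + \<alpha> / 2)"
    using \<alpha> by (simp add: \<theta>_def powr_powr)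
  have p: "0 \<le> p" "p < 1 / 2"
  proof -
    have "2 powr (- (1 + \<alpha> / 2)) < 2 powr (- 1)" using \<alpha> by (intro powr_less_mono) auto
    then show "p < 1 / 2" by (simp add: p_def powr_minus_divide)
  qed (simp add: p_def)
  \<comment> \<open>For \<open>y \<le> - y0\<close> the first entry makes the ratio
    \<open>y / w\<close> below at least \<open>\<theta>\<close>, and the second gives
    \<open>w \<le> x0\<close>; adding \<open>1\<close> keeps \<open>y0\<close> positive.\<close>
  define y0 where "y0 = max (\<theta> * b / (2 - \<theta>)) (- 2 * x0) + 1"
  have y0: "0 < y0" "\<theta> * b / (2 - \<theta>) \<le> y0" "- 2 * x0 \<le> y0"
    using \<theta> b x0 by (auto simp: y0_def max_def intro: order.strict_trans2)
  define C where "C = - U (- b) - U (- y0)"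
  have signs: "0 \<le> - U (- b)" "0 \<le> - U (- y0)"
    using monoD[OF mono, of "- b" 0] monoD[OF mono, of "- y0" 0] U0 b y0 by auto
  have main: "p * U (x - \<beta>) - C \<le> U (x / 2 - \<beta>) \<and> 1 / 2 * U (x - \<beta>) - C \<le> U (x / 2 - \<beta>)"
    if \<beta>: "\<bar>\<beta>\<bar> \<le> b" for x \<beta>
  proof -
    define y where "y = x - \<beta>"
    have half: "U y / 2 + U (- b) \<le> U (x / 2 - \<beta>)"
      unfolding y_def by (rule concave_halving[OF conc mono U0 \<beta>])
    consider "0 \<le> U y" | "U y < 0" "y \<le> - y0" | "U y < 0" "- y0 < y" by linarith
    then have "p * U y - C \<le> U (x / 2 - \<beta>)"
    proof cases
      case 1
      then have "p * U y \<le> 1 / 2 * U y"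
        using p by (intro mult_right_mono) auto
      then show ?thesis using half signs by (simp add: C_def)
    next
      case 2
      define w where "w = (y - b) / 2"
      define l where "l = y / w"
      have w: "w < 0" "w \<le> x0" using 2 y0 b by (auto simp: w_def)
      have y: "y = l * w" using w by (simp add: l_def)
      have "\<theta> \<le> l"
      proof -
        have "\<theta> * b \<le> y0 * (2 - \<theta>)" using y0(2) \<theta> by (simp add: pos_divide_le_eq)
        also have "\<dots> \<le> - y * (2 - \<theta>)" using 2 \<theta> by (intro mult_right_mono) auto
        finally have "y \<le> \<theta> * w" by (simp add: w_def field_simps)
        then show ?thesis using w by (simp add: l_def neg_le_divide_eq)
      qed
      then have l: "1 \<le> l" "2 powr (1 + \<alpha> / 2) \<le> l powr (1 + \<alpha>)"
        using \<theta> \<alpha> unfolding \<theta>_powr[symmetric] by (auto intro!: powr_mono2)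
      have "U w \<le> 0" using monoD[OF mono, of w 0] w U0 by simp
      have "U y \<le> l powr (1 + \<alpha>) * U w"
        unfolding y by (rule growth[OF w(2) l(1)])
      also have "\<dots> \<le> 2 powr (1 + \<alpha> / 2) * U w"
        using l \<open>U w \<le> 0\<close> by (intro mult_right_mono_neg) auto
      finally have "p * U y \<le> p * (2 powr (1 + \<alpha> / 2) * U w)"
        using p by (intro mult_left_mono) auto
      also have "p * (2 powr (1 + \<alpha> / 2) * U w) = U w"
      proof -
        have "p * 2 powr (1 + \<alpha> / 2) = 2 powr (- (1 + \<alpha> / 2) + (1 + \<alpha> / 2))"
          unfolding p_def by (rule powr_add[symmetric])
        then show ?thesis by (simp flip: mult.assoc)
      qed
      also have "U w \<le> U (x / 2 - \<beta>)"
        using \<beta> by (intro monoD[OF mono]) (auto simp: y_def w_def field_simps)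
      finally show ?thesis using signs by (simp add: C_def)
    next
      case 3
      have "U (- y0) \<le> U y" using 3 by (intro monoD[OF mono]) auto
      moreover have "p * U y \<le> 0" using 3 p by (intro mult_nonneg_nonpos) auto
      ultimately show ?thesis using half signs by (simp add: C_def)
    qed
    then show ?thesis using half signs by (simp add: y_def C_def)
  qed
  have "0 \<le> C" using signs by (simp add: C_def)
  then show ?thesis
    using p main by (intro exI[of _ p] exI[of _ "1 / 2"] exI[of _ C]) auto
qed

section \<open>Conditional expectations and measurable selection\<close>

context sigma_finite_subalgebra
begin

lemma measurable_F_imp_M [measurable_dest]: "f \<in> measurable F N \<Longrightarrow> f \<in> measurable M N"
  by (rule measurable_from_subalg[OF subalg])

lemma sets_F_imp_M: "A \<in> sets F \<Longrightarrow> A \<in> sets M"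
  using subalg by (auto simp: subalgebra_def)

lemma space_F: "space F = space M"
  using subalg by (simp add: subalgebra_def)

lemma nn_cond_exp_const: "AE \<omega> in M. nn_cond_exp M F (\<lambda>_. c) \<omega> = c"
  using nn_cond_exp_F_meas[of "\<lambda>_. c"] by (auto elim!: eventually_mono)

lemma nn_cond_exp_cmult:
  assumes "f \<in> borel_measurable M"
  shows "AE \<omega> in M. nn_cond_exp M F (\<lambda>\<omega>. c * f \<omega>) \<omega> = c * nn_cond_exp M F f \<omega>"
  using nn_cond_exp_prod[of "\<lambda>_. c" f] assms by (auto elim!: eventually_mono)

text \<open>On the \<open>F\<close>-set where \<open>N\<close> equals \<open>i\<close> the glued
  function is \<open>f i\<close>, and the indicator of this set can be pulled out; countably many
  exceptional null sets are united. On the right the index is frozen at \<open>\<omega>\<close>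
  before conditioning. Every later gluing of positions rests on this.\<close>

lemma nn_cond_exp_patch:
  fixes f :: "'i::countable \<Rightarrow> 'a \<Rightarrow> ennreal"
  assumes f [measurable]: "\<And>i. f i \<in> borel_measurable M"
    and N [measurable]: "N \<in> measurable F (count_space UNIV)"
  shows "AE \<omega> in M. nn_cond_exp M F (\<lambda>\<omega>. f (N \<omega>) \<omega>) \<omega> = nn_cond_exp M F (f (N \<omega>)) \<omega>"
proof -
  have [measurable]: "N \<in> measurable M (count_space UNIV)"
    by (rule measurable_F_imp_M[OF N])
  have [measurable]: "(\<lambda>\<omega>. f (N \<omega>) \<omega>) \<in> borel_measurable M"
    by measurable
  have "AE \<omega> in M. indicator {\<omega>. N \<omega> = i} \<omega> * nn_cond_exp M F (\<lambda>\<omega>. f (N \<omega>) \<omega>) \<omega>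
      = indicator {\<omega>. N \<omega> = i} \<omega> * nn_cond_exp M F (f i) \<omega>" for i
  proof -
    have ind [measurable]: "(indicator {\<omega>. N \<omega> = i} :: 'a \<Rightarrow> ennreal) \<in> borel_measurable F"
    proof -
      have "(\<lambda>\<omega>. if N \<omega> = i then 1 else 0 :: ennreal) \<in> borel_measurable F"
        by measurable
      also have "(\<lambda>\<omega>. if N \<omega> = i then 1 else 0 :: ennreal) = indicator {\<omega>. N \<omega> = i}"
        by (auto simp: fun_eq_iff)
      finally show ?thesis .
    qed
    have eq: "(\<lambda>\<omega>. indicator {\<omega>. N \<omega> = i} \<omega> * f (N \<omega>) \<omega>) = (\<lambda>\<omega>. indicator {\<omega>. N \<omega> = i} \<omega> * f i \<omega>)"
      by (auto simp: fun_eq_iff split: split_indicator)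
    have "AE \<omega> in M. indicator {\<omega>. N \<omega> = i} \<omega> * nn_cond_exp M F (\<lambda>\<omega>. f (N \<omega>) \<omega>) \<omega>
        = nn_cond_exp M F (\<lambda>\<omega>. indicator {\<omega>. N \<omega> = i} \<omega> * f (N \<omega>) \<omega>) \<omega>"
      by (rule nn_cond_exp_prod) auto
    moreover have "AE \<omega> in M. indicator {\<omega>. N \<omega> = i} \<omega> * nn_cond_exp M F (f i) \<omega>
        = nn_cond_exp M F (\<lambda>\<omega>. indicator {\<omega>. N \<omega> = i} \<omega> * f i \<omega>) \<omega>"
      by (rule nn_cond_exp_prod) auto
    ultimately show ?thesis
      unfolding eq by eventually_elim simp
  qed
  then have "AE \<omega> in M. \<forall>i. indicator {\<omega>. N \<omega> = i} \<omega> * nn_cond_exp M F (\<lambda>\<omega>. f (N \<omega>) \<omega>) \<omega>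
      = indicator {\<omega>. N \<omega> = i} \<omega> * nn_cond_exp M F (f i) \<omega>"
    by (simp add: AE_all_countable)
  then show ?thesis
  proof eventually_elim
    case (elim \<omega>)
    show ?case using elim[rule_format, of "N \<omega>"] by simp
  qed
qed

text \<open>Monotone convergence on each \<open>F\<close>-set gives the supremum of the conditional
  expectations exactly the integrals that characterise the right-hand side.\<close>

lemma nn_cond_exp_SUP:
  fixes f :: "nat \<Rightarrow> 'a \<Rightarrow> ennreal"
  assumes f [measurable]: "\<And>n. f n \<in> borel_measurable M" and "\<And>\<omega>. incseq (\<lambda>n. f n \<omega>)"
  shows "AE \<omega> in M. (SUP n. nn_cond_exp M F (f n) \<omega>) = nn_cond_exp M F (\<lambda>\<omega>. SUP n. f n \<omega>) \<omega>"
proof (rule nn_cond_exp_charact)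
  fix A assume A: "A \<in> sets F"
  then have [measurable]: "A \<in> sets M" by (rule sets_F_imp_M)
  have mono: "AE \<omega> in M. \<forall>n. nn_cond_exp M F (f n) \<omega> \<le> nn_cond_exp M F (f (Suc n)) \<omega>"
    unfolding AE_all_countable using assms(2)
    by (intro allI nn_cond_exp_mono) (auto simp: incseq_Suc_iff)
  have int: "(\<integral>\<^sup>+x\<in>A. nn_cond_exp M F (f n) x \<partial>M) = (\<integral>\<^sup>+x\<in>A. f n x \<partial>M)" for n
    using nn_cond_exp_intg[of "indicator A" "f n"] A by (simp add: mult.commute)
  have "(\<integral>\<^sup>+x\<in>A. (SUP n. nn_cond_exp M F (f n) x) \<partial>M)
      = (\<integral>\<^sup>+x. (SUP n. nn_cond_exp M F (f n) x * indicator A x) \<partial>M)"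
    by (simp add: SUP_mult_right_ennreal)
  also have "\<dots> = (SUP n. \<integral>\<^sup>+x\<in>A. nn_cond_exp M F (f n) x \<partial>M)"
    by (rule nn_integral_monotone_convergence_SUP_AE)
      (use mono in \<open>auto elim!: eventually_mono intro!: mult_right_mono\<close>)
  also have "\<dots> = (SUP n. \<integral>\<^sup>+x\<in>A. f n x \<partial>M)"
    by (simp add: int)
  also have "\<dots> = (\<integral>\<^sup>+x. (SUP n. f n x * indicator A x) \<partial>M)"
    by (rule nn_integral_monotone_convergence_SUP[symmetric])
      (use assms(2) in \<open>auto simp: incseq_def le_fun_def intro!: mult_right_mono\<close>)
  also have "\<dots> = (\<integral>\<^sup>+x\<in>A. (SUP n. f n x) \<partial>M)"
    by (simp add: SUP_mult_right_ennreal)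
  finally show "(\<integral>\<^sup>+x\<in>A. (SUP n. f n x) \<partial>M) = (\<integral>\<^sup>+x\<in>A. (SUP n. nn_cond_exp M F (f n) x) \<partial>M)"
    by simp
qed auto

lemma nn_cond_exp_Fatou:
  fixes f :: "nat \<Rightarrow> 'a \<Rightarrow> ennreal"
  assumes f [measurable]: "\<And>n. f n \<in> borel_measurable M"
  shows "AE \<omega> in M. nn_cond_exp M F (\<lambda>\<omega>. liminf (\<lambda>n. f n \<omega>)) \<omega>
    \<le> liminf (\<lambda>n. nn_cond_exp M F (f n) \<omega>)"
proof -
  define g where "g n \<omega> = (INF m\<in>{n..}. f m \<omega>)" for n \<omega>
  have [measurable]: "g n \<in> borel_measurable M" for n
    unfolding g_def by measurable
  have "AE \<omega> in M. (SUP n. nn_cond_exp M F (g n) \<omega>) = nn_cond_exp M F (\<lambda>\<omega>. SUP n. g n \<omega>) \<omega>"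
    by (rule nn_cond_exp_SUP) (auto simp: g_def incseq_def intro!: INF_superset_mono)
  moreover have "AE \<omega> in M. \<forall>n. \<forall>m\<in>{n..}. nn_cond_exp M F (g n) \<omega> \<le> nn_cond_exp M F (f m) \<omega>"
    unfolding AE_all_countable
    by (intro allI AE_ball_countable[THEN iffD2] ballI nn_cond_exp_mono)
       (auto simp: g_def intro!: INF_lower AE_I2)
  ultimately show ?thesis
  proof eventually_elim
    case (elim \<omega>)
    have "nn_cond_exp M F (\<lambda>\<omega>. liminf (\<lambda>n. f n \<omega>)) \<omega> = (SUP n. nn_cond_exp M F (g n) \<omega>)"
      using elim(1) by (simp add: g_def liminf_SUP_INF)
    also have "\<dots> \<le> (SUP n. INF m\<in>{n..}. nn_cond_exp M F (f m) \<omega>)"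
      using elim(2) by (intro SUP_mono) (auto intro!: INF_greatest)
    finally show ?case by (simp add: liminf_SUP_INF)
  qed
qed

lemma nn_integral_nn_cond_exp:
  assumes "f \<in> borel_measurable M"
  shows "(\<integral>\<^sup>+\<omega>. nn_cond_exp M F f \<omega> \<partial>M) = (\<integral>\<^sup>+\<omega>. f \<omega> \<partial>M)"
  using nn_cond_exp_intg[of "\<lambda>_. 1" f] assms by simp

end

section \<open>Exhaustion and measurable subsequences\<close>

text \<open>Exhaustion: absorb a sequence of members whose measures approach the supremum
  \<open>s\<close> into one member \<open>B\<close>, which then has measure \<open>s\<close>. A
  member not almost surely inside \<open>B\<close> could be absorbed together with \<open>B\<close>
  into a member of measure above \<open>s\<close>.\<close>

lemma (in finite_measure) AE_maximal_set:
  assumes ne: "\<A> \<noteq> {}" and sub: "\<A> \<subseteq> sets M"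
    and cl: "\<And>A :: nat \<Rightarrow> 'a set. range A \<subseteq> \<A> \<Longrightarrow> \<exists>B\<in>\<A>. AE \<omega> in M. \<omega> \<in> (\<Union>n. A n) \<longrightarrow> \<omega> \<in> B"
  shows "\<exists>B\<in>\<A>. \<forall>A\<in>\<A>. AE \<omega> in M. \<omega> \<in> A \<longrightarrow> \<omega> \<in> B"
proof -
  define s where "s = (SUP A\<in>\<A>. measure M A)"
  have bdd: "bdd_above (measure M ` \<A>)"
    by (rule bdd_aboveI[of _ "measure M (space M)"]) (auto intro: bounded_measure)
  have le_s: "measure M A \<le> s" if "A \<in> \<A>" for A
    unfolding s_def using that bdd by (rule cSUP_upper)
  have "\<exists>A\<in>\<A>. measure M A > s - 1 / Suc n" for n
    using less_cSUP_iff[OF ne bdd, of "s - 1 / Suc n"] by (auto simp: s_def)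
  then obtain A where A: "\<And>n. A n \<in> \<A>" "\<And>n. measure M (A n) > s - 1 / Suc n"
    by metis
  obtain B where B: "B \<in> \<A>" "AE \<omega> in M. \<omega> \<in> (\<Union>n. A n) \<longrightarrow> \<omega> \<in> B"
    using cl[of A] A(1) by auto
  have "measure M B \<ge> s"
  proof (rule LIMSEQ_le_const2)
    show "(\<lambda>n. s - 1 / Suc n) \<longlonglongrightarrow> s"
      using tendsto_diff[OF tendsto_const LIMSEQ_inverse_real_of_nat, of s] by (simp add: divide_inverse)
    have "measure M (A n) \<le> measure M B" for n
    proof (rule finite_measure_mono_AE)
      show "AE \<omega> in M. \<omega> \<in> A n \<longrightarrow> \<omega> \<in> B"
        using B(2) by eventually_elim auto
    qed (use B sub in auto)
    then show "\<exists>N. \<forall>n\<ge>N. s - 1 / Suc n \<le> measure M B"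
      using A(2) by (metis less_le_trans less_imp_le)
  qed
  have "AE \<omega> in M. \<omega> \<in> D \<longrightarrow> \<omega> \<in> B" if D: "D \<in> \<A>" for D
  proof -
    have "range (\<lambda>n :: nat. if n = 0 then B else D) \<subseteq> \<A>"
      using D B(1) by auto
    from cl[OF this] obtain E where E: "E \<in> \<A>"
      "AE \<omega> in M. \<omega> \<in> (\<Union>n :: nat. (if n = 0 then B else D)) \<longrightarrow> \<omega> \<in> E"
      by blast
    have un: "(\<Union>n :: nat. (if n = 0 then B else D)) = B \<union> D"
      by (auto split: if_splits)
    have [measurable]: "B \<in> sets M" "D \<in> sets M" "E \<in> sets M"
      using sub B D E by auto
    have "measure M (B \<union> D) \<le> measure M E"
      using E(2) unfolding un by (intro finite_measure_mono_AE) auto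
    also have "\<dots> \<le> measure M B"
      using le_s[OF E(1)] \<open>measure M B \<ge> s\<close> by simp
    finally have "measure M (D - B) \<le> 0"
      using finite_measure_Union[of B "D - B"] by (simp add: Un_Diff_cancel)
    then have "D - B \<in> null_sets M"
      by (intro null_setsI) (auto simp: emeasure_eq_measure measure_le_0_iff)
    then show ?thesis
      by (auto dest!: AE_not_in elim!: eventually_mono)
  qed
  then show ?thesis using B(1) by auto
qed

text \<open>Bolzano-Weierstrass with indices depending measurably on \<open>\<omega>\<close>, one
  coordinate at a time. The result asks only for \<open>N k \<omega> \<ge> k\<close>, not for
  monotonicity in \<open>k\<close>; that already makes composition preserve limits.\<close>

lemma random_subsequence_real:
  fixes h :: "'b \<Rightarrow> nat \<Rightarrow> 'a \<Rightarrow> real"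
  assumes "finite B"
    and h [measurable]: "\<And>b n. b \<in> B \<Longrightarrow> h b n \<in> borel_measurable F"
    and bd: "\<And>b \<omega>. b \<in> B \<Longrightarrow> \<omega> \<in> space F \<Longrightarrow> bounded (range (\<lambda>n. h b n \<omega>))"
  shows "\<exists>N. (\<forall>k. N k \<in> measurable F (count_space (UNIV :: nat set))) \<and>
    (\<forall>\<omega>\<in>space F. \<forall>k. N k \<omega> \<ge> k) \<and>
    (\<forall>b\<in>B. \<forall>\<omega>\<in>space F. convergent (\<lambda>k. h b (N k \<omega>) \<omega>))"
  using assms
proof (induction B)
  case empty
  show ?case by (rule exI[of _ "\<lambda>k \<omega>. k"]) auto
next
  case (insert b B)
  have "\<exists>N. (\<forall>k. N k \<in> measurable F (count_space (UNIV :: nat set))) \<and>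
    (\<forall>\<omega>\<in>space F. \<forall>k. N k \<omega> \<ge> k) \<and>
    (\<forall>b\<in>B. \<forall>\<omega>\<in>space F. convergent (\<lambda>k. h b (N k \<omega>) \<omega>))"
    using insert.prems by (intro insert.IH) auto
  then obtain N where N [measurable]: "\<And>k. N k \<in> measurable F (count_space (UNIV :: nat set))"
    and Nk: "\<And>\<omega> k. \<omega> \<in> space F \<Longrightarrow> N k \<omega> \<ge> k"
    and conv: "\<And>b \<omega>. b \<in> B \<Longrightarrow> \<omega> \<in> space F \<Longrightarrow> convergent (\<lambda>k. h b (N k \<omega>) \<omega>)"
    by blast
  have [measurable]: "h b n \<in> borel_measurable F" for n
    using insert by auto
  define g where "g k \<omega> = h b (N k \<omega>) \<omega>" for k \<omega>
  have [measurable]: "g k \<in> borel_measurable F" for k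
    unfolding g_def by measurable
  have gb: "bounded (range (\<lambda>k. g k \<omega>))" if "\<omega> \<in> space F" for \<omega>
    using insert.prems(2)[of b \<omega>] that by (auto simp: g_def intro: bounded_subset)
  define l where "l \<omega> = real_of_ereal (limsup (\<lambda>k. ereal (g k \<omega>)))" for \<omega>
  have [measurable]: "l \<in> borel_measurable F"
    unfolding l_def by measurable
  \<comment> \<open>The target \<open>l\<close> is the limit superior, which is measurable and is
    approached along infinitely many indices. Taking the least suitable index keeps the choice
    measurable.\<close>
  define m where "m j \<omega> = (LEAST k. k \<ge> j \<and> \<bar>g k \<omega> - l \<omega>\<bar> < 1 / Suc j)" for j \<omega>
  have [measurable]: "m j \<in> measurable F (count_space UNIV)" for j
    unfolding m_def by measurable
  have ex: "\<exists>k. k \<ge> j \<and> \<bar>g k \<omega> - l \<omega>\<bar> < 1 / Suc j" if \<omega>: "\<omega> \<in> space F" for j \<omega>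
  proof -
    obtain r where r: "strict_mono r" "((\<lambda>k. ereal (g k \<omega>)) \<circ> r) \<longlonglongrightarrow> limsup (\<lambda>k. ereal (g k \<omega>))"
      using limsup_subseq_lim by blast
    obtain C where C: "\<And>k. \<bar>g k \<omega>\<bar> \<le> C"
      using gb[OF \<omega>] by (auto simp: bounded_iff)
    have "limsup (\<lambda>k. ereal (g k \<omega>)) \<le> ereal C"
      using C by (intro Limsup_bounded) (auto simp: abs_le_iff)
    moreover have "ereal (- C) \<le> limsup (\<lambda>k. ereal (g k \<omega>))"
    proof (rule order_trans[OF _ Liminf_le_Limsup])
      show "ereal (- C) \<le> liminf (\<lambda>k. ereal (g k \<omega>))"
        using C by (intro Liminf_bounded always_eventually) (auto simp: abs_le_iff minus_le_iff)
    qed auto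
    ultimately have "ereal (l \<omega>) = limsup (\<lambda>k. ereal (g k \<omega>))"
      unfolding l_def by (intro ereal_real') auto
    then have "(\<lambda>k. g (r k) \<omega>) \<longlonglongrightarrow> l \<omega>"
      using r(2) by (simp add: comp_def flip: lim_ereal)
    then obtain n where n: "\<And>k. k \<ge> n \<Longrightarrow> dist (g (r k) \<omega>) (l \<omega>) < 1 / Suc j"
      unfolding lim_sequentially by (metis of_nat_0_less_iff zero_less_Suc zero_less_divide_1_iff)
    show ?thesis
      using n[of "max n j"] seq_suble[OF r(1), of "max n j"]
      by (intro exI[of _ "r (max n j)"]) (auto simp: dist_real_def)
  qed
  have mj: "m j \<omega> \<ge> j" "\<bar>g (m j \<omega>) \<omega> - l \<omega>\<bar> < 1 / Suc j" if "\<omega> \<in> space F" for j \<omega>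
    using LeastI_ex[OF ex[OF that], of j] unfolding m_def by auto
  have lim: "(\<lambda>j. g (m j \<omega>) \<omega>) \<longlonglongrightarrow> l \<omega>" if "\<omega> \<in> space F" for \<omega>
  proof (rule LIM_zero_cancel, rule Lim_null_comparison)
    show "\<forall>\<^sub>F j in sequentially. norm (g (m j \<omega>) \<omega> - l \<omega>) \<le> 1 / Suc j"
      using mj(2)[OF that] by (auto intro!: always_eventually less_imp_le)
    show "(\<lambda>j. 1 / real (Suc j)) \<longlonglongrightarrow> 0"
      using LIMSEQ_inverse_real_of_nat by (simp add: divide_inverse)
  qed
  have inf: "filterlim (\<lambda>j. m j \<omega>) sequentially sequentially" if "\<omega> \<in> space F" for \<omega>
    by (rule filterlim_at_top_mono[OF filterlim_ident]) (use mj(1)[OF that] in auto)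
  show ?case
  proof (intro exI[of _ "\<lambda>j \<omega>. N (m j \<omega>) \<omega>"] conjI allI ballI)
    show "(\<lambda>\<omega>. N (m j \<omega>) \<omega>) \<in> measurable F (count_space UNIV)" for j
      by measurable
    show "N (m j \<omega>) \<omega> \<ge> j" if "\<omega> \<in> space F" for j \<omega>
      using Nk[OF that, of "m j \<omega>"] mj(1)[OF that, of j] by simp
    show "convergent (\<lambda>j. h c (N (m j \<omega>) \<omega>) \<omega>)" if "c \<in> insert b B" "\<omega> \<in> space F" for c \<omega>
    proof (cases "c = b")
      case True
      then show ?thesis using lim[OF that(2)] by (auto simp: g_def convergent_def)
    next
      case False
      then have "convergent (\<lambda>k. h c (N k \<omega>) \<omega>)"
        using conv[of c \<omega>] that by simp
      then obtain L where "(\<lambda>k. h c (N k \<omega>) \<omega>) \<longlonglongrightarrow> L"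
        by (auto simp: convergent_def)
      from filterlim_compose[OF this inf[OF that(2)]] show ?thesis
        by (auto simp: convergent_def)
    qed
  qed
qed

lemma random_subsequence:
  fixes f :: "nat \<Rightarrow> 'a \<Rightarrow> 'b::euclidean_space"
  assumes f [measurable]: "\<And>n. f n \<in> borel_measurable F" and D [measurable]: "D \<in> sets F"
    and bd: "\<And>\<omega>. \<omega> \<in> D \<Longrightarrow> bounded (range (\<lambda>n. f n \<omega>))"
  obtains N :: "nat \<Rightarrow> 'a \<Rightarrow> nat" and g where
    "\<And>k. N k \<in> measurable F (count_space UNIV)" "\<And>\<omega> k. \<omega> \<in> space F \<Longrightarrow> N k \<omega> \<ge> k"
    "g \<in> borel_measurable F" "\<And>\<omega>. \<omega> \<in> D \<Longrightarrow> (\<lambda>k. f (N k \<omega>) \<omega>) \<longlonglongrightarrow> g \<omega>"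
    "\<And>\<omega>. \<omega> \<notin> D \<Longrightarrow> g \<omega> = 0"
proof -
  \<comment> \<open>The indicator makes the coordinates bounded outside \<open>D\<close> as well, so
    a subsequence exists on the whole space and the limit is \<open>0\<close> off
    \<open>D\<close>.\<close>
  define h where "h b n \<omega> = (indicator D \<omega> *\<^sub>R f n \<omega>) \<bullet> b" for b n \<omega>
  have [measurable]: "h b n \<in> borel_measurable F" for b n
    unfolding h_def by measurable
  have hb: "bounded (range (\<lambda>n. h b n \<omega>))" if "b \<in> Basis" for b \<omega>
  proof (cases "\<omega> \<in> D")
    case True
    then obtain C where C: "\<And>n. norm (f n \<omega>) \<le> C"
      using bd[OF True] by (auto simp: bounded_iff)
    have "\<bar>f n \<omega> \<bullet> b\<bar> \<le> C" for n
      using Basis_le_norm[OF that] C order_trans by blast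
    then show ?thesis using True by (auto simp: h_def bounded_iff)
  qed (auto simp: h_def bounded_iff)
  have "\<exists>N. (\<forall>k. N k \<in> measurable F (count_space (UNIV :: nat set))) \<and>
    (\<forall>\<omega>\<in>space F. \<forall>k. N k \<omega> \<ge> k) \<and>
    (\<forall>b\<in>Basis. \<forall>\<omega>\<in>space F. convergent (\<lambda>k. h b (N k \<omega>) \<omega>))"
    by (rule random_subsequence_real) (use hb in auto)
  then obtain N where N: "\<And>k. N k \<in> measurable F (count_space (UNIV :: nat set))"
     "\<And>\<omega> k. \<omega> \<in> space F \<Longrightarrow> N k \<omega> \<ge> k"
    and conv: "\<And>b \<omega>. b \<in> Basis \<Longrightarrow> \<omega> \<in> space F \<Longrightarrow> convergent (\<lambda>k. h b (N k \<omega>) \<omega>)"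
    by blast
  note N(1)[measurable]
  define g where "g \<omega> = lim (\<lambda>k. indicator D \<omega> *\<^sub>R f (N k \<omega>) \<omega>)" for \<omega>
  show ?thesis
  proof
    show "g \<in> borel_measurable F"
      unfolding g_def by measurable
    show "(\<lambda>k. f (N k \<omega>) \<omega>) \<longlonglongrightarrow> g \<omega>" if "\<omega> \<in> D" for \<omega>
    proof -
      have \<omega>: "\<omega> \<in> space F" using sets.sets_into_space[OF D] that by auto
      have "\<forall>b\<in>Basis. \<exists>L. (\<lambda>k. f (N k \<omega>) \<omega> \<bullet> b) \<longlonglongrightarrow> L"
        using conv[OF _ \<omega>] that by (auto simp: h_def convergent_def)
      then obtain L where L: "\<And>b. b \<in> Basis \<Longrightarrow> (\<lambda>k. f (N k \<omega>) \<omega> \<bullet> b) \<longlonglongrightarrow> L b"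
        by metis
      have "(\<lambda>k. f (N k \<omega>) \<omega>) \<longlonglongrightarrow> (\<Sum>b\<in>Basis. L b *\<^sub>R b)"
        unfolding tendsto_componentwise_iff[of _ "\<Sum>b\<in>Basis. L b *\<^sub>R b"] using L by simp
      then show ?thesis using that limI by (fastforce simp: g_def)
    qed
    show "g \<omega> = 0" if "\<omega> \<notin> D" for \<omega>
      using that by (simp add: g_def)
  qed (use N in auto)
qed

section \<open>Random concave functions at random arguments\<close>

lemma concave_on_imp_isCont:
  fixes f :: "real \<Rightarrow> real"
  assumes "concave_on UNIV f"
  shows "isCont f x"
proof -
  have "continuous_on UNIV (\<lambda>x. - f x)"
    using assms by (intro convex_on_continuous) (auto simp: concave_on_def)
  then have "continuous_on UNIV (\<lambda>x. - (- f x))"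
    by (rule continuous_on_minus)
  then show ?thesis
    by (simp add: continuous_on_eq_continuous_at)
qed

text \<open>Rounding up to a multiple of \<open>1 / (n + 1)\<close>: the countable range allows
  gluing over constant arguments, and the upward direction never lowers a nondecreasing
  function.\<close>

definition grid_above :: "nat \<Rightarrow> real \<Rightarrow> real" where
  "grid_above n x = real_of_int \<lceil>real (Suc n) * x\<rceil> / real (Suc n)"

lemma grid_above_ge: "x \<le> grid_above n x"
  unfolding grid_above_def by (simp add: field_simps del: of_nat_Suc)

lemma grid_above_le: "grid_above n x \<le> x + 1 / real (Suc n)"
proof -
  have "real_of_int \<lceil>real (Suc n) * x\<rceil> \<le> real (Suc n) * x + 1"
    by linarith
  then show ?thesis
    unfolding grid_above_def by (simp add: field_simps del: of_nat_Suc)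
qed

lemma grid_above_le1: "grid_above n x \<le> x + 1"
proof -
  have "1 / real (Suc n) \<le> 1" by simp
  then show ?thesis using grid_above_le[of n x] by linarith
qed

lemma grid_above_tendsto: "(\<lambda>n. grid_above n x) \<longlonglongrightarrow> x"
proof (rule tendsto_sandwich[where f = "\<lambda>_. x" and h = "\<lambda>n. x + 1 / real (Suc n)"])
  show "(\<lambda>n. x + 1 / real (Suc n)) \<longlonglongrightarrow> x"
    using tendsto_add[OF tendsto_const LIMSEQ_inverse_real_of_nat, of x] by (simp add: divide_inverse)
qed (use grid_above_ge grid_above_le in \<open>auto simp del: of_nat_Suc\<close>)

lemma borel_measurable_grid [measurable]: "grid_above n \<in> borel_measurable borel"
  unfolding grid_above_def by measurable

text \<open>With \<open>X\<close> rounded to the grid the composition is a countable gluing of the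
  measurable \<open>V x\<close>; continuity of concave functions removes the rounding.\<close>

lemma borel_measurable_random_function:
  fixes V :: "real \<Rightarrow> 'a \<Rightarrow> real"
  assumes V [measurable]: "\<And>x. V x \<in> borel_measurable N"
    and cont: "\<And>\<omega>. concave_on UNIV (\<lambda>x. V x \<omega>)"
    and X [measurable]: "X \<in> borel_measurable N"
  shows "(\<lambda>\<omega>. V (X \<omega>) \<omega>) \<in> borel_measurable N"
proof (rule borel_measurable_LIMSEQ_real)
  show "(\<lambda>n. V (grid_above n (X \<omega>)) \<omega>) \<longlonglongrightarrow> V (X \<omega>) \<omega>" for \<omega>
    by (rule isCont_tendsto_compose[OF concave_on_imp_isCont[OF cont] grid_above_tendsto])
  show "(\<lambda>\<omega>. V (grid_above n (X \<omega>)) \<omega>) \<in> borel_measurable N" for n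
  proof -
    have [measurable]: "(\<lambda>\<omega>. \<lceil>real (Suc n) * X \<omega>\<rceil>) \<in> measurable N (count_space UNIV)"
      by measurable
    have "(\<lambda>\<omega>. (\<lambda>i :: int. V (real_of_int i / real (Suc n))) (\<lceil>real (Suc n) * X \<omega>\<rceil>) \<omega>) \<in> borel_measurable N"
      by (rule measurable_compose_countable[OF V]) measurable
    then show ?thesis by (simp add: grid_above_def)
  qed
qed

lemma (in sigma_finite_subalgebra) nn_cond_exp_sum_finite:
  fixes f :: "'i \<Rightarrow> 'a \<Rightarrow> ennreal"
  assumes "finite I" and f [measurable]: "\<And>i. f i \<in> borel_measurable M"
    and fin: "\<And>i. AE \<omega> in M. nn_cond_exp M F (f i) \<omega> < \<infinity>"
  shows "AE \<omega> in M. nn_cond_exp M F (\<lambda>\<omega>. \<Sum>i\<in>I. f i \<omega>) \<omega> < \<infinity>"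
  using \<open>finite I\<close>
proof induction
  case empty
  then show ?case using nn_cond_exp_const[of 0] by auto
next
  case (insert i I)
  have sum: "AE \<omega> in M. nn_cond_exp M F (f i) \<omega> + nn_cond_exp M F (\<lambda>\<omega>. \<Sum>i\<in>I. f i \<omega>) \<omega>
      = nn_cond_exp M F (\<lambda>\<omega>. f i \<omega> + (\<Sum>i\<in>I. f i \<omega>)) \<omega>"
    by (rule nn_cond_exp_sum) measurable
  have eq: "(\<lambda>\<omega>. \<Sum>j\<in>insert i I. f j \<omega>) = (\<lambda>\<omega>. f i \<omega> + (\<Sum>i\<in>I. f i \<omega>))"
    using insert.hyps by simp
  from sum show ?case
    using insert.IH fin[of i]
  proof eventually_elim
    case (elim \<omega>)
    show ?case
      unfolding eq elim(1)[symmetric] using elim(2,3) by simp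
  qed
qed

section \<open>Generalised conditional expectations through their positive and negative
  parts\<close>

context sigma_finite_subalgebra
begin

abbreviation cpos :: "('a \<Rightarrow> real) \<Rightarrow> 'a \<Rightarrow> ennreal" where
  "cpos f \<equiv> nn_cond_exp M F (\<lambda>\<omega>. ennreal (f \<omega>))"

abbreviation cneg :: "('a \<Rightarrow> real) \<Rightarrow> 'a \<Rightarrow> ennreal" where
  "cneg f \<equiv> nn_cond_exp M F (\<lambda>\<omega>. ennreal (- f \<omega>))"

lemma borel_measurable_gen_cond_exp [measurable]: "gen_cond_exp M F f \<in> borel_measurable F"
  unfolding gen_cond_exp_def by measurable

lemma le_gen_cond_exp_iff:
  assumes "cpos f \<omega> < \<infinity>"
  shows "ereal g \<le> gen_cond_exp M F f \<omega> \<longleftrightarrow>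
    cneg f \<omega> < \<infinity> \<and> g \<le> enn2real (cpos f \<omega>) - enn2real (cneg f \<omega>)"
  using assms unfolding gen_cond_exp_def
  by (cases "cpos f \<omega>"; cases "cneg f \<omega>") auto

lemma gen_cond_exp_eq_real:
  assumes "cpos f \<omega> < \<infinity>" "cneg f \<omega> < \<infinity>"
  shows "gen_cond_exp M F f \<omega> = ereal (enn2real (cpos f \<omega>) - enn2real (cneg f \<omega>))"
  using assms unfolding gen_cond_exp_def
  by (cases "cpos f \<omega>"; cases "cneg f \<omega>") auto

lemma gen_cond_exp_patch:
  fixes f :: "'i::countable \<Rightarrow> 'a \<Rightarrow> real"
  assumes [measurable]: "\<And>i. f i \<in> borel_measurable M" "N \<in> measurable F (count_space UNIV)"
  shows "AE \<omega> in M. gen_cond_exp M F (\<lambda>\<omega>. f (N \<omega>) \<omega>) \<omega> = gen_cond_exp M F (f (N \<omega>)) \<omega>"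
  using nn_cond_exp_patch[of "\<lambda>i \<omega>. ennreal (f i \<omega>)" N] nn_cond_exp_patch[of "\<lambda>i \<omega>. ennreal (- f i \<omega>)" N]
  unfolding gen_cond_exp_def by (auto elim: eventually_elim2)

lemma gen_cond_exp_mono:
  assumes [measurable]: "f \<in> borel_measurable M" "g \<in> borel_measurable M" and le: "AE \<omega> in M. f \<omega> \<le> g \<omega>"
  shows "AE \<omega> in M. gen_cond_exp M F f \<omega> \<le> gen_cond_exp M F g \<omega>"
proof -
  have "AE \<omega> in M. cpos f \<omega> \<le> cpos g \<omega>"
    using le by (intro nn_cond_exp_mono) (auto elim!: eventually_mono intro: ennreal_leI)
  moreover have "AE \<omega> in M. cneg g \<omega> \<le> cneg f \<omega>"
    using le by (intro nn_cond_exp_mono) (auto elim!: eventually_mono intro: ennreal_leI)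
  ultimately show ?thesis
    unfolding gen_cond_exp_def
    by eventually_elim (intro ereal_minus_mono, auto simp: less_eq_ennreal.rep_eq)
qed

lemma gen_cond_exp_cong:
  assumes [measurable]: "f \<in> borel_measurable M" "g \<in> borel_measurable M" and eq: "AE \<omega> in M. f \<omega> = g \<omega>"
  shows "AE \<omega> in M. gen_cond_exp M F f \<omega> = gen_cond_exp M F g \<omega>"
proof -
  have "AE \<omega> in M. gen_cond_exp M F f \<omega> \<le> gen_cond_exp M F g \<omega>"
    using eq by (intro gen_cond_exp_mono) auto
  moreover have "AE \<omega> in M. gen_cond_exp M F g \<omega> \<le> gen_cond_exp M F f \<omega>"
    using eq by (intro gen_cond_exp_mono) auto
  ultimately show ?thesis by eventually_elim simp
qed

text \<open>On the set \<open>D\<close> where \<open>f\<close> is infinite, \<open>f\<close>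
  dominates infinity times the indicator of \<open>D\<close>. Finiteness of its conditional
  expectation forces that of the indicator to vanish, hence \<open>D\<close> is null.\<close>

lemma nn_cond_exp_finite_imp_finite:
  assumes [measurable]: "f \<in> borel_measurable M" and fin: "AE \<omega> in M. nn_cond_exp M F f \<omega> < \<infinity>"
  shows "AE \<omega> in M. f \<omega> < \<infinity>"
proof -
  define D where "D = {\<omega>\<in>space M. f \<omega> = \<infinity>}"
  have [measurable]: "D \<in> sets M" unfolding D_def by measurable
  have "AE \<omega> in M. nn_cond_exp M F (\<lambda>\<omega>. \<infinity> * indicator D \<omega>) \<omega> \<le> nn_cond_exp M F f \<omega>"
    by (intro nn_cond_exp_mono) (auto simp: D_def split: split_indicator)
  moreover have "AE \<omega> in M. nn_cond_exp M F (\<lambda>\<omega>. \<infinity> * indicator D \<omega>) \<omega>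
      = \<infinity> * nn_cond_exp M F (indicator D) \<omega>"
    by (rule nn_cond_exp_cmult) measurable
  ultimately have "AE \<omega> in M. nn_cond_exp M F (indicator D) \<omega> = 0"
    using fin
  proof eventually_elim
    case (elim \<omega>)
    then have "\<infinity> * nn_cond_exp M F (indicator D) \<omega> < \<infinity>" by simp
    then show ?case by (auto simp: ennreal_mult_less_top)
  qed
  then have "(\<integral>\<^sup>+\<omega>. nn_cond_exp M F (indicator D) \<omega> \<partial>M) = 0"
    by (subst nn_integral_0_iff_AE) auto
  then have "emeasure M D = 0"
    by (simp add: nn_integral_nn_cond_exp)
  then have "AE \<omega> in M. \<omega> \<notin> D"
    by (intro AE_not_in) (auto simp: null_sets_def)
  then show ?thesis
    using AE_space by eventually_elim (auto simp: D_def top.not_eq_extremum)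
qed

text \<open>The hypothesis is rearranged, with superscripts for positive and negative parts, as
  \<open>q * f\<^sup>+ + h\<^sup>- \<le> h\<^sup>+ + (p * f\<^sup>- + C)\<close>. This form can be
  conditioned without any subtraction, and the finite right-hand side also yields that the negative
  part of \<open>h\<close> is conditionally finite.\<close>

lemma cond_exp_linear_bound:
  fixes f h :: "'a \<Rightarrow> real"
  assumes [measurable]: "f \<in> borel_measurable M" "h \<in> borel_measurable M"
    and nonneg: "0 \<le> p" "0 \<le> q" "0 \<le> C"
    and le: "AE \<omega> in M. q * max 0 (f \<omega>) - p * max 0 (- f \<omega>) - C \<le> h \<omega>"
    and h: "AE \<omega> in M. cpos h \<omega> < \<infinity>" and f: "AE \<omega> in M. cpos f \<omega> < \<infinity>" "AE \<omega> in M. cneg f \<omega> < \<infinity>"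
  shows "AE \<omega> in M. cneg h \<omega> < \<infinity> \<and>
    q * enn2real (cpos f \<omega>) - p * enn2real (cneg f \<omega>) - C \<le> enn2real (cpos h \<omega>) - enn2real (cneg h \<omega>)"
proof -
  let ?l = "\<lambda>\<omega>. ennreal q * ennreal (f \<omega>) + ennreal (- h \<omega>)"
  let ?r = "\<lambda>\<omega>. ennreal (h \<omega>) + (ennreal p * ennreal (- f \<omega>) + ennreal C)"
  have "AE \<omega> in M. nn_cond_exp M F ?l \<omega> \<le> nn_cond_exp M F ?r \<omega>"
  proof (rule nn_cond_exp_mono)
    show "AE \<omega> in M. ?l \<omega> \<le> ?r \<omega>"
      using le
    proof eventually_elim
      case (elim \<omega>)
      have e: "ennreal x = ennreal (max 0 x)" for x :: real
        by (simp add: max_def ennreal_neg)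
      have "q * max 0 (f \<omega>) + max 0 (- h \<omega>) \<le> max 0 (h \<omega>) + (p * max 0 (- f \<omega>) + C)"
        using elim nonneg by (auto simp: max_def split: if_splits)
      then have "ennreal (q * max 0 (f \<omega>) + max 0 (- h \<omega>)) \<le> ennreal (max 0 (h \<omega>) + (p * max 0 (- f \<omega>) + C))"
        by (rule ennreal_leI)
      then show ?case
        using nonneg
        by (subst (1 2 3 4) e) (simp add: ennreal_plus ennreal_mult)
    qed
  qed measurable
  moreover have "AE \<omega> in M. nn_cond_exp M F ?l \<omega> = ennreal q * cpos f \<omega> + cneg h \<omega>"
    using nn_cond_exp_sum[of "\<lambda>\<omega>. ennreal q * ennreal (f \<omega>)" "\<lambda>\<omega>. ennreal (- h \<omega>)"]
      nn_cond_exp_cmult[of "\<lambda>\<omega>. ennreal (f \<omega>)" "ennreal q"]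
    by (auto elim: eventually_elim2)
  moreover have "AE \<omega> in M. nn_cond_exp M F ?r \<omega> = cpos h \<omega> + (ennreal p * cneg f \<omega> + ennreal C)"
  proof -
    have "AE \<omega> in M. cpos h \<omega> + nn_cond_exp M F (\<lambda>\<omega>. ennreal p * ennreal (- f \<omega>) + ennreal C) \<omega> = nn_cond_exp M F ?r \<omega>"
      by (rule nn_cond_exp_sum) measurable
    moreover have "AE \<omega> in M. nn_cond_exp M F (\<lambda>\<omega>. ennreal p * ennreal (- f \<omega>)) \<omega> + nn_cond_exp M F (\<lambda>_. ennreal C) \<omega>
        = nn_cond_exp M F (\<lambda>\<omega>. ennreal p * ennreal (- f \<omega>) + ennreal C) \<omega>"
      by (rule nn_cond_exp_sum) measurable
    moreover have "AE \<omega> in M. nn_cond_exp M F (\<lambda>\<omega>. ennreal p * ennreal (- f \<omega>)) \<omega> = ennreal p * cneg f \<omega>"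
      by (rule nn_cond_exp_cmult) measurable
    moreover note nn_cond_exp_const[of "ennreal C"]
    ultimately show ?thesis by eventually_elim simp
  qed
  ultimately show ?thesis
    using h f
  proof eventually_elim
    case (elim \<omega>)
    define a b c where "a = enn2real (cpos f \<omega>)" and "b = enn2real (cneg f \<omega>)" and "c = enn2real (cpos h \<omega>)"
    have ab: "cpos f \<omega> = ennreal a" "cneg f \<omega> = ennreal b" "cpos h \<omega> = ennreal c" "0 \<le> a" "0 \<le> b" "0 \<le> c"
      using elim by (auto simp: a_def b_def c_def)
    have main: "ennreal (q * a) + cneg h \<omega> \<le> ennreal (c + (p * b + C))"
      using elim(1) nonneg ab(4-) unfolding elim(2,3) ab(1-3) by (simp add: ennreal_mult ennreal_plus)
    then have "cneg h \<omega> \<le> ennreal (c + (p * b + C))"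
      by (metis add_increasing le_iff_add order_trans zero_le add.commute)
    then have fin: "cneg h \<omega> < \<infinity>"
      by (metis ennreal_less_top infinity_ennreal_def order_le_less_trans)
    define d where "d = enn2real (cneg h \<omega>)"
    have d: "cneg h \<omega> = ennreal d" "0 \<le> d"
      using fin by (auto simp: d_def)
    have "q * a + d \<le> c + (p * b + C)"
      using main nonneg ab d by (simp flip: ennreal_plus)
    then show ?case
      using fin by (simp add: a_def b_def c_def d_def)
  qed
qed

text \<open>For each integer \<open>k\<close>, exhaustion gives one member with norm below
  \<open>k\<close> almost everywhere that any given member has norm below \<open>k\<close>. Gluing
  these along the least \<open>k\<close> that succeeds is optimal up to the rounding of norms to
  integers, hence the slack \<open>1\<close>.\<close>

lemma AE_min_norm_selection:
  fixes \<C> :: "('a \<Rightarrow> 'b::euclidean_space) set"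
  assumes "finite_measure M" and ne: "\<C> \<noteq> {}" and meas: "\<C> \<subseteq> borel_measurable F"
    and patch: "\<And>\<xi> N. \<lbrakk>\<And>n :: nat. \<xi> n \<in> \<C>; N \<in> measurable F (count_space UNIV)\<rbrakk> \<Longrightarrow> (\<lambda>\<omega>. \<xi> (N \<omega>) \<omega>) \<in> \<C>"
  shows "\<exists>\<xi>\<in>\<C>. \<forall>\<eta>\<in>\<C>. AE \<omega> in M. norm (\<xi> \<omega>) \<le> norm (\<eta> \<omega>) + 1"
proof -
  interpret finite_measure M by fact
  have C_meas [measurable]: "\<xi> \<in> borel_measurable F" if "\<xi> \<in> \<C>" for \<xi>
    using that meas by auto
  have "\<exists>\<xi>\<in>\<C>. \<forall>\<eta>\<in>\<C>. AE \<omega> in M. norm (\<eta> \<omega>) < real k \<longrightarrow> norm (\<xi> \<omega>) < real k" for k :: nat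
  proof -
    define S where "S \<xi> = {\<omega>\<in>space M. norm (\<xi> \<omega>) < real k}" for \<xi> :: "'a \<Rightarrow> 'b"
    have "\<exists>B\<in>S ` \<C>. \<forall>A\<in>S ` \<C>. AE \<omega> in M. \<omega> \<in> A \<longrightarrow> \<omega> \<in> B"
    proof (rule AE_maximal_set)
      show "S ` \<C> \<subseteq> sets M"
      proof (safe)
        fix \<xi> assume "\<xi> \<in> \<C>"
        then have [measurable]: "\<xi> \<in> borel_measurable M"
          using C_meas measurable_F_imp_M by blast
        show "S \<xi> \<in> sets M" unfolding S_def by measurable
      qed
      fix A :: "nat \<Rightarrow> 'a set" assume "range A \<subseteq> S ` \<C>"
      then have "\<forall>n. \<exists>\<xi>\<in>\<C>. A n = S \<xi>" by auto
      then obtain \<xi> where \<xi>: "\<And>n. \<xi> n \<in> \<C>" "\<And>n. A n = S (\<xi> n)" by metis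
      note C_meas[OF \<xi>(1), measurable]
      define N where "N \<omega> = (LEAST n. norm (\<xi> n \<omega>) < real k)" for \<omega>
      have N: "N \<in> measurable F (count_space UNIV)" unfolding N_def by measurable
      show "\<exists>B\<in>S ` \<C>. AE \<omega> in M. \<omega> \<in> (\<Union>n. A n) \<longrightarrow> \<omega> \<in> B"
      proof (rule bexI[where x = "S (\<lambda>\<omega>. \<xi> (N \<omega>) \<omega>)"], intro AE_I2 impI)
        show "S (\<lambda>\<omega>. \<xi> (N \<omega>) \<omega>) \<in> S ` \<C>" by (intro imageI patch[OF \<xi>(1) N])
        fix \<omega> assume "\<omega> \<in> space M" "\<omega> \<in> (\<Union>n. A n)"
        then obtain n where "norm (\<xi> n \<omega>) < real k" by (auto simp: \<xi>(2) S_def)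
        then have "norm (\<xi> (N \<omega>) \<omega>) < real k" unfolding N_def by (rule LeastI)
        then show "\<omega> \<in> S (\<lambda>\<omega>. \<xi> (N \<omega>) \<omega>)" using \<open>\<omega> \<in> space M\<close> by (simp add: S_def)
      qed
    qed (use ne in auto)
    then obtain \<xi> where \<xi>: "\<xi> \<in> \<C>" "\<And>\<eta>. \<eta> \<in> \<C> \<Longrightarrow> AE \<omega> in M. \<omega> \<in> S \<eta> \<longrightarrow> \<omega> \<in> S \<xi>"
      by auto
    show ?thesis
    proof (intro bexI ballI)
      show "AE \<omega> in M. norm (\<eta> \<omega>) < real k \<longrightarrow> norm (\<xi> \<omega>) < real k" if "\<eta> \<in> \<C>" for \<eta>
        using \<xi>(2)[OF that] AE_space by eventually_elim (auto simp: S_def)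
    qed (rule \<xi>(1))
  qed
  then obtain \<xi> where \<xi>: "\<And>k. \<xi> k \<in> \<C>"
    and max: "\<And>k \<eta>. \<eta> \<in> \<C> \<Longrightarrow> AE \<omega> in M. norm (\<eta> \<omega>) < real k \<longrightarrow> norm (\<xi> k \<omega>) < real k"
    by metis
  note C_meas[OF \<xi>, measurable]
  define N where "N \<omega> = (LEAST k. norm (\<xi> k \<omega>) < real k)" for \<omega>
  have N: "N \<in> measurable F (count_space UNIV)" unfolding N_def by measurable
  show ?thesis
  proof (rule bexI[where x = "\<lambda>\<omega>. \<xi> (N \<omega>) \<omega>"], rule ballI)
    show "(\<lambda>\<omega>. \<xi> (N \<omega>) \<omega>) \<in> \<C>" by (rule patch[OF \<xi> N])
    fix \<eta> assume "\<eta> \<in> \<C>"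
    then have "AE \<omega> in M. \<forall>k. norm (\<eta> \<omega>) < real k \<longrightarrow> norm (\<xi> k \<omega>) < real k"
      unfolding AE_all_countable using max by blast
    then show "AE \<omega> in M. norm (\<xi> (N \<omega>) \<omega>) \<le> norm (\<eta> \<omega>) + 1"
    proof eventually_elim
      case (elim \<omega>)
      define k where "k = Suc (nat \<lfloor>norm (\<eta> \<omega>)\<rfloor>)"
      have k: "norm (\<eta> \<omega>) < real k" "real k \<le> norm (\<eta> \<omega>) + 1"
        unfolding k_def by (simp_all, linarith+)
      then have "norm (\<xi> k \<omega>) < real k" using elim by blast
      then have "norm (\<xi> (N \<omega>) \<omega>) < real (N \<omega>)" "N \<omega> \<le> k"
        unfolding N_def by (rule LeastI, intro Least_le)
      then show ?case using k by linarith
    qed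
  qed
qed

end

section \<open>One step of the recursion\<close>

text \<open>\<open>V\<close> is the value function after the price increment \<open>Y\<close> and
  \<open>W\<close> the one before it. Monotonicity and concavity are required at every
  \<open>\<omega>\<close>, so that compositions with random wealth are measurable without
  exceptional sets. The step has to reproduce \<open>V_unbounded\<close> and \<open>V_growth\<close>
  for \<open>W\<close>, as the recursion feeds \<open>W\<close> into the preceding step.\<close>

locale utility_step = finite_measure_subalgebra M F for M F :: "'a measure" +
  fixes Y :: "'a \<Rightarrow> 'b::euclidean_space" and V W :: "real \<Rightarrow> 'a \<Rightarrow> real" and p q C :: real
  assumes Y_meas [measurable]: "Y \<in> borel_measurable M"
    and V_meas: "\<And>x. V x \<in> borel_measurable M"
    and W_meas: "\<And>x. W x \<in> borel_measurable F"
    and V_mono: "\<And>\<omega>. mono (\<lambda>x. V x \<omega>)" and V_concave: "\<And>\<omega>. concave_on UNIV (\<lambda>x. V x \<omega>)"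
    and W_mono: "\<And>\<omega>. mono (\<lambda>x. W x \<omega>)" and W_concave: "\<And>\<omega>. concave_on UNIV (\<lambda>x. W x \<omega>)"
    and V_defined: "\<And>x \<xi>. \<xi> \<in> borel_measurable F \<Longrightarrow> cond_exp_defined M F (\<lambda>\<omega>. V (x + \<xi> \<omega> \<bullet> Y \<omega>) \<omega>)"
    and W_ess_sup: "\<And>x. is_ess_sup M
      ((\<lambda>\<xi>. gen_cond_exp M F (\<lambda>\<omega>. V (x + \<xi> \<omega> \<bullet> Y \<omega>) \<omega>)) ` borel_measurable F) (\<lambda>\<omega>. ereal (W x \<omega>))"
    and no_arbitrage_step: "\<And>\<xi>. \<lbrakk>\<xi> \<in> borel_measurable F; AE \<omega> in M. 0 \<le> \<xi> \<omega> \<bullet> Y \<omega>\<rbrakk>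
      \<Longrightarrow> AE \<omega> in M. \<xi> \<omega> \<bullet> Y \<omega> = 0"
    and V_unbounded: "AE \<omega> in M. \<forall>a. \<exists>x. V x \<omega> < a"
    and pqC: "0 \<le> p" "p < q" "0 \<le> C"
    and V_growth: "AE \<omega> in M. \<forall>x. p * V x \<omega> - C \<le> V (x / 2) \<omega> \<and> q * V x \<omega> - C \<le> V (x / 2) \<omega>"
begin

definition payoff :: "('a \<Rightarrow> real) \<Rightarrow> ('a \<Rightarrow> 'b) \<Rightarrow> 'a \<Rightarrow> real" where
  "payoff X \<xi> \<omega> = V (X \<omega> + \<xi> \<omega> \<bullet> Y \<omega>) \<omega>"

lemma V_le: "x \<le> y \<Longrightarrow> V x \<omega> \<le> V y \<omega>"
  using V_mono by (rule monoD)

lemma W_le: "x \<le> y \<Longrightarrow> W x \<omega> \<le> W y \<omega>"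
  using W_mono by (rule monoD)

lemma V_lim: "(x \<longlongrightarrow> l) net \<Longrightarrow> ((\<lambda>n. V (x n) \<omega>) \<longlongrightarrow> V l \<omega>) net"
  by (rule isCont_tendsto_compose[OF concave_on_imp_isCont[OF V_concave]])

lemma W_lim: "(x \<longlongrightarrow> l) net \<Longrightarrow> ((\<lambda>n. W (x n) \<omega>) \<longlongrightarrow> W l \<omega>) net"
  by (rule isCont_tendsto_compose[OF concave_on_imp_isCont[OF W_concave]])

lemma W_comp_meas [measurable]: "X \<in> borel_measurable F \<Longrightarrow> (\<lambda>\<omega>. W (X \<omega>) \<omega>) \<in> borel_measurable F"
  by (rule borel_measurable_random_function[OF W_meas W_concave])

lemma V_comp_meas [measurable]: "X \<in> borel_measurable M \<Longrightarrow> (\<lambda>\<omega>. V (X \<omega>) \<omega>) \<in> borel_measurable M"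
  by (rule borel_measurable_random_function[OF V_meas V_concave])

lemma payoff_meas [measurable]:
  assumes "X \<in> borel_measurable F" "\<xi> \<in> borel_measurable F"
  shows "payoff X \<xi> \<in> borel_measurable M"
proof -
  note assms[THEN measurable_F_imp_M, measurable]
  show ?thesis unfolding payoff_def by measurable
qed

lemma gen_cond_exp_payoff_const_le:
  assumes "\<xi> \<in> borel_measurable F"
  shows "AE \<omega> in M. gen_cond_exp M F (payoff (\<lambda>_. x) \<xi>) \<omega> \<le> ereal (W x \<omega>)"
  using W_ess_sup[of x] assms by (auto simp: is_ess_sup_def payoff_def[abs_def])

text \<open>If the positive part were conditionally infinite, well-definedness would make the
  negative part finite and the conditional expectation infinite, above the real number
  \<open>W x \<omega>\<close>.\<close>

lemma cpos_payoff_const_finite: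
  assumes "\<xi> \<in> borel_measurable F"
  shows "AE \<omega> in M. cpos (payoff (\<lambda>_. x) \<xi>) \<omega> < \<infinity>"
proof -
  have "AE \<omega> in M. cpos (payoff (\<lambda>_. x) \<xi>) \<omega> < \<infinity> \<or> cneg (payoff (\<lambda>_. x) \<xi>) \<omega> < \<infinity>"
    using V_defined[OF assms, of x] by (simp add: cond_exp_defined_def payoff_def)
  then show ?thesis
    using gen_cond_exp_payoff_const_le[OF assms, of x]
  proof eventually_elim
    case (elim \<omega>)
    then show ?case
      unfolding gen_cond_exp_def
      by (cases "cpos (payoff (\<lambda>_. x) \<xi>) \<omega>"; cases "cneg (payoff (\<lambda>_. x) \<xi>) \<omega>") auto
  qed
qed

lemma grid_index_meas:
  assumes [measurable]: "X \<in> borel_measurable F"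
  shows "(\<lambda>\<omega>. \<lceil>real (Suc n) * X \<omega>\<rceil>) \<in> measurable F (count_space UNIV)"
  by measurable

text \<open>Rounding the capital up to an integer only increases the positive part, and for integer
  capital the claim is glued from constants.\<close>

lemma cpos_payoff_finite:
  assumes [measurable]: "X \<in> borel_measurable F" "\<xi> \<in> borel_measurable F"
  shows "AE \<omega> in M. cpos (payoff X \<xi>) \<omega> < \<infinity>"
proof -
  let ?N = "\<lambda>\<omega>. \<lceil>real (Suc 0) * X \<omega>\<rceil>"
  let ?c = "\<lambda>i :: int. \<lambda>_ :: 'a. real_of_int i / real (Suc 0)"
  have "AE \<omega> in M. cpos (payoff X \<xi>) \<omega> \<le> cpos (payoff (\<lambda>\<omega>. grid_above 0 (X \<omega>)) \<xi>) \<omega>"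
    by (intro nn_cond_exp_mono AE_I2) (auto simp: payoff_def intro!: ennreal_leI V_le grid_above_ge)
  moreover have "AE \<omega> in M. cpos (payoff (\<lambda>\<omega>. grid_above 0 (X \<omega>)) \<xi>) \<omega> = cpos (payoff (?c (?N \<omega>)) \<xi>) \<omega>"
    using nn_cond_exp_patch[of "\<lambda>i \<omega>. ennreal (payoff (?c i) \<xi> \<omega>)" ?N] grid_index_meas[of X 0]
    by (simp add: payoff_def grid_above_def)
  moreover have "AE \<omega> in M. \<forall>i. cpos (payoff (?c i) \<xi>) \<omega> < \<infinity>"
    unfolding AE_all_countable by (intro allI cpos_payoff_const_finite) measurable
  ultimately show ?thesis
    by eventually_elim (metis order_le_less_trans)
qed

lemma gen_cond_exp_payoff_grid:
  assumes [measurable]: "X \<in> borel_measurable F" "\<And>i. \<xi> i \<in> borel_measurable F"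
  shows "AE \<omega> in M. gen_cond_exp M F (payoff (\<lambda>\<omega>. grid_above n (X \<omega>)) (\<lambda>\<omega>. \<xi> \<lceil>real (Suc n) * X \<omega>\<rceil> \<omega>)) \<omega>
    = gen_cond_exp M F (payoff (\<lambda>_. grid_above n (X \<omega>)) (\<xi> \<lceil>real (Suc n) * X \<omega>\<rceil>)) \<omega>"
  using gen_cond_exp_patch[of "\<lambda>i. payoff (\<lambda>_. real_of_int i / real (Suc n)) (\<xi> i)" "\<lambda>\<omega>. \<lceil>real (Suc n) * X \<omega>\<rceil>"]
    grid_index_meas[of X n]
  by (simp add: payoff_def[abs_def] grid_above_def)

text \<open>The essential supremum speaks of constant capital only. Rounding \<open>X\<close> up
  preserves the left-hand side as a lower estimate, gluing gives the bound on the grid, and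
  continuity of \<open>W\<close> brings the bound back to \<open>X\<close>.\<close>

lemma gen_cond_exp_payoff_le:
  assumes [measurable]: "X \<in> borel_measurable F" "\<xi> \<in> borel_measurable F"
  shows "AE \<omega> in M. gen_cond_exp M F (payoff X \<xi>) \<omega> \<le> ereal (W (X \<omega>) \<omega>)"
proof -
  have "AE \<omega> in M. gen_cond_exp M F (payoff X \<xi>) \<omega> \<le> ereal (W (grid_above n (X \<omega>)) \<omega>)" for n
  proof -
    have "AE \<omega> in M. gen_cond_exp M F (payoff X \<xi>) \<omega>
        \<le> gen_cond_exp M F (payoff (\<lambda>\<omega>. grid_above n (X \<omega>)) \<xi>) \<omega>"
      by (intro gen_cond_exp_mono AE_I2) (auto simp: payoff_def intro!: V_le grid_above_ge)
    moreover have "AE \<omega> in M. gen_cond_exp M F (payoff (\<lambda>\<omega>. grid_above n (X \<omega>)) \<xi>) \<omega>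
        = gen_cond_exp M F (payoff (\<lambda>_. grid_above n (X \<omega>)) \<xi>) \<omega>"
      using gen_cond_exp_payoff_grid[of X "\<lambda>_. \<xi>" n] by simp
    moreover have "AE \<omega> in M. \<forall>i :: int. gen_cond_exp M F (payoff (\<lambda>_. real_of_int i / real (Suc n)) \<xi>) \<omega>
        \<le> ereal (W (real_of_int i / real (Suc n)) \<omega>)"
      unfolding AE_all_countable by (intro allI gen_cond_exp_payoff_const_le) measurable
    ultimately show ?thesis
    proof eventually_elim
      case (elim \<omega>)
      show ?case
        using elim(1,2) elim(3)[rule_format, of "\<lceil>real (Suc n) * X \<omega>\<rceil>"]
        by (simp add: grid_above_def del: of_nat_Suc)
    qed
  qed
  then have "AE \<omega> in M. \<forall>n. gen_cond_exp M F (payoff X \<xi>) \<omega> \<le> ereal (W (grid_above n (X \<omega>)) \<omega>)"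
    by (simp add: AE_all_countable)
  then show ?thesis
  proof eventually_elim
    case (elim \<omega>)
    show ?case
    proof (rule LIMSEQ_le_const)
      show "(\<lambda>n. ereal (W (grid_above n (X \<omega>)) \<omega>)) \<longlonglongrightarrow> ereal (W (X \<omega>) \<omega>)"
        by (intro tendsto_ereal W_lim grid_above_tendsto)
    qed (use elim in auto)
  qed
qed

section \<open>Near-optimal positions of almost minimal norm\<close>

definition near_optimal :: "('a \<Rightarrow> real) \<Rightarrow> real \<Rightarrow> ('a \<Rightarrow> 'b) set" where
  "near_optimal X e = {\<xi> \<in> borel_measurable F.
     AE \<omega> in M. ereal (W (X \<omega>) \<omega> - e) \<le> gen_cond_exp M F (payoff X \<xi>) \<omega>}"

lemma gen_cond_exp_payoff_patch:
  fixes \<xi> :: "'i::countable \<Rightarrow> 'a \<Rightarrow> 'b"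
  assumes [measurable]: "\<And>i. X i \<in> borel_measurable F" "\<And>i. \<xi> i \<in> borel_measurable F"
    "N \<in> measurable F (count_space UNIV)"
  shows "AE \<omega> in M. gen_cond_exp M F (payoff (\<lambda>\<omega>. X (N \<omega>) \<omega>) (\<lambda>\<omega>. \<xi> (N \<omega>) \<omega>)) \<omega>
    = gen_cond_exp M F (payoff (X (N \<omega>)) (\<xi> (N \<omega>))) \<omega>"
  using gen_cond_exp_patch[of "\<lambda>i. payoff (X i) (\<xi> i)" N] by (simp add: payoff_def[abs_def])

text \<open>Exhaustion is applied to the sets on which a position is optimal up to \<open>e\<close>;
  gluing along the first successful index absorbs countably many of them. The largest such set has
  full measure, for otherwise the essential supremum could be lowered on its complement.\<close>

lemma near_optimal_const_nonempty:
  assumes "0 < e"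
  shows "near_optimal (\<lambda>_. x) e \<noteq> {}"
proof -
  define S where "S \<xi> = {\<omega>\<in>space M. ereal (W x \<omega> - e) \<le> gen_cond_exp M F (payoff (\<lambda>_. x) \<xi>) \<omega>}" for \<xi>
  have W_measM [measurable]: "W x \<in> borel_measurable M"
    by (rule measurable_F_imp_M[OF W_meas])
  note W_meas[of x, measurable]
  have gF [measurable]: "gen_cond_exp M F (payoff (\<lambda>_. x) \<xi>) \<in> borel_measurable M" for \<xi>
    by (rule measurable_F_imp_M) measurable
  have SF [measurable]: "S \<xi> \<in> sets M" for \<xi>
    unfolding S_def by measurable
  have "\<exists>B\<in>S ` borel_measurable F. \<forall>A\<in>S ` borel_measurable F. AE \<omega> in M. \<omega> \<in> A \<longrightarrow> \<omega> \<in> B"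
  proof (rule AE_maximal_set)
    fix A :: "nat \<Rightarrow> 'a set" assume "range A \<subseteq> S ` borel_measurable F"
    then have "\<forall>n. \<exists>\<xi>\<in>borel_measurable F. A n = S \<xi>" by auto
    then obtain \<xi> where \<xi> [measurable]: "\<And>n. \<xi> n \<in> borel_measurable F" and A: "\<And>n. A n = S (\<xi> n)"
      by metis
    define N where "N \<omega> = (LEAST n. ereal (W x \<omega> - e) \<le> gen_cond_exp M F (payoff (\<lambda>_. x) (\<xi> n)) \<omega>)" for \<omega>
    have N [measurable]: "N \<in> measurable F (count_space UNIV)" unfolding N_def by measurable
    have "AE \<omega> in M. gen_cond_exp M F (payoff (\<lambda>_. x) (\<lambda>\<omega>. \<xi> (N \<omega>) \<omega>)) \<omega>
        = gen_cond_exp M F (payoff (\<lambda>_. x) (\<xi> (N \<omega>))) \<omega>"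
      by (rule gen_cond_exp_payoff_patch) measurable
    then have "AE \<omega> in M. \<omega> \<in> (\<Union>n. A n) \<longrightarrow> \<omega> \<in> S (\<lambda>\<omega>. \<xi> (N \<omega>) \<omega>)"
    proof eventually_elim
      case (elim \<omega>)
      show ?case
      proof
        assume "\<omega> \<in> (\<Union>n. A n)"
        then obtain n where n: "\<omega> \<in> space M" "ereal (W x \<omega> - e) \<le> gen_cond_exp M F (payoff (\<lambda>_. x) (\<xi> n)) \<omega>"
          by (auto simp: A S_def)
        have "ereal (W x \<omega> - e) \<le> gen_cond_exp M F (payoff (\<lambda>_. x) (\<xi> (N \<omega>))) \<omega>"
          unfolding N_def by (rule LeastI[where P = "\<lambda>n. ereal (W x \<omega> - e) \<le> gen_cond_exp M F (payoff (\<lambda>_. x) (\<xi> n)) \<omega>", OF n(2)])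
        then show "\<omega> \<in> S (\<lambda>\<omega>. \<xi> (N \<omega>) \<omega>)"
          using elim n(1) by (simp add: S_def)
      qed
    qed
    then show "\<exists>B\<in>S ` borel_measurable F. AE \<omega> in M. \<omega> \<in> (\<Union>n. A n) \<longrightarrow> \<omega> \<in> B"
      by (intro bexI[where x = "S (\<lambda>\<omega>. \<xi> (N \<omega>) \<omega>)"] imageI) measurable
  next
    show "S ` borel_measurable F \<noteq> {}"
    proof -
      have "(\<lambda>_. 0 :: 'b) \<in> borel_measurable F" by simp
      then show ?thesis by blast
    qed
  qed (use SF in auto)
  then obtain \<xi> where \<xi> [measurable]: "\<xi> \<in> borel_measurable F"
    and max: "\<And>\<eta>. \<eta> \<in> borel_measurable F \<Longrightarrow> AE \<omega> in M. \<omega> \<in> S \<eta> \<longrightarrow> \<omega> \<in> S \<xi>"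
    by auto
  \<comment> \<open>Off the maximal set every position almost surely falls short of
    \<open>W x\<close> by more than \<open>e\<close>, so this smaller function is still an upper
    bound of the family.\<close>
  define Z where "Z \<omega> = (if \<omega> \<in> S \<xi> then ereal (W x \<omega>) else ereal (W x \<omega> - e))" for \<omega>
  have "Z \<in> borel_measurable M" unfolding Z_def by measurable
  moreover have "AE \<omega> in M. gen_cond_exp M F (payoff (\<lambda>_. x) \<eta>) \<omega> \<le> Z \<omega>" if "\<eta> \<in> borel_measurable F" for \<eta>
    using max[OF that] gen_cond_exp_payoff_const_le[OF that, of x] AE_space
    by eventually_elim (auto simp: Z_def S_def)
  ultimately have "AE \<omega> in M. ereal (W x \<omega>) \<le> Z \<omega>"
    using W_ess_sup[of x] by (auto simp: is_ess_sup_def payoff_def[abs_def])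
  then have "AE \<omega> in M. \<omega> \<in> S \<xi>"
    by eventually_elim (use assms in \<open>auto simp: Z_def split: if_splits\<close>)
  then have "\<xi> \<in> near_optimal (\<lambda>_. x) e"
    by (auto simp: near_optimal_def S_def elim!: eventually_mono)
  then show ?thesis by auto
qed

lemma near_optimal_grid_nonempty:
  assumes [measurable]: "X \<in> borel_measurable F" and "0 < e"
  shows "near_optimal (\<lambda>\<omega>. grid_above n (X \<omega>)) e \<noteq> {}"
proof -
  have "\<exists>\<xi>. \<forall>i :: int. \<xi> i \<in> near_optimal (\<lambda>_. real_of_int i / real (Suc n)) e"
    using near_optimal_const_nonempty[OF \<open>0 < e\<close>] by (intro choice allI ex_in_conv[THEN iffD2])
  then obtain \<xi> where \<xi>: "\<And>i :: int. \<xi> i \<in> near_optimal (\<lambda>_. real_of_int i / real (Suc n)) e"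
    by blast
  then have [measurable]: "\<xi> i \<in> borel_measurable F" for i
    by (auto simp: near_optimal_def)
  have "AE \<omega> in M. \<forall>i. ereal (W (real_of_int i / real (Suc n)) \<omega> - e)
      \<le> gen_cond_exp M F (payoff (\<lambda>_. real_of_int i / real (Suc n)) (\<xi> i)) \<omega>"
    unfolding AE_all_countable using \<xi> by (auto simp: near_optimal_def)
  moreover have "AE \<omega> in M. gen_cond_exp M F (payoff (\<lambda>\<omega>. grid_above n (X \<omega>)) (\<lambda>\<omega>. \<xi> \<lceil>real (Suc n) * X \<omega>\<rceil> \<omega>)) \<omega>
    = gen_cond_exp M F (payoff (\<lambda>_. grid_above n (X \<omega>)) (\<xi> \<lceil>real (Suc n) * X \<omega>\<rceil>)) \<omega>"
    by (rule gen_cond_exp_payoff_grid) measurable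
  ultimately have "AE \<omega> in M. ereal (W (grid_above n (X \<omega>)) \<omega> - e)
      \<le> gen_cond_exp M F (payoff (\<lambda>\<omega>. grid_above n (X \<omega>)) (\<lambda>\<omega>. \<xi> \<lceil>real (Suc n) * X \<omega>\<rceil> \<omega>)) \<omega>"
    by eventually_elim (simp add: grid_above_def del: of_nat_Suc)
  moreover have "(\<lambda>\<omega>. \<xi> \<lceil>real (Suc n) * X \<omega>\<rceil> \<omega>) \<in> borel_measurable F"
    by measurable
  ultimately have "(\<lambda>\<omega>. \<xi> \<lceil>real (Suc n) * X \<omega>\<rceil> \<omega>) \<in> near_optimal (\<lambda>\<omega>. grid_above n (X \<omega>)) e"
    unfolding near_optimal_def by blast
  then show ?thesis by blast
qed

text \<open>Minimality is kept only against shifts by \<open>\<zeta>\<close> with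
  \<open>\<zeta> \<bullet> Y = 0\<close>. These redundant directions leave the payoff unchanged, so
  the condition stands in for projecting the position orthogonally to them.\<close>

definition min_norm_near_optimal :: "('a \<Rightarrow> real) \<Rightarrow> real \<Rightarrow> ('a \<Rightarrow> 'b) \<Rightarrow> bool" where
  "min_norm_near_optimal X e \<xi> \<longleftrightarrow> \<xi> \<in> near_optimal X e \<and>
     (\<forall>\<zeta>\<in>borel_measurable F. (AE \<omega> in M. \<zeta> \<omega> \<bullet> Y \<omega> = 0) \<longrightarrow>
        (AE \<omega> in M. norm (\<xi> \<omega>) \<le> norm (\<xi> \<omega> + \<zeta> \<omega>) + 1))"

lemma near_optimal_min_norm:
  assumes X [measurable]: "X \<in> borel_measurable F" and ne: "near_optimal X e \<noteq> {}"
  shows "\<exists>\<xi>. min_norm_near_optimal X e \<xi>"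
proof -
  have "\<exists>\<xi>\<in>near_optimal X e. \<forall>\<eta>\<in>near_optimal X e. AE \<omega> in M. norm (\<xi> \<omega>) \<le> norm (\<eta> \<omega>) + 1"
  proof (rule AE_min_norm_selection[OF _ ne])
    fix \<xi> :: "nat \<Rightarrow> 'a \<Rightarrow> 'b" and N :: "'a \<Rightarrow> nat"
    assume \<xi>: "\<And>n. \<xi> n \<in> near_optimal X e" and N [measurable]: "N \<in> measurable F (count_space UNIV)"
    then have [measurable]: "\<xi> n \<in> borel_measurable F" for n
      by (auto simp: near_optimal_def)
    have "AE \<omega> in M. gen_cond_exp M F (payoff X (\<lambda>\<omega>. \<xi> (N \<omega>) \<omega>)) \<omega> = gen_cond_exp M F (payoff X (\<xi> (N \<omega>))) \<omega>"
      by (rule gen_cond_exp_payoff_patch) measurable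
    moreover have "AE \<omega> in M. \<forall>n. ereal (W (X \<omega>) \<omega> - e) \<le> gen_cond_exp M F (payoff X (\<xi> n)) \<omega>"
      unfolding AE_all_countable using \<xi> by (auto simp: near_optimal_def)
    ultimately have "AE \<omega> in M. ereal (W (X \<omega>) \<omega> - e) \<le> gen_cond_exp M F (payoff X (\<lambda>\<omega>. \<xi> (N \<omega>) \<omega>)) \<omega>"
      by eventually_elim simp
    then show "(\<lambda>\<omega>. \<xi> (N \<omega>) \<omega>) \<in> near_optimal X e"
      by (simp add: near_optimal_def)
  qed (auto simp: near_optimal_def finite_measure_axioms)
  then obtain \<xi> where \<xi>: "\<xi> \<in> near_optimal X e"
    and min: "\<And>\<eta>. \<eta> \<in> near_optimal X e \<Longrightarrow> AE \<omega> in M. norm (\<xi> \<omega>) \<le> norm (\<eta> \<omega>) + 1"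
    by auto
  have [measurable]: "\<xi> \<in> borel_measurable F"
    using \<xi> by (simp add: near_optimal_def)
  show ?thesis
    unfolding min_norm_near_optimal_def
  proof (intro exI[of _ \<xi>] conjI ballI impI \<xi>)
    fix \<zeta> :: "'a \<Rightarrow> 'b" assume \<zeta> [measurable]: "\<zeta> \<in> borel_measurable F" and 0: "AE \<omega> in M. \<zeta> \<omega> \<bullet> Y \<omega> = 0"
    have "AE \<omega> in M. gen_cond_exp M F (payoff X (\<lambda>\<omega>. \<xi> \<omega> + \<zeta> \<omega>)) \<omega> = gen_cond_exp M F (payoff X \<xi>) \<omega>"
      using 0 by (intro gen_cond_exp_cong) (auto simp: payoff_def inner_add_left elim!: eventually_mono)
    moreover have "AE \<omega> in M. ereal (W (X \<omega>) \<omega> - e) \<le> gen_cond_exp M F (payoff X \<xi>) \<omega>"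
      using \<xi> by (simp add: near_optimal_def)
    ultimately have "AE \<omega> in M. ereal (W (X \<omega>) \<omega> - e) \<le> gen_cond_exp M F (payoff X (\<lambda>\<omega>. \<xi> \<omega> + \<zeta> \<omega>)) \<omega>"
      by eventually_elim simp
    then have "(\<lambda>\<omega>. \<xi> \<omega> + \<zeta> \<omega>) \<in> near_optimal X e"
      by (simp add: near_optimal_def)
    from min[OF this] show "AE \<omega> in M. norm (\<xi> \<omega>) \<le> norm (\<xi> \<omega> + \<zeta> \<omega>) + 1" .
  qed
qed

text \<open>Halving the position keeps the positive part up to the factor \<open>q\<close> but damps the negative part
  by \<open>p < q\<close>; as the halved position cannot beat \<open>W\<close>, this bounds the positive part.\<close>

lemma cpos_payoff_bound:
  assumes [measurable]: "X \<in> borel_measurable F" "\<xi> \<in> borel_measurable F"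
    and K: "\<And>\<omega>. 0 \<le> K \<omega>" and low: "AE \<omega> in M. ereal (- K \<omega>) \<le> gen_cond_exp M F (payoff X \<xi>) \<omega>"
  shows "AE \<omega> in M. enn2real (cpos (payoff X \<xi>) \<omega>) \<le> (max 0 (W (X \<omega> / 2) \<omega>) + p * K \<omega> + C) / (q - p)"
proof -
  let ?h = "payoff (\<lambda>\<omega>. X \<omega> / 2) (\<lambda>\<omega>. \<xi> \<omega> /\<^sub>R 2)"
  have fin: "AE \<omega> in M. cpos (payoff X \<xi>) \<omega> < \<infinity>" "AE \<omega> in M. cpos ?h \<omega> < \<infinity>"
    by (rule cpos_payoff_finite; measurable)+
  have finn: "AE \<omega> in M. cneg (payoff X \<xi>) \<omega> < \<infinity>"
    using low fin(1) by eventually_elim (simp add: le_gen_cond_exp_iff)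
  have "AE \<omega> in M. cneg ?h \<omega> < \<infinity> \<and>
    q * enn2real (cpos (payoff X \<xi>) \<omega>) - p * enn2real (cneg (payoff X \<xi>) \<omega>) - C
      \<le> enn2real (cpos ?h \<omega>) - enn2real (cneg ?h \<omega>)"
  proof (rule cond_exp_linear_bound)
    \<comment> \<open>The growth inequality with \<open>q\<close> is used where the payoff is
      nonnegative, the one with \<open>p\<close> where it is negative.\<close>
    show "AE \<omega> in M. q * max 0 (payoff X \<xi> \<omega>) - p * max 0 (- payoff X \<xi> \<omega>) - C \<le> ?h \<omega>"
      using V_growth
    proof eventually_elim
      case (elim \<omega>)
      have "X \<omega> / 2 + (\<xi> \<omega> /\<^sub>R 2) \<bullet> Y \<omega> = (X \<omega> + \<xi> \<omega> \<bullet> Y \<omega>) / 2"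
        by (simp add: field_simps)
      then show ?case
        using elim[rule_format, of "X \<omega> + \<xi> \<omega> \<bullet> Y \<omega>"] by (auto simp: payoff_def max_def add_divide_distrib)
    qed
  qed (use fin finn pqC in auto)
  moreover have "AE \<omega> in M. gen_cond_exp M F ?h \<omega> \<le> ereal (W (X \<omega> / 2) \<omega>)"
    by (rule gen_cond_exp_payoff_le) measurable
  ultimately show ?thesis
    using low fin
  proof eventually_elim
    case (elim \<omega>)
    define a b where "a = enn2real (cpos (payoff X \<xi>) \<omega>)" and "b = enn2real (cneg (payoff X \<xi>) \<omega>)"
    \<comment> \<open>The loss exceeds the gain by at most \<open>K\<close>. Inserted into
      \<open>q * a - p * b - C \<le> W (X \<omega> / 2) \<omega>\<close>, this leaves the gain with
      the positive coefficient \<open>q - p\<close>.\<close>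
    have "b \<le> a + K \<omega>"
      using elim by (simp add: le_gen_cond_exp_iff a_def b_def)
    then have "p * b \<le> p * (a + K \<omega>)"
      using pqC by (intro mult_left_mono) auto
    moreover have "q * a - p * b - C \<le> W (X \<omega> / 2) \<omega>"
      using elim gen_cond_exp_eq_real[of ?h \<omega>] by (simp add: a_def b_def)
    ultimately have "(q - p) * a \<le> max 0 (W (X \<omega> / 2) \<omega>) + p * K \<omega> + C"
      by (auto simp: algebra_simps max_def split: if_splits)
    then show ?case
      using pqC by (simp add: a_def pos_le_divide_eq mult.commute)
  qed
qed

text \<open>On the set where the sequence is unbounded, the normalised positions have a cluster point
  \<open>(a, \<zeta>)\<close> with \<open>a \<le> 0\<close>.  Uniformly bounded negative parts force \<open>a + \<zeta> \<bullet> Y \<ge> 0\<close>, hence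
  \<open>a = 0\<close> and \<open>\<zeta> \<bullet> Y = 0\<close> by absence of arbitrage; subtracting the component along \<open>\<zeta>\<close> would then
  shorten the strategies by more than \<open>1\<close>.\<close>

lemma bounded_positions:
  fixes x :: "nat \<Rightarrow> 'a \<Rightarrow> real" and \<xi> :: "nat \<Rightarrow> 'a \<Rightarrow> 'b"
  assumes meas: "\<And>n. x n \<in> borel_measurable F" "\<And>n. \<xi> n \<in> borel_measurable F"
    and upper: "\<And>n \<omega>. x n \<omega> \<le> Xb \<omega>" and K: "\<And>\<omega>. 0 \<le> K \<omega>"
    and low: "\<And>n. AE \<omega> in M. ereal (- K \<omega>) \<le> gen_cond_exp M F (payoff (x n) (\<xi> n)) \<omega>"
    and min: "\<And>n \<zeta>. \<lbrakk>\<zeta> \<in> borel_measurable F; AE \<omega> in M. \<zeta> \<omega> \<bullet> Y \<omega> = 0\<rbrakk>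
      \<Longrightarrow> AE \<omega> in M. norm (\<xi> n \<omega>) \<le> norm (\<xi> n \<omega> + \<zeta> \<omega>) + 1"
  shows "AE \<omega> in M. bounded (range (\<lambda>n. (x n \<omega>, \<xi> n \<omega>)))"
proof -
  note meas[measurable]
  \<comment> \<open>The bound on the gain plus \<open>K\<close> bounds the loss. Replacing the
    capital by its upper bound \<open>Xb\<close> makes it independent of \<open>n\<close>.\<close>
  define L where "L \<omega> = (max 0 (W (Xb \<omega> / 2) \<omega>) + p * K \<omega> + C) / (q - p) + K \<omega>" for \<omega>
  have cneg_le: "AE \<omega> in M. \<forall>n. cneg (payoff (x n) (\<xi> n)) \<omega> \<le> ennreal (L \<omega>)"
    unfolding AE_all_countable
  proof
    fix n
    have "AE \<omega> in M. cpos (payoff (x n) (\<xi> n)) \<omega> < \<infinity>"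
      by (rule cpos_payoff_finite) measurable
    moreover have "AE \<omega> in M. enn2real (cpos (payoff (x n) (\<xi> n)) \<omega>)
        \<le> (max 0 (W (x n \<omega> / 2) \<omega>) + p * K \<omega> + C) / (q - p)"
      using K low by (intro cpos_payoff_bound) auto
    ultimately show "AE \<omega> in M. cneg (payoff (x n) (\<xi> n)) \<omega> \<le> ennreal (L \<omega>)"
      using low[of n]
    proof eventually_elim
      case (elim \<omega>)
      have "W (x n \<omega> / 2) \<omega> \<le> W (Xb \<omega> / 2) \<omega>"
        using upper by (intro W_le) auto
      then have "(max 0 (W (x n \<omega> / 2) \<omega>) + p * K \<omega> + C) / (q - p)
          \<le> (max 0 (W (Xb \<omega> / 2) \<omega>) + p * K \<omega> + C) / (q - p)"
        using pqC by (intro divide_right_mono add_right_mono) auto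
      then have "enn2real (cneg (payoff (x n) (\<xi> n)) \<omega>) \<le> L \<omega>"
        using elim by (simp add: le_gen_cond_exp_iff L_def)
      moreover have "cneg (payoff (x n) (\<xi> n)) \<omega> < \<infinity>"
        using elim by (simp add: le_gen_cond_exp_iff)
      ultimately show ?case
        by (cases "cneg (payoff (x n) (\<xi> n)) \<omega>") (auto intro: ennreal_leI)
    qed
  qed
  define \<eta> where "\<eta> n \<omega> = (x n \<omega>, \<xi> n \<omega>)" for n \<omega>
  have [measurable]: "\<eta> n \<in> borel_measurable F" for n
    unfolding \<eta>_def by measurable
  define A where "A = {\<omega>\<in>space F. \<forall>k::nat. \<exists>n. real (Suc k) \<le> norm (\<eta> n \<omega>)}"
  have A [measurable]: "A \<in> sets F"
    unfolding A_def by measurable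
  \<comment> \<open>The threshold is \<open>Suc k\<close> rather than \<open>k\<close>, so the norms
    used as divisors below are positive even for \<open>k = 0\<close>.\<close>
  define m where "m k \<omega> = (LEAST n. real (Suc k) \<le> norm (\<eta> n \<omega>))" for k \<omega>
  have [measurable]: "m k \<in> measurable F (count_space UNIV)" for k
    unfolding m_def by measurable
  have m: "real (Suc k) \<le> norm (\<eta> (m k \<omega>) \<omega>)" if "\<omega> \<in> A" for k \<omega>
  proof -
    have "\<exists>n. real (Suc k) \<le> norm (\<eta> n \<omega>)" using that unfolding A_def by blast
    then show ?thesis unfolding m_def by (rule LeastI_ex)
  qed
  define u where "u k \<omega> = \<eta> (m k \<omega>) \<omega> /\<^sub>R norm (\<eta> (m k \<omega>) \<omega>)" for k \<omega>
  have u_meas [measurable]: "u k \<in> borel_measurable F" for k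
    unfolding u_def by measurable
  have u_bounded: "bounded (range (\<lambda>k. u k \<omega>))" for \<omega>
    unfolding bounded_iff by (rule exI[of _ 1]) (auto simp: u_def divide_simps)
  obtain N g where N [measurable]: "\<And>k. N k \<in> measurable F (count_space (UNIV :: nat set))"
    and N_ge: "\<And>\<omega> k. \<omega> \<in> space F \<Longrightarrow> N k \<omega> \<ge> k"
    and g [measurable]: "g \<in> borel_measurable F"
    and lim: "\<And>\<omega>. \<omega> \<in> A \<Longrightarrow> (\<lambda>k. u (N k \<omega>) \<omega>) \<longlonglongrightarrow> g \<omega>" and g0: "\<And>\<omega>. \<omega> \<notin> A \<Longrightarrow> g \<omega> = 0"
    by (rule random_subsequence[OF u_meas A u_bounded]) blast
  define a \<zeta> where "a \<omega> = fst (g \<omega>)" and "\<zeta> \<omega> = snd (g \<omega>)" for \<omega>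
  have \<zeta> [measurable]: "\<zeta> \<in> borel_measurable F"
    unfolding \<zeta>_def by (rule borel_measurable_continuous_on[OF _ g]) (intro continuous_intros)
  define i where "i k \<omega> = m (N k \<omega>) \<omega>" for k \<omega>
  have i [measurable]: "i k \<in> measurable F (count_space UNIV)" for k
    unfolding i_def by measurable
  define r where "r k \<omega> = norm (\<eta> (i k \<omega>) \<omega>)" for k \<omega>
  have r: "real (Suc k) \<le> r k \<omega>" if "\<omega> \<in> A" for k \<omega>
    using m[OF that, of "N k \<omega>"] N_ge[of \<omega> k] that
    by (auto simp: r_def i_def A_def)
  have r_pos: "0 < r k \<omega>" if "\<omega> \<in> A" for k \<omega>
    using r[OF that, of k] by simp
  have r_lim: "filterlim (\<lambda>k. r k \<omega>) at_top sequentially" if "\<omega> \<in> A" for \<omega>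
    by (rule filterlim_at_top_mono[OF filterlim_compose[OF filterlim_real_sequentially filterlim_Suc]])
      (use r[OF that] in auto)
  have lim_a: "(\<lambda>k. x (i k \<omega>) \<omega> / r k \<omega>) \<longlonglongrightarrow> a \<omega>" and lim_\<zeta>: "(\<lambda>k. \<xi> (i k \<omega>) \<omega> /\<^sub>R r k \<omega>) \<longlonglongrightarrow> \<zeta> \<omega>"
    and norm_g: "norm (g \<omega>) = 1" if "\<omega> \<in> A" for \<omega>
  proof -
    have eq: "u (N k \<omega>) \<omega> = (x (i k \<omega>) \<omega> / r k \<omega>, \<xi> (i k \<omega>) \<omega> /\<^sub>R r k \<omega>)" for k
      by (simp add: u_def i_def r_def \<eta>_def divide_inverse mult.commute)
    show "(\<lambda>k. x (i k \<omega>) \<omega> / r k \<omega>) \<longlonglongrightarrow> a \<omega>"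
      using tendsto_fst[OF lim[OF that]] by (simp add: eq a_def)
    show "(\<lambda>k. \<xi> (i k \<omega>) \<omega> /\<^sub>R r k \<omega>) \<longlonglongrightarrow> \<zeta> \<omega>"
      using tendsto_snd[OF lim[OF that]] by (simp add: eq \<zeta>_def)
    have "norm (u (N k \<omega>) \<omega>) = 1" for k
      using r_pos[OF that, of k] by (simp add: u_def r_def i_def)
    then show "norm (g \<omega>) = 1"
      using tendsto_norm[OF lim[OF that]] by (simp add: LIMSEQ_const_iff)
  qed
  have a_le: "a \<omega> \<le> 0" for \<omega>
  proof (cases "\<omega> \<in> A")
    case True
    have "(\<lambda>k. Xb \<omega> / r k \<omega>) \<longlonglongrightarrow> 0"
      by (rule tendsto_divide_0[OF tendsto_const filterlim_at_top_imp_at_infinity[OF r_lim[OF True]]])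
    with lim_a[OF True] show ?thesis
    proof (rule LIMSEQ_le)
      have "x (i k \<omega>) \<omega> / r k \<omega> \<le> Xb \<omega> / r k \<omega>" for k
        using upper r_pos[OF True, of k] by (intro divide_right_mono) auto
      then show "\<exists>N. \<forall>k\<ge>N. x (i k \<omega>) \<omega> / r k \<omega> \<le> Xb \<omega> / r k \<omega>" by blast
    qed
  qed (simp add: a_def g0)
  let ?z = "\<lambda>k \<omega>. payoff (x (i k \<omega>)) (\<xi> (i k \<omega>)) \<omega>"
  have z_meas [measurable]: "?z k \<in> borel_measurable M" for k
  proof -
    note i[THEN measurable_F_imp_M, measurable]
    show ?thesis by measurable
  qed
  have "AE \<omega> in M. \<forall>k. cneg (?z k) \<omega> \<le> ennreal (L \<omega>)"
    unfolding AE_all_countable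
  proof
    fix k
    have "AE \<omega> in M. cneg (?z k) \<omega> = cneg (payoff (x (i k \<omega>)) (\<xi> (i k \<omega>))) \<omega>"
      using nn_cond_exp_patch[of "\<lambda>n \<omega>. ennreal (- payoff (x n) (\<xi> n) \<omega>)" "i k"] by simp
    then show "AE \<omega> in M. cneg (?z k) \<omega> \<le> ennreal (L \<omega>)"
      using cneg_le by eventually_elim simp
  qed
  \<comment> \<open>Fatou's lemma turns the uniform conditional bound on losses into pathwise
    finiteness of their lower limit.\<close>
  moreover have "AE \<omega> in M. nn_cond_exp M F (\<lambda>\<omega>. liminf (\<lambda>k. ennreal (- ?z k \<omega>))) \<omega>
      \<le> liminf (\<lambda>k. cneg (?z k) \<omega>)"
    by (rule nn_cond_exp_Fatou) measurable
  ultimately have "AE \<omega> in M. nn_cond_exp M F (\<lambda>\<omega>. liminf (\<lambda>k. ennreal (- ?z k \<omega>))) \<omega> < \<infinity>"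
  proof eventually_elim
    case (elim \<omega>)
    have "liminf (\<lambda>k. cneg (?z k) \<omega>) \<le> limsup (\<lambda>k. cneg (?z k) \<omega>)"
      by (rule Liminf_le_Limsup) simp
    also have "\<dots> \<le> ennreal (L \<omega>)"
      using elim(1) by (intro Limsup_bounded) auto
    finally have "liminf (\<lambda>k. cneg (?z k) \<omega>) \<le> ennreal (L \<omega>)" .
    from le_less_trans[OF order_trans[OF elim(2) this] ennreal_less_top] show ?case
      by simp
  qed
  then have liminf_fin: "AE \<omega> in M. liminf (\<lambda>k. ennreal (- ?z k \<omega>)) < \<infinity>"
    by (rule nn_cond_exp_finite_imp_finite[rotated]) measurable
  have nonneg: "AE \<omega> in M. \<omega> \<in> A \<longrightarrow> 0 \<le> a \<omega> + \<zeta> \<omega> \<bullet> Y \<omega>"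
    using liminf_fin V_unbounded
  proof eventually_elim
    case (elim \<omega>)
    show ?case
    proof (intro impI, rule ccontr)
      assume \<omega>: "\<omega> \<in> A" and "\<not> 0 \<le> a \<omega> + \<zeta> \<omega> \<bullet> Y \<omega>"
      then have neg: "a \<omega> + \<zeta> \<omega> \<bullet> Y \<omega> < 0" by simp
      \<comment> \<open>A negative limiting direction multiplied by the diverging norms
        \<open>r k\<close> drives the terminal positions to minus infinity. As \<open>V\<close> is
        unbounded below, the losses then diverge, against \<open>liminf_fin\<close>.\<close>
      have "(\<lambda>k. x (i k \<omega>) \<omega> / r k \<omega> + (\<xi> (i k \<omega>) \<omega> /\<^sub>R r k \<omega>) \<bullet> Y \<omega>) \<longlonglongrightarrow> a \<omega> + \<zeta> \<omega> \<bullet> Y \<omega>"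
        by (intro tendsto_intros lim_a lim_\<zeta> \<omega>)
      then have "filterlim (\<lambda>k. (x (i k \<omega>) \<omega> / r k \<omega> + (\<xi> (i k \<omega>) \<omega> /\<^sub>R r k \<omega>) \<bullet> Y \<omega>) * r k \<omega>) at_bot sequentially"
        by (rule filterlim_tendsto_neg_mult_at_bot[OF _ neg r_lim[OF \<omega>]])
      moreover have "(x (i k \<omega>) \<omega> / r k \<omega> + (\<xi> (i k \<omega>) \<omega> /\<^sub>R r k \<omega>) \<bullet> Y \<omega>) * r k \<omega>
          = x (i k \<omega>) \<omega> + \<xi> (i k \<omega>) \<omega> \<bullet> Y \<omega>" for k
        using r_pos[OF \<omega>, of k] by (simp add: field_simps)
      ultimately have pos_lim: "filterlim (\<lambda>k. x (i k \<omega>) \<omega> + \<xi> (i k \<omega>) \<omega> \<bullet> Y \<omega>) at_bot sequentially"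
        by simp
      have "ennreal (real n) \<le> liminf (\<lambda>k. ennreal (- ?z k \<omega>))" for n
      proof (rule Liminf_bounded)
        obtain y where y: "V y \<omega> < - real n" using elim(2) by blast
        have "\<forall>\<^sub>F k in sequentially. x (i k \<omega>) \<omega> + \<xi> (i k \<omega>) \<omega> \<bullet> Y \<omega> \<le> y"
          using pos_lim by (simp add: filterlim_at_bot)
        then show "\<forall>\<^sub>F k in sequentially. ennreal (real n) \<le> ennreal (- ?z k \<omega>)"
        proof eventually_elim
          case (elim k)
          then have "?z k \<omega> \<le> V y \<omega>" unfolding payoff_def by (rule V_le)
          then show ?case using y by (intro ennreal_leI) simp
        qed
      qed
      moreover obtain n where "liminf (\<lambda>k. ennreal (- ?z k \<omega>)) < of_nat n"
        using ennreal_Ex_less_of_nat elim(1) unfolding infinity_ennreal_def by blast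
      ultimately show False
        by (metis ennreal_of_nat_eq_real_of_nat leD)
    qed
  qed
  have "AE \<omega> in M. \<zeta> \<omega> \<bullet> Y \<omega> = 0"
  proof (rule no_arbitrage_step[OF \<zeta>])
    show "AE \<omega> in M. 0 \<le> \<zeta> \<omega> \<bullet> Y \<omega>"
      using nonneg
    proof eventually_elim
      case (elim \<omega>)
      then show ?case using a_le[of \<omega>] by (cases "\<omega> \<in> A") (auto simp: \<zeta>_def g0)
    qed
  qed
  moreover from this have "AE \<omega> in M. \<forall>n. norm (\<xi> n \<omega>) \<le> norm (\<xi> n \<omega> + (- (\<xi> n \<omega> \<bullet> \<zeta> \<omega>)) *\<^sub>R \<zeta> \<omega>) + 1"
    unfolding AE_all_countable
    by (intro allI min) (auto elim!: eventually_mono)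
  ultimately have "AE \<omega> in M. \<omega> \<notin> A"
    using nonneg
  proof eventually_elim
    case (elim \<omega>)
    show ?case
    proof
      assume \<omega>: "\<omega> \<in> A"
      have "a \<omega> = 0" using elim(1,3) a_le[of \<omega>] \<omega> by auto
      then have norm_\<zeta>: "norm (\<zeta> \<omega>) = 1"
        using norm_g[OF \<omega>] by (simp add: norm_prod_def a_def \<zeta>_def)
      have "(\<lambda>k. norm (\<xi> (i k \<omega>) \<omega> /\<^sub>R r k \<omega>)) \<longlonglongrightarrow> norm (\<zeta> \<omega>)"
        by (intro tendsto_intros lim_\<zeta> \<omega>)
      \<comment> \<open>Division by \<open>r k\<close> makes the slack \<open>1\<close> disappear,
        and the minimality inequality passes to the limit as \<open>1 \<le> 0\<close>, since
        \<open>\<zeta>\<close> minus its own projection onto itself is zero.\<close>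
      moreover have "(\<lambda>k. norm (\<xi> (i k \<omega>) \<omega> /\<^sub>R r k \<omega> + (- ((\<xi> (i k \<omega>) \<omega> /\<^sub>R r k \<omega>) \<bullet> \<zeta> \<omega>)) *\<^sub>R \<zeta> \<omega>) + 1 / r k \<omega>)
          \<longlonglongrightarrow> norm (\<zeta> \<omega> + (- (\<zeta> \<omega> \<bullet> \<zeta> \<omega>)) *\<^sub>R \<zeta> \<omega>) + 0"
        by (intro tendsto_intros lim_\<zeta> \<omega> tendsto_divide_0[OF tendsto_const] filterlim_at_top_imp_at_infinity r_lim)
      moreover have "norm (\<xi> (i k \<omega>) \<omega> /\<^sub>R r k \<omega>)
          \<le> norm (\<xi> (i k \<omega>) \<omega> /\<^sub>R r k \<omega> + (- ((\<xi> (i k \<omega>) \<omega> /\<^sub>R r k \<omega>) \<bullet> \<zeta> \<omega>)) *\<^sub>R \<zeta> \<omega>) + 1 / r k \<omega>" for k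
      proof -
        have "\<xi> (i k \<omega>) \<omega> /\<^sub>R r k \<omega> + (- ((\<xi> (i k \<omega>) \<omega> /\<^sub>R r k \<omega>) \<bullet> \<zeta> \<omega>)) *\<^sub>R \<zeta> \<omega>
            = (\<xi> (i k \<omega>) \<omega> + (- (\<xi> (i k \<omega>) \<omega> \<bullet> \<zeta> \<omega>)) *\<^sub>R \<zeta> \<omega>) /\<^sub>R r k \<omega>"
          by (simp add: scaleR_right_diff_distrib)
        moreover have "norm (\<xi> (i k \<omega>) \<omega>) / r k \<omega>
            \<le> (norm (\<xi> (i k \<omega>) \<omega> + (- (\<xi> (i k \<omega>) \<omega> \<bullet> \<zeta> \<omega>)) *\<^sub>R \<zeta> \<omega>) + 1) / r k \<omega>"
          using elim(2)[rule_format, of "i k \<omega>"] r_pos[OF \<omega>, of k] by (intro divide_right_mono) auto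
        moreover have "norm (v /\<^sub>R r k \<omega>) = norm v / r k \<omega>" for v :: 'b
          using r_pos[OF \<omega>, of k] by (simp add: divide_inverse mult.commute)
        ultimately show ?thesis
          by (simp only: add_divide_distrib)
      qed
      ultimately have "norm (\<zeta> \<omega>) \<le> norm (\<zeta> \<omega> + (- (\<zeta> \<omega> \<bullet> \<zeta> \<omega>)) *\<^sub>R \<zeta> \<omega>) + 0"
        by (intro LIMSEQ_le) auto
      also have "\<zeta> \<omega> \<bullet> \<zeta> \<omega> = 1"
        using norm_\<zeta> by (simp add: norm_eq_1)
      finally show False using norm_\<zeta> by simp
    qed
  qed
  then show ?thesis
    using AE_space
  proof eventually_elim
    case (elim \<omega>)
    then obtain k where k: "\<And>n. \<not> real (Suc k) \<le> norm (\<eta> n \<omega>)"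
      by (auto simp: A_def space_F)
    then have "norm (\<eta> n \<omega>) \<le> real (Suc k)" for n
      using less_imp_le not_le by blast
    then show ?case
      unfolding bounded_iff \<eta>_def by blast
  qed
qed

section \<open>Divergence to the left and exact optimizers\<close>

text \<open>If \<open>W\<close> stayed bounded below on a set, near-optimal positions from the
  capitals \<open>- n\<close> would there have values bounded below uniformly in \<open>n\<close>.
  Then \<open>bounded_positions\<close> would bound the capitals themselves.\<close>

lemma W_unbounded: "AE \<omega> in M. \<forall>a. \<exists>x. W x \<omega> < a"
proof -
  note W_meas[measurable]
  define Q where "Q = {\<omega>\<in>space F. \<exists>j::nat. \<forall>n::nat. - real j \<le> W (- real n) \<omega>}"
  have [measurable]: "Q \<in> sets F" unfolding Q_def by measurable
  \<comment> \<open>Capital \<open>0\<close> off \<open>Q\<close> supplies the uniform lower bound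
    there, so that \<open>bounded_positions\<close> applies on the whole space.\<close>
  define x where "x n \<omega> = (if \<omega> \<in> Q then - real n else 0)" for n \<omega>
  have x_meas [measurable]: "x n \<in> borel_measurable F" for n
    unfolding x_def by measurable
  have grid: "(\<lambda>\<omega>. grid_above 0 (x n \<omega>)) = x n" for n
    by (auto simp: grid_above_def x_def fun_eq_iff)
  \<comment> \<open>On \<open>Q\<close> the least \<open>j\<close> bounds \<open>W\<close> from
    below; off \<open>Q\<close> that term is an arbitrary nonnegative number and
    \<open>\<bar>W 0 \<omega>\<bar>\<close> does the work. The last \<open>1\<close> is the
    tolerance of the positions.\<close>
  define K where "K \<omega> = real (LEAST j. \<forall>n::nat. - real j \<le> W (- real n) \<omega>) + \<bar>W 0 \<omega>\<bar> + 1" for \<omega>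
  have "\<exists>\<xi>. min_norm_near_optimal (x n) 1 \<xi>" for n
  proof -
    have "near_optimal (x n) 1 \<noteq> {}"
      using near_optimal_grid_nonempty[OF x_meas[of n], of 1 0] by (simp add: grid)
    from near_optimal_min_norm[OF x_meas this] show ?thesis .
  qed
  then obtain \<xi> where opt: "\<And>n. min_norm_near_optimal (x n) 1 (\<xi> n)"
    by metis
  have \<xi>: "\<And>n. \<xi> n \<in> near_optimal (x n) 1"
    and min: "\<And>n \<zeta>. \<lbrakk>\<zeta> \<in> borel_measurable F; AE \<omega> in M. \<zeta> \<omega> \<bullet> Y \<omega> = 0\<rbrakk>
      \<Longrightarrow> AE \<omega> in M. norm (\<xi> n \<omega>) \<le> norm (\<xi> n \<omega> + \<zeta> \<omega>) + 1"
    using opt by (auto simp: min_norm_near_optimal_def)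
  have "AE \<omega> in M. bounded (range (\<lambda>n. (x n \<omega>, \<xi> n \<omega>)))"
  proof (rule bounded_positions[where Xb = "\<lambda>_. 0" and K = K])
    show "AE \<omega> in M. ereal (- K \<omega>) \<le> gen_cond_exp M F (payoff (x n) (\<xi> n)) \<omega>" for n
    proof -
      have "- K \<omega> \<le> W (x n \<omega>) \<omega> - 1" for \<omega>
      proof (cases "\<omega> \<in> Q")
        case True
        then have "\<exists>j::nat. \<forall>n::nat. - real j \<le> W (- real n) \<omega>" by (simp add: Q_def)
        then have "\<forall>n::nat. - real (LEAST j. \<forall>n::nat. - real j \<le> W (- real n) \<omega>) \<le> W (- real n) \<omega>"
          by (rule LeastI_ex)
        then have "- real (LEAST j. \<forall>n::nat. - real j \<le> W (- real n) \<omega>) \<le> W (- real n) \<omega>" ..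
        then show ?thesis using True by (simp add: K_def x_def)
      next
        case False
        then show ?thesis by (simp add: K_def x_def)
      qed
      then have le: "ereal (- K \<omega>) \<le> ereal (W (x n \<omega>) \<omega> - 1)" for \<omega>
        by simp
      have "AE \<omega> in M. ereal (W (x n \<omega>) \<omega> - 1) \<le> gen_cond_exp M F (payoff (x n) (\<xi> n)) \<omega>"
        using \<xi>[of n] by (simp add: near_optimal_def)
      then show ?thesis
        by eventually_elim (rule order_trans[OF le])
    qed
  qed (use \<xi> min in \<open>auto simp: near_optimal_def x_def K_def\<close>)
  then show ?thesis
    using AE_space
  proof eventually_elim
    case (elim \<omega>)
    then obtain b where b: "\<And>n. norm (x n \<omega>, \<xi> n \<omega>) \<le> b"
      by (auto simp: bounded_iff)
    have "\<omega> \<notin> Q"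
    proof
      assume "\<omega> \<in> Q"
      then have "real n \<le> b" for n
        using order_trans[OF norm_fst_le b[of n]] by (simp add: x_def)
      then show False by (meson not_le reals_Archimedean2)
    qed
    then have "\<exists>n::nat. W (- real n) \<omega> < - real j" for j :: nat
      using elim(2) by (auto simp: Q_def space_F not_le)
    moreover have "\<exists>j::nat. - real j \<le> a" for a
      using reals_Archimedean2[of "- a"] by (auto intro: less_imp_le simp: minus_le_iff)
    ultimately show ?case by (meson less_le_trans)
  qed
qed

text \<open>Replacing \<open>X\<close> by grid values from above reduces to constant initial capital, where the essential
  supremum is available, and keeps the value at least \<open>W X\<close>.\<close>

lemma optimal_step:
  assumes X [measurable]: "X \<in> borel_measurable F"
  shows "\<exists>\<xi>\<in>borel_measurable F. AE \<omega> in M. ereal (W (X \<omega>) \<omega>) = gen_cond_exp M F (payoff X \<xi>) \<omega>"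
proof -
  define x where "x n \<omega> = grid_above n (X \<omega>)" for n \<omega>
  have x_meas [measurable]: "x n \<in> borel_measurable F" for n
    unfolding x_def by measurable
  have "\<exists>\<xi>. min_norm_near_optimal (x n) (1 / Suc n) \<xi>" for n
  proof -
    have "near_optimal (x n) (1 / Suc n) \<noteq> {}"
      using near_optimal_grid_nonempty[OF X, of "1 / Suc n" n] by (simp add: x_def[abs_def])
    from near_optimal_min_norm[OF x_meas this] show ?thesis .
  qed
  then obtain \<xi>s where opt: "\<And>n. min_norm_near_optimal (x n) (1 / Suc n) (\<xi>s n)"
    by metis
  have \<xi>s: "\<And>n. \<xi>s n \<in> near_optimal (x n) (1 / Suc n)"
    and min: "\<And>n \<zeta>. \<lbrakk>\<zeta> \<in> borel_measurable F; AE \<omega> in M. \<zeta> \<omega> \<bullet> Y \<omega> = 0\<rbrakk>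
      \<Longrightarrow> AE \<omega> in M. norm (\<xi>s n \<omega>) \<le> norm (\<xi>s n \<omega> + \<zeta> \<omega>) + 1"
    using opt by (auto simp: min_norm_near_optimal_def)
  have \<xi>s_meas [measurable]: "\<xi>s n \<in> borel_measurable F" for n
    using \<xi>s by (simp add: near_optimal_def)
  have low: "AE \<omega> in M. ereal (W (X \<omega>) \<omega> - 1 / Suc n) \<le> gen_cond_exp M F (payoff (x n) (\<xi>s n)) \<omega>" for n
  proof -
    have le: "ereal (W (X \<omega>) \<omega> - 1 / Suc n) \<le> ereal (W (x n \<omega>) \<omega> - 1 / Suc n)" for \<omega>
      by (auto simp: x_def intro!: W_le grid_above_ge)
    have "AE \<omega> in M. ereal (W (x n \<omega>) \<omega> - 1 / Suc n) \<le> gen_cond_exp M F (payoff (x n) (\<xi>s n)) \<omega>"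
      using \<xi>s[of n] by (simp add: near_optimal_def)
    then show ?thesis
      by eventually_elim (rule order_trans[OF le])
  qed
  have "AE \<omega> in M. bounded (range (\<lambda>n. (x n \<omega>, \<xi>s n \<omega>)))"
  proof (rule bounded_positions[where Xb = "\<lambda>\<omega>. X \<omega> + 1" and K = "\<lambda>\<omega>. \<bar>W (X \<omega>) \<omega>\<bar> + 1"])
    fix n
    have le: "ereal (- (\<bar>W (X \<omega>) \<omega>\<bar> + 1)) \<le> ereal (W (X \<omega>) \<omega> - 1 / Suc n)" for \<omega>
    proof -
      have "1 / real (Suc n) \<le> 1" by simp
      then show ?thesis unfolding ereal_less_eq by linarith
    qed
    show "AE \<omega> in M. ereal (- (\<bar>W (X \<omega>) \<omega>\<bar> + 1)) \<le> gen_cond_exp M F (payoff (x n) (\<xi>s n)) \<omega>"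
      using low[of n] by eventually_elim (rule order_trans[OF le])
  qed (use min in \<open>auto simp: x_def intro: grid_above_le1\<close>)
  then have bdd: "AE \<omega> in M. \<exists>b::nat. \<forall>n. norm (\<xi>s n \<omega>) \<le> real b"
  proof eventually_elim
    case (elim \<omega>)
    then obtain b where b: "\<And>n. norm (x n \<omega>, \<xi>s n \<omega>) \<le> b"
      by (auto simp: bounded_iff)
    obtain c :: nat where "b \<le> real c" using real_arch_simple by blast
    then show ?case
      using order_trans[OF norm_snd_le b] order_trans by (metis snd_conv)
  qed
  define D where "D = {\<omega>\<in>space F. \<exists>b::nat. \<forall>n. norm (\<xi>s n \<omega>) \<le> real b}"
  have D [measurable]: "D \<in> sets F" unfolding D_def by measurable
  have D_bounded: "bounded (range (\<lambda>n. \<xi>s n \<omega>))" if "\<omega> \<in> D" for \<omega>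
    using that by (auto simp: D_def bounded_iff)
  obtain N \<xi> where N [measurable]: "\<And>k. N k \<in> measurable F (count_space (UNIV :: nat set))"
    and N_ge: "\<And>\<omega> k. \<omega> \<in> space F \<Longrightarrow> N k \<omega> \<ge> k"
    and \<xi> [measurable]: "\<xi> \<in> borel_measurable F"
    and lim: "\<And>\<omega>. \<omega> \<in> D \<Longrightarrow> (\<lambda>k. \<xi>s (N k \<omega>) \<omega>) \<longlonglongrightarrow> \<xi> \<omega>"
    by (rule random_subsequence[OF \<xi>s_meas D], erule D_bounded) blast
  define R where "R \<omega> = real (LEAST b. \<forall>n. norm (\<xi>s n \<omega>) \<le> real b)" for \<omega>
  have [measurable]: "R \<in> borel_measurable F" unfolding R_def by measurable
  have R: "norm (\<xi>s n \<omega>) \<le> R \<omega>" if "\<omega> \<in> D" for n \<omega>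
  proof -
    have "\<exists>b::nat. \<forall>n. norm (\<xi>s n \<omega>) \<le> real b" using that by (simp add: D_def)
    from LeastI_ex[OF this] show ?thesis by (simp add: R_def)
  qed
  define z where "z k \<omega> = payoff (x (N k \<omega>)) (\<xi>s (N k \<omega>)) \<omega>" for k \<omega>
  have [measurable]: "z k \<in> borel_measurable M" for k
  proof -
    note N[THEN measurable_F_imp_M, measurable]
    show ?thesis unfolding z_def by measurable
  qed
  have z_eq: "z k = payoff (\<lambda>\<omega>. x (N k \<omega>) \<omega>) (\<lambda>\<omega>. \<xi>s (N k \<omega>) \<omega>)" for k
    by (simp add: z_def fun_eq_iff payoff_def)
  have z_low: "AE \<omega> in M. \<forall>k. ereal (W (X \<omega>) \<omega> - 1 / Suc k) \<le> gen_cond_exp M F (z k) \<omega>"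
    unfolding AE_all_countable
  proof
    fix k
    have "AE \<omega> in M. gen_cond_exp M F (z k) \<omega> = gen_cond_exp M F (payoff (x (N k \<omega>)) (\<xi>s (N k \<omega>))) \<omega>"
      unfolding z_eq by (rule gen_cond_exp_payoff_patch) measurable
    moreover have "AE \<omega> in M. \<forall>n. ereal (W (X \<omega>) \<omega> - 1 / Suc n) \<le> gen_cond_exp M F (payoff (x n) (\<xi>s n)) \<omega>"
      unfolding AE_all_countable using low by simp
    ultimately show "AE \<omega> in M. ereal (W (X \<omega>) \<omega> - 1 / Suc k) \<le> gen_cond_exp M F (z k) \<omega>"
      using AE_space
    proof eventually_elim
      case (elim \<omega>)
      have "1 / real (Suc (N k \<omega>)) \<le> 1 / real (Suc k)"
        using N_ge[of \<omega> k] elim(3) by (simp add: space_F divide_simps)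
      then have "ereal (W (X \<omega>) \<omega> - 1 / Suc k) \<le> ereal (W (X \<omega>) \<omega> - 1 / Suc (N k \<omega>))"
        by simp
      also have "\<dots> \<le> gen_cond_exp M F (z k) \<omega>"
        using elim(1,2) by simp
      finally show ?case .
    qed
  qed
  \<comment> \<open>Fatou's lemma for the payoffs needs a majorant with conditionally finite mean.
    It is built from finitely many positions along the coordinate axes, with the norm bound
    \<open>R\<close> and the capital \<open>X + 1\<close>, which exceeds every grid value.\<close>
  define d where "d = real DIM('b)"
  define P where "P s b = payoff (\<lambda>\<omega>. X \<omega> + 1) (\<lambda>\<omega>. (s * d * R \<omega>) *\<^sub>R b)" for s :: real and b :: 'b
  have P_meas [measurable]: "P s b \<in> borel_measurable M" for s b
    unfolding P_def by (rule payoff_meas) measurable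
  define Dm where "Dm \<omega> = (\<Sum>b\<in>Basis. max 0 (P 1 b \<omega>) + max 0 (P (-1) b \<omega>))" for \<omega>
  \<comment> \<open>\<open>\<xi> \<bullet> Y\<close> is at most \<open>DIM('b) * norm \<xi>\<close> times the largest \<open>\<bar>b \<bullet> Y\<bar>\<close>, so finitely many positions dominate.\<close>
  have Dm_nonneg: "0 \<le> Dm \<omega>" for \<omega>
    unfolding Dm_def by (intro sum_nonneg) auto
  have [measurable]: "Dm \<in> borel_measurable M"
    unfolding Dm_def by measurable
  have Dm_fin: "AE \<omega> in M. cpos Dm \<omega> < \<infinity>"
  proof -
    have "AE \<omega> in M. nn_cond_exp M F (\<lambda>\<omega>. ennreal (P 1 b \<omega>) + ennreal (P (-1) b \<omega>)) \<omega> < \<infinity>" for b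
    proof -
      have "AE \<omega> in M. cpos (P 1 b) \<omega> + cpos (P (-1) b) \<omega>
          = nn_cond_exp M F (\<lambda>\<omega>. ennreal (P 1 b \<omega>) + ennreal (P (-1) b \<omega>)) \<omega>"
        by (rule nn_cond_exp_sum) measurable
      moreover have "AE \<omega> in M. cpos (P 1 b) \<omega> < \<infinity>" "AE \<omega> in M. cpos (P (-1) b) \<omega> < \<infinity>"
        unfolding P_def by (rule cpos_payoff_finite; measurable)+
      ultimately show ?thesis
      proof eventually_elim
        case (elim \<omega>)
        show ?case unfolding elim(1)[symmetric] using elim(2,3) by simp
      qed
    qed
    then have "AE \<omega> in M.
      nn_cond_exp M F (\<lambda>\<omega>. \<Sum>b\<in>Basis. ennreal (P 1 b \<omega>) + ennreal (P (-1) b \<omega>)) \<omega> < \<infinity>"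
      by (intro nn_cond_exp_sum_finite) auto
    moreover have "(\<Sum>b\<in>Basis. ennreal (P 1 b \<omega>) + ennreal (P (-1) b \<omega>)) = ennreal (Dm \<omega>)" for \<omega>
      unfolding Dm_def by (simp flip: sum_ennreal add: ennreal_plus)
    ultimately show ?thesis by simp
  qed
  have z_le: "z k \<omega> \<le> Dm \<omega>" if "\<omega> \<in> D" for k \<omega>
  proof -
    define v where "v = \<xi>s (N k \<omega>) \<omega>"
    define mx where "mx = Max ((\<lambda>b. \<bar>b \<bullet> Y \<omega>\<bar>) ` Basis)"
    have "mx \<in> (\<lambda>b. \<bar>b \<bullet> Y \<omega>\<bar>) ` Basis"
      unfolding mx_def by (intro Max_in) auto
    then obtain b0 where b0: "b0 \<in> Basis" "mx = \<bar>b0 \<bullet> Y \<omega>\<bar>" by auto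
    have le_mx: "\<bar>b \<bullet> Y \<omega>\<bar> \<le> mx" if "b \<in> Basis" for b
      unfolding mx_def using that by (intro Max_ge) auto
    have R_ge: "norm v \<le> R \<omega>" unfolding v_def by (rule R[OF that])
    have "v \<bullet> Y \<omega> = (\<Sum>b\<in>Basis. (v \<bullet> b) * (Y \<omega> \<bullet> b))"
      by (rule euclidean_inner)
    also have "\<dots> \<le> (\<Sum>b\<in>(Basis :: 'b set). R \<omega> * mx)"
    proof (rule sum_mono)
      fix b :: 'b assume b: "b \<in> Basis"
      have "(v \<bullet> b) * (Y \<omega> \<bullet> b) \<le> \<bar>v \<bullet> b\<bar> * \<bar>Y \<omega> \<bullet> b\<bar>"
        by (simp flip: abs_mult)
      also have "\<dots> \<le> R \<omega> * mx"
        using Basis_le_norm[OF b, of v] R_ge le_mx[OF b]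
        by (intro mult_mono) (auto simp: inner_commute intro: order_trans[OF norm_ge_zero])
      finally show "(v \<bullet> b) * (Y \<omega> \<bullet> b) \<le> R \<omega> * mx" .
    qed
    also have "\<dots> = d * R \<omega> * mx"
      by (simp add: d_def)
    finally have "v \<bullet> Y \<omega> \<le> d * R \<omega> * mx" .
    then obtain s :: real where s: "s = 1 \<or> s = -1" and "v \<bullet> Y \<omega> \<le> ((s * d * R \<omega>) *\<^sub>R b0) \<bullet> Y \<omega>"
      using b0(2) that[of 1] that[of "-1"] by (cases "0 \<le> b0 \<bullet> Y \<omega>") (auto simp: algebra_simps)
    then have "z k \<omega> \<le> P s b0 \<omega>"
      unfolding z_def P_def payoff_def v_def x_def
      by (intro V_le add_mono grid_above_le1)
    also have "\<dots> \<le> max 0 (P 1 b0 \<omega>) + max 0 (P (-1) b0 \<omega>)"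
      using s by auto
    also have "\<dots> \<le> Dm \<omega>"
      unfolding Dm_def using b0(1) by (intro member_le_sum) auto
    finally show ?thesis .
  qed
  have AE_D: "AE \<omega> in M. \<omega> \<in> D"
    using bdd AE_space by eventually_elim (simp add: D_def space_F)
  have z_lim: "(\<lambda>k. z k \<omega>) \<longlonglongrightarrow> payoff X \<xi> \<omega>" if "\<omega> \<in> D" for \<omega>
  proof -
    have "filterlim (\<lambda>k. N k \<omega>) sequentially sequentially"
      using N_ge[of \<omega>] that by (intro filterlim_at_top_mono[OF filterlim_ident]) (auto simp: D_def)
    from filterlim_compose[OF grid_above_tendsto this]
    have "(\<lambda>k. x (N k \<omega>) \<omega>) \<longlonglongrightarrow> X \<omega>" by (simp add: x_def)
    then show ?thesis
      unfolding z_def payoff_def by (intro V_lim tendsto_intros lim that)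
  qed
  let ?z = "payoff X \<xi>"
  \<comment> \<open>This is the conditional mean of \<open>Dm - f\<close> without subtraction: for
    \<open>f \<le> Dm\<close> and \<open>0 \<le> Dm\<close>, adding the positive part of
    \<open>f\<close> to \<open>Dm - f\<close> gives \<open>Dm\<close> plus the negative part of
    \<open>f\<close>.\<close>
  have balance: "AE \<omega> in M. nn_cond_exp M F (\<lambda>\<omega>. ennreal (Dm \<omega> - f \<omega>)) \<omega> + cpos f \<omega> = cpos Dm \<omega> + cneg f \<omega>"
    if [measurable]: "f \<in> borel_measurable M" and le: "\<And>\<omega>. \<omega> \<in> D \<Longrightarrow> f \<omega> \<le> Dm \<omega>" for f
  proof -
    have "AE \<omega> in M. nn_cond_exp M F (\<lambda>\<omega>. ennreal (Dm \<omega> - f \<omega>)) \<omega> + cpos f \<omega>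
        = nn_cond_exp M F (\<lambda>\<omega>. ennreal (Dm \<omega> - f \<omega>) + ennreal (f \<omega>)) \<omega>"
      by (rule nn_cond_exp_sum) measurable
    moreover have "AE \<omega> in M. cpos Dm \<omega> + cneg f \<omega> = nn_cond_exp M F (\<lambda>\<omega>. ennreal (Dm \<omega>) + ennreal (- f \<omega>)) \<omega>"
      by (rule nn_cond_exp_sum) measurable
    moreover have "AE \<omega> in M. nn_cond_exp M F (\<lambda>\<omega>. ennreal (Dm \<omega> - f \<omega>) + ennreal (f \<omega>)) \<omega>
        = nn_cond_exp M F (\<lambda>\<omega>. ennreal (Dm \<omega>) + ennreal (- f \<omega>)) \<omega>"
    proof (rule nn_cond_exp_cong)
      show "AE \<omega> in M. ennreal (Dm \<omega> - f \<omega>) + ennreal (f \<omega>) = ennreal (Dm \<omega>) + ennreal (- f \<omega>)"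
        using AE_D
      proof eventually_elim
        case (elim \<omega>)
        then show ?case
          using le[OF elim] Dm_nonneg[of \<omega>]
          by (cases "0 \<le> f \<omega>") (auto simp: ennreal_neg simp flip: ennreal_plus)
      qed
    qed measurable
    ultimately show ?thesis by eventually_elim simp
  qed
  have z_lim_le: "?z \<omega> \<le> Dm \<omega>" if "\<omega> \<in> D" for \<omega>
    by (rule LIMSEQ_le_const2[OF z_lim[OF that]]) (use z_le[OF that] in auto)
  have "AE \<omega> in M. nn_cond_exp M F (\<lambda>\<omega>. ennreal (Dm \<omega> - ?z \<omega>)) \<omega>
      \<le> liminf (\<lambda>k. nn_cond_exp M F (\<lambda>\<omega>. ennreal (Dm \<omega> - z k \<omega>)) \<omega>)"
  proof -
    have "AE \<omega> in M. nn_cond_exp M F (\<lambda>\<omega>. ennreal (Dm \<omega> - ?z \<omega>)) \<omega>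
        = nn_cond_exp M F (\<lambda>\<omega>. liminf (\<lambda>k. ennreal (Dm \<omega> - z k \<omega>))) \<omega>"
    proof (rule nn_cond_exp_cong)
      show "AE \<omega> in M. ennreal (Dm \<omega> - ?z \<omega>) = liminf (\<lambda>k. ennreal (Dm \<omega> - z k \<omega>))"
        using AE_D
      proof eventually_elim
        case (elim \<omega>)
        have "(\<lambda>k. ennreal (Dm \<omega> - z k \<omega>)) \<longlonglongrightarrow> ennreal (Dm \<omega> - ?z \<omega>)"
          by (intro tendsto_ennrealI tendsto_intros z_lim elim)
        then show ?case by (simp add: lim_imp_Liminf)
      qed
    qed measurable
    moreover have "AE \<omega> in M. nn_cond_exp M F (\<lambda>\<omega>. liminf (\<lambda>k. ennreal (Dm \<omega> - z k \<omega>))) \<omega>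
        \<le> liminf (\<lambda>k. nn_cond_exp M F (\<lambda>\<omega>. ennreal (Dm \<omega> - z k \<omega>)) \<omega>)"
      by (rule nn_cond_exp_Fatou) measurable
    ultimately show ?thesis by eventually_elim simp
  qed
  moreover have "AE \<omega> in M. \<forall>k. nn_cond_exp M F (\<lambda>\<omega>. ennreal (Dm \<omega> - z k \<omega>)) \<omega> + cpos (z k) \<omega> = cpos Dm \<omega> + cneg (z k) \<omega>"
    unfolding AE_all_countable by (intro allI balance z_le) measurable
  moreover have "AE \<omega> in M. nn_cond_exp M F (\<lambda>\<omega>. ennreal (Dm \<omega> - ?z \<omega>)) \<omega> + cpos ?z \<omega> = cpos Dm \<omega> + cneg ?z \<omega>"
    by (intro balance z_lim_le) measurable
  moreover have "AE \<omega> in M. \<forall>k. cpos (z k) \<omega> < \<infinity>"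
    unfolding AE_all_countable z_eq by (intro allI cpos_payoff_finite) measurable
  moreover have "AE \<omega> in M. cpos ?z \<omega> < \<infinity>"
    by (rule cpos_payoff_finite) measurable
  moreover have "AE \<omega> in M. gen_cond_exp M F ?z \<omega> \<le> ereal (W (X \<omega>) \<omega>)"
    by (rule gen_cond_exp_payoff_le) measurable
  ultimately have "AE \<omega> in M. ereal (W (X \<omega>) \<omega>) = gen_cond_exp M F ?z \<omega>"
    using z_low Dm_fin
  proof eventually_elim
    case (elim \<omega>)
    define D0 where "D0 = enn2real (cpos Dm \<omega>)"
    have D0: "cpos Dm \<omega> = ennreal D0" "0 \<le> D0"
      using elim(8) by (auto simp: D0_def)
    have ek: "nn_cond_exp M F (\<lambda>\<omega>. ennreal (Dm \<omega> - z k \<omega>)) \<omega> \<le> ennreal (D0 - W (X \<omega>) \<omega> + 1 / Suc k)"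
      and ek_nonneg: "0 \<le> D0 - W (X \<omega>) \<omega> + 1 / Suc k" for k
    proof -
      define a b where "a = enn2real (cpos (z k) \<omega>)" and "b = enn2real (cneg (z k) \<omega>)"
      have fin: "cpos (z k) \<omega> < \<infinity>" "cneg (z k) \<omega> < \<infinity>" and ge: "W (X \<omega>) \<omega> - 1 / Suc k \<le> a - b"
        using elim(4) elim(7)[rule_format, of k] by (auto simp: le_gen_cond_exp_iff a_def b_def simp del: of_nat_Suc)
      have ab: "cpos (z k) \<omega> = ennreal a" "cneg (z k) \<omega> = ennreal b" "0 \<le> a" "0 \<le> b"
        using fin by (auto simp: a_def b_def)
      have eq: "nn_cond_exp M F (\<lambda>\<omega>. ennreal (Dm \<omega> - z k \<omega>)) \<omega> + ennreal a = ennreal (D0 + b)"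
        using elim(2)[rule_format, of k] D0 ab by simp
      then have "nn_cond_exp M F (\<lambda>\<omega>. ennreal (Dm \<omega> - z k \<omega>)) \<omega> = ennreal (D0 + b) - ennreal a"
        by (metis ennreal_add_diff_cancel_right ennreal_neq_top)
      also have "\<dots> = ennreal (D0 + b - a)"
        using ab by (simp add: ennreal_minus)
      also have "\<dots> \<le> ennreal (D0 - W (X \<omega>) \<omega> + 1 / Suc k)"
        using ge by (intro ennreal_leI) linarith
      finally show "nn_cond_exp M F (\<lambda>\<omega>. ennreal (Dm \<omega> - z k \<omega>)) \<omega> \<le> ennreal (D0 - W (X \<omega>) \<omega> + 1 / Suc k)" .
      have "ennreal a \<le> ennreal (D0 + b)"
        unfolding eq[symmetric] by simp
      then have "a \<le> D0 + b"
        using D0 ab by (subst (asm) ennreal_le_iff) auto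
      then show "0 \<le> D0 - W (X \<omega>) \<omega> + 1 / Suc k"
        using ge by linarith
    qed
    have lim0: "(\<lambda>k. D0 - W (X \<omega>) \<omega> + 1 / Suc k) \<longlonglongrightarrow> D0 - W (X \<omega>) \<omega>"
      using tendsto_add[OF tendsto_const LIMSEQ_inverse_real_of_nat, of "D0 - W (X \<omega>) \<omega>"]
      by (simp add: divide_inverse)
    \<comment> \<open>Since \<open>ennreal\<close> truncates at \<open>0\<close>, a bound by
      \<open>ennreal (D0 - W (X \<omega>) \<omega>)\<close> is a bound by the real number only once
      this is known.\<close>
    have D0_ge: "0 \<le> D0 - W (X \<omega>) \<omega>"
      by (rule LIMSEQ_le_const[OF lim0]) (use ek_nonneg in blast)
    from ek have "liminf (\<lambda>k. nn_cond_exp M F (\<lambda>\<omega>. ennreal (Dm \<omega> - z k \<omega>)) \<omega>)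
        \<le> liminf (\<lambda>k. ennreal (D0 - W (X \<omega>) \<omega> + 1 / Suc k))"
      by (intro Liminf_mono) auto
    also have "\<dots> = ennreal (D0 - W (X \<omega>) \<omega>)"
      using tendsto_ennrealI[OF lim0] by (simp add: lim_imp_Liminf)
    finally have E: "nn_cond_exp M F (\<lambda>\<omega>. ennreal (Dm \<omega> - ?z \<omega>)) \<omega> \<le> ennreal (D0 - W (X \<omega>) \<omega>)"
      using elim(1) by (rule order_trans[rotated])
    define a where "a = enn2real (cpos ?z \<omega>)"
    have a: "cpos ?z \<omega> = ennreal a" "0 \<le> a"
      using elim(5) by (auto simp: a_def)
    define e where "e = enn2real (nn_cond_exp M F (\<lambda>\<omega>. ennreal (Dm \<omega> - ?z \<omega>)) \<omega>)"
    have e: "nn_cond_exp M F (\<lambda>\<omega>. ennreal (Dm \<omega> - ?z \<omega>)) \<omega> = ennreal e" "0 \<le> e"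
      using le_less_trans[OF E ennreal_less_top] by (auto simp: e_def)
    have sum: "ennreal (e + a) = ennreal D0 + cneg ?z \<omega>"
      using elim(3) e a D0 by simp
    then have "cneg ?z \<omega> \<noteq> \<infinity>"
      by (metis ennreal_add_eq_top ennreal_neq_top infinity_ennreal_def)
    define b where "b = enn2real (cneg ?z \<omega>)"
    have b: "cneg ?z \<omega> = ennreal b" "0 \<le> b"
      using \<open>cneg ?z \<omega> \<noteq> \<infinity>\<close> by (auto simp: b_def top.not_eq_extremum)
    \<comment> \<open>So \<open>a - b = D0 - e\<close>. Fatou's bound
      \<open>e \<le> D0 - W (X \<omega>) \<omega>\<close> makes the value of the limit at least
      \<open>W (X \<omega>) \<omega>\<close>, and the essential supremum gives the opposite
      inequality.\<close>
    have "e + a = D0 + b"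
      using sum e a b D0 by (simp flip: ennreal_plus)
    moreover have "a - b \<le> W (X \<omega>) \<omega>"
      using elim(6) gen_cond_exp_eq_real[of ?z \<omega>] a b by simp
    moreover have "e \<le> D0 - W (X \<omega>) \<omega>"
      using E e D0_ge by (simp add: ennreal_le_iff)
    ultimately have "a - b = W (X \<omega>) \<omega>"
      by linarith
    then show ?case
      using gen_cond_exp_eq_real[of ?z \<omega>] a b by simp
  qed
  then show ?thesis using \<xi> by auto
qed

section \<open>Inheritance of growth and transfer of expectations across one step\<close>

text \<open>Half of an optimal position for capital \<open>x\<close> is available from capital
  \<open>x / 2\<close>, and conditioning the inequality for \<open>V\<close> along it gives the one
  for \<open>W\<close>. An exact optimizer keeps the constant \<open>C\<close> the same at every
  step. Countably many grid points and continuity give all \<open>x\<close> at once.\<close>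

lemma W_growth_coeff:
  assumes c: "0 \<le> c" and V: "AE \<omega> in M. \<forall>x. c * V x \<omega> - C \<le> V (x / 2) \<omega>"
  shows "AE \<omega> in M. \<forall>x. c * W x \<omega> - C \<le> W (x / 2) \<omega>"
proof -
  have const: "AE \<omega> in M. c * W x \<omega> - C \<le> W (x / 2) \<omega>" for x
  proof -
    have "(\<lambda>_. x) \<in> borel_measurable F" by simp
    from optimal_step[OF this] obtain \<xi> where \<xi> [measurable]: "\<xi> \<in> borel_measurable F"
      and opt: "AE \<omega> in M. ereal (W x \<omega>) = gen_cond_exp M F (payoff (\<lambda>_. x) \<xi>) \<omega>"
      by blast
    let ?f = "payoff (\<lambda>_. x) \<xi>" and ?h = "payoff (\<lambda>_. x / 2) (\<lambda>\<omega>. \<xi> \<omega> /\<^sub>R 2)"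
    have fin: "AE \<omega> in M. cpos ?f \<omega> < \<infinity>" "AE \<omega> in M. cpos ?h \<omega> < \<infinity>"
      by (rule cpos_payoff_finite; measurable)+
    have finn: "AE \<omega> in M. cneg ?f \<omega> < \<infinity> \<and> W x \<omega> \<le> enn2real (cpos ?f \<omega>) - enn2real (cneg ?f \<omega>)"
      using opt fin(1) by eventually_elim (metis le_gen_cond_exp_iff order_refl)
    have "AE \<omega> in M. cneg ?h \<omega> < \<infinity> \<and>
      c * enn2real (cpos ?f \<omega>) - c * enn2real (cneg ?f \<omega>) - C \<le> enn2real (cpos ?h \<omega>) - enn2real (cneg ?h \<omega>)"
    proof (rule cond_exp_linear_bound)
      show "AE \<omega> in M. c * max 0 (?f \<omega>) - c * max 0 (- ?f \<omega>) - C \<le> ?h \<omega>"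
        using V
      proof eventually_elim
        case (elim \<omega>)
        show ?case
          using elim[rule_format, of "x + \<xi> \<omega> \<bullet> Y \<omega>"]
          by (auto simp: payoff_def max_def add_divide_distrib)
      qed
    qed (use fin finn c pqC in auto)
    moreover have "AE \<omega> in M. gen_cond_exp M F ?h \<omega> \<le> ereal (W (x / 2) \<omega>)"
      by (rule gen_cond_exp_payoff_le) measurable
    ultimately show ?thesis
      using fin finn
    proof eventually_elim
      case (elim \<omega>)
      have "c * W x \<omega> \<le> c * (enn2real (cpos ?f \<omega>) - enn2real (cneg ?f \<omega>))"
        using elim c by (intro mult_left_mono) auto
      then show ?case
        using elim gen_cond_exp_eq_real[of ?h \<omega>] by (simp add: right_diff_distrib)
    qed
  qed
  have "AE \<omega> in M. \<forall>n. \<forall>i :: int. c * W (real_of_int i / real (Suc n)) \<omega> - C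
      \<le> W (real_of_int i / real (Suc n) / 2) \<omega>"
    unfolding AE_all_countable using const by blast
  then show ?thesis
  proof eventually_elim
    case (elim \<omega>)
    show ?case
    proof
      fix x
      have "c * W (grid_above n x) \<omega> - C \<le> W (grid_above n x / 2) \<omega>" for n
        using elim unfolding grid_above_def by blast
      moreover have "(\<lambda>n. c * W (grid_above n x) \<omega> - C) \<longlonglongrightarrow> c * W x \<omega> - C"
        "(\<lambda>n. W (grid_above n x / 2) \<omega>) \<longlonglongrightarrow> W (x / 2) \<omega>"
        by (intro tendsto_intros W_lim grid_above_tendsto; simp)+
      ultimately show "c * W x \<omega> - C \<le> W (x / 2) \<omega>"
        using LIMSEQ_le by blast
    qed
  qed
qed

lemma W_growth: "AE \<omega> in M. \<forall>x. p * W x \<omega> - C \<le> W (x / 2) \<omega> \<and> q * W x \<omega> - C \<le> W (x / 2) \<omega>"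
proof -
  have "AE \<omega> in M. \<forall>x. p * W x \<omega> - C \<le> W (x / 2) \<omega>" "AE \<omega> in M. \<forall>x. q * W x \<omega> - C \<le> W (x / 2) \<omega>"
    using V_growth pqC by (intro W_growth_coeff; auto elim!: eventually_mono)+
  then show ?thesis by eventually_elim blast
qed

text \<open>The zero position is available, so a constant lower bound survives conditioning and the
  essential supremum.\<close>

lemma W_lower:
  assumes "0 \<le> l" and V: "AE \<omega> in M. - l \<le> V x \<omega>"
  shows "AE \<omega> in M. - l \<le> W x \<omega>"
proof -
  let ?f = "payoff (\<lambda>_. x) (\<lambda>_. 0)"
  have "AE \<omega> in M. cneg ?f \<omega> \<le> nn_cond_exp M F (\<lambda>_. ennreal l) \<omega>"
    using V by (intro nn_cond_exp_mono) (auto simp: payoff_def elim!: eventually_mono intro!: ennreal_leI)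
  moreover have "AE \<omega> in M. gen_cond_exp M F ?f \<omega> \<le> ereal (W x \<omega>)"
    by (rule gen_cond_exp_payoff_const_le) simp
  moreover have "AE \<omega> in M. cpos ?f \<omega> < \<infinity>"
    by (rule cpos_payoff_const_finite) simp
  moreover note nn_cond_exp_const[of "ennreal l"]
  ultimately show ?thesis
  proof eventually_elim
    case (elim \<omega>)
    then have le: "cneg ?f \<omega> \<le> ennreal l" by simp
    then have fin: "cneg ?f \<omega> < \<infinity>"
      using ennreal_less_top le_less_trans unfolding infinity_ennreal_def by blast
    have "enn2real (cneg ?f \<omega>) \<le> l"
      using enn2real_mono[OF le] \<open>0 \<le> l\<close> by simp
    then show ?case
      using elim(2) gen_cond_exp_eq_real[OF elim(3) fin] enn2real_nonneg[of "cpos ?f \<omega>"]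
      by (auto simp del: enn2real_nonneg)
  qed
qed

text \<open>The second claim is the inequality of expectations with negative parts moved across, so
  it makes sense while the positive parts may still be infinite.\<close>

lemma payoff_upper_step:
  assumes [measurable]: "X \<in> borel_measurable F" "\<xi> \<in> borel_measurable F"
    and neg: "(\<integral>\<^sup>+\<omega>. ennreal (- payoff X \<xi> \<omega>) \<partial>M) < \<infinity>"
  shows "(\<integral>\<^sup>+\<omega>. ennreal (- W (X \<omega>) \<omega>) \<partial>M) < \<infinity>"
    and "(\<integral>\<^sup>+\<omega>. ennreal (payoff X \<xi> \<omega>) \<partial>M) + (\<integral>\<^sup>+\<omega>. ennreal (- W (X \<omega>) \<omega>) \<partial>M)
      \<le> (\<integral>\<^sup>+\<omega>. ennreal (- payoff X \<xi> \<omega>) \<partial>M) + (\<integral>\<^sup>+\<omega>. ennreal (W (X \<omega>) \<omega>) \<partial>M)"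
proof -
  let ?f = "payoff X \<xi>"
  have WX [measurable]: "(\<lambda>\<omega>. W (X \<omega>) \<omega>) \<in> borel_measurable M"
    by (rule measurable_F_imp_M) measurable
  have int: "(\<integral>\<^sup>+\<omega>. cpos ?f \<omega> \<partial>M) = (\<integral>\<^sup>+\<omega>. ennreal (?f \<omega>) \<partial>M)"
      "(\<integral>\<^sup>+\<omega>. cneg ?f \<omega> \<partial>M) = (\<integral>\<^sup>+\<omega>. ennreal (- ?f \<omega>) \<partial>M)"
    by (rule nn_integral_nn_cond_exp; measurable)+
  have "AE \<omega> in M. cneg ?f \<omega> \<noteq> \<infinity>"
    using neg unfolding int(2)[symmetric] by (intro nn_integral_PInf_AE) auto
  moreover have "AE \<omega> in M. cpos ?f \<omega> < \<infinity>"
    by (rule cpos_payoff_finite) measurable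
  moreover have "AE \<omega> in M. gen_cond_exp M F ?f \<omega> \<le> ereal (W (X \<omega>) \<omega>)"
    by (rule gen_cond_exp_payoff_le) measurable
  ultimately have *: "AE \<omega> in M. cpos ?f \<omega> + ennreal (- W (X \<omega>) \<omega>) \<le> cneg ?f \<omega> + ennreal (W (X \<omega>) \<omega>) \<and>
      ennreal (- W (X \<omega>) \<omega>) \<le> cneg ?f \<omega>"
  proof eventually_elim
    case (elim \<omega>)
    define a b where "a = enn2real (cpos ?f \<omega>)" and "b = enn2real (cneg ?f \<omega>)"
    have fin: "cpos ?f \<omega> < \<infinity>" "cneg ?f \<omega> < \<infinity>"
      using elim by (auto simp: top.not_eq_extremum)
    have ab: "cpos ?f \<omega> = ennreal a" "cneg ?f \<omega> = ennreal b" "0 \<le> a" "0 \<le> b"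
      using fin by (auto simp: a_def b_def)
    have "a - b \<le> W (X \<omega>) \<omega>"
      using elim(3) gen_cond_exp_eq_real[OF fin] by (simp add: a_def b_def)
    then show ?case
      using ab by (cases "0 \<le> W (X \<omega>) \<omega>") (auto simp: ennreal_neg intro!: ennreal_leI simp flip: ennreal_plus)
  qed
  have "(\<integral>\<^sup>+\<omega>. ennreal (- W (X \<omega>) \<omega>) \<partial>M) \<le> (\<integral>\<^sup>+\<omega>. cneg ?f \<omega> \<partial>M)"
    using * by (intro nn_integral_mono_AE) auto
  then show "(\<integral>\<^sup>+\<omega>. ennreal (- W (X \<omega>) \<omega>) \<partial>M) < \<infinity>"
    using neg int(2) by (auto intro: le_less_trans)
  have "(\<integral>\<^sup>+\<omega>. cpos ?f \<omega> + ennreal (- W (X \<omega>) \<omega>) \<partial>M) \<le> (\<integral>\<^sup>+\<omega>. cneg ?f \<omega> + ennreal (W (X \<omega>) \<omega>) \<partial>M)"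
    using * by (intro nn_integral_mono_AE) auto
  then show "(\<integral>\<^sup>+\<omega>. ennreal (?f \<omega>) \<partial>M) + (\<integral>\<^sup>+\<omega>. ennreal (- W (X \<omega>) \<omega>) \<partial>M)
      \<le> (\<integral>\<^sup>+\<omega>. ennreal (- ?f \<omega>) \<partial>M) + (\<integral>\<^sup>+\<omega>. ennreal (W (X \<omega>) \<omega>) \<partial>M)"
    by (simp add: nn_integral_add int)
qed

text \<open>Equality of the conditional mean with an integrable function does not by itself make the
  payoff integrable, as gains and losses could cancel. The halving bound gives an integrable
  majorant of the conditional gain, and the balance of the parts then controls the loss.\<close>

lemma optimal_payoff_integrable:
  assumes [measurable]: "X \<in> borel_measurable F" "\<xi> \<in> borel_measurable F"
    and opt: "AE \<omega> in M. ereal (W (X \<omega>) \<omega>) = gen_cond_exp M F (payoff X \<xi>) \<omega>"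
    and W: "integrable M (\<lambda>\<omega>. W (X \<omega>) \<omega>)" and half: "(\<integral>\<^sup>+\<omega>. ennreal (W (X \<omega> / 2) \<omega>) \<partial>M) < \<infinity>"
  shows "integrable M (payoff X \<xi>)" and "(\<integral>\<omega>. payoff X \<xi> \<omega> \<partial>M) = (\<integral>\<omega>. W (X \<omega>) \<omega> \<partial>M)"
proof -
  let ?f = "payoff X \<xi>"
  \<comment> \<open>By optimality the conditional mean equals
    \<open>W (X \<omega>) \<omega>\<close>, so the negative part of the latter is an admissible and
    integrable choice of \<open>K\<close> in \<open>cpos_payoff_bound\<close>.\<close>
  let ?K = "\<lambda>\<omega>. max 0 (- W (X \<omega>) \<omega>)"
  let ?b = "\<lambda>\<omega>. (max 0 (W (X \<omega> / 2) \<omega>) + p * ?K \<omega> + C) / (q - p)"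
  have [measurable]: "(\<lambda>\<omega>. W (X \<omega>) \<omega>) \<in> borel_measurable M" "(\<lambda>\<omega>. W (X \<omega> / 2) \<omega>) \<in> borel_measurable M"
    by (rule measurable_F_imp_M; measurable)+
  have int: "(\<integral>\<^sup>+\<omega>. cpos ?f \<omega> \<partial>M) = (\<integral>\<^sup>+\<omega>. ennreal (?f \<omega>) \<partial>M)"
      "(\<integral>\<^sup>+\<omega>. cneg ?f \<omega> \<partial>M) = (\<integral>\<^sup>+\<omega>. ennreal (- ?f \<omega>) \<partial>M)"
    by (rule nn_integral_nn_cond_exp; measurable)+
  have fin: "AE \<omega> in M. cpos ?f \<omega> < \<infinity>"
    by (rule cpos_payoff_finite) measurable
  have "AE \<omega> in M. enn2real (cpos ?f \<omega>) \<le> ?b \<omega>"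
  proof (rule cpos_payoff_bound)
    show "AE \<omega> in M. ereal (- ?K \<omega>) \<le> gen_cond_exp M F ?f \<omega>"
      using opt
    proof eventually_elim
      case (elim \<omega>)
      show ?case unfolding elim[symmetric] by simp
    qed
  qed auto
  then have cpos_le: "AE \<omega> in M. cpos ?f \<omega> \<le> ennreal (?b \<omega>)"
    using fin
  proof eventually_elim
    case (elim \<omega>)
    then show ?case by (cases "cpos ?f \<omega>") (auto intro: ennreal_leI)
  qed
  have "integrable M (\<lambda>\<omega>. max 0 (W (X \<omega> / 2) \<omega>))"
  proof (rule integrableI_nonneg)
    show "(\<integral>\<^sup>+\<omega>. ennreal (max 0 (W (X \<omega> / 2) \<omega>)) \<partial>M) < \<infinity>"
      using half by simp
  qed auto
  moreover have "integrable M ?K"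
    using W by (intro integrable_max) auto
  ultimately have "integrable M ?b"
    by (intro integrable_divide Bochner_Integration.integrable_add integrable_mult_right) auto
  then have "(\<integral>\<^sup>+\<omega>. ennreal (?b \<omega>) \<partial>M) < \<infinity>"
    by (auto simp: real_integrable_def top.not_eq_extremum)
  then have pos: "(\<integral>\<^sup>+\<omega>. ennreal (?f \<omega>) \<partial>M) < \<infinity>"
    using nn_integral_mono_AE[OF cpos_le] int(1) by (auto intro: le_less_trans)
  have eq: "AE \<omega> in M. cpos ?f \<omega> + ennreal (- W (X \<omega>) \<omega>) = cneg ?f \<omega> + ennreal (W (X \<omega>) \<omega>)"
    using opt fin
  proof eventually_elim
    case (elim \<omega>)
    define a b where "a = enn2real (cpos ?f \<omega>)" and "b = enn2real (cneg ?f \<omega>)"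
    have "cneg ?f \<omega> < \<infinity>"
      using elim by (metis le_gen_cond_exp_iff order_refl)
    then have ab: "cpos ?f \<omega> = ennreal a" "cneg ?f \<omega> = ennreal b" "0 \<le> a" "0 \<le> b" "W (X \<omega>) \<omega> = a - b"
      using elim gen_cond_exp_eq_real[of ?f \<omega>] by (auto simp: a_def b_def)
    then show ?case
      by (cases "b \<le> a") (auto simp: ennreal_neg simp flip: ennreal_plus)
  qed
  have W_fin: "(\<integral>\<^sup>+\<omega>. ennreal (W (X \<omega>) \<omega>) \<partial>M) < \<infinity>" "(\<integral>\<^sup>+\<omega>. ennreal (- W (X \<omega>) \<omega>) \<partial>M) < \<infinity>"
    using W by (auto simp: real_integrable_def top.not_eq_extremum)
  have "(\<integral>\<^sup>+\<omega>. cpos ?f \<omega> + ennreal (- W (X \<omega>) \<omega>) \<partial>M) = (\<integral>\<^sup>+\<omega>. cneg ?f \<omega> + ennreal (W (X \<omega>) \<omega>) \<partial>M)"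
    by (rule nn_integral_cong_AE[OF eq])
  then have sum: "(\<integral>\<^sup>+\<omega>. ennreal (?f \<omega>) \<partial>M) + (\<integral>\<^sup>+\<omega>. ennreal (- W (X \<omega>) \<omega>) \<partial>M)
      = (\<integral>\<^sup>+\<omega>. ennreal (- ?f \<omega>) \<partial>M) + (\<integral>\<^sup>+\<omega>. ennreal (W (X \<omega>) \<omega>) \<partial>M)"
    by (simp add: nn_integral_add int)
  have neg: "(\<integral>\<^sup>+\<omega>. ennreal (- ?f \<omega>) \<partial>M) < \<infinity>"
  proof -
    have "(\<integral>\<^sup>+\<omega>. ennreal (- ?f \<omega>) \<partial>M) \<le> (\<integral>\<^sup>+\<omega>. ennreal (?f \<omega>) \<partial>M) + (\<integral>\<^sup>+\<omega>. ennreal (- W (X \<omega>) \<omega>) \<partial>M)"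
      unfolding sum by simp
    also have "\<dots> < \<infinity>" using pos W_fin by simp
    finally show ?thesis .
  qed
  show f: "integrable M ?f"
    using pos neg by (auto simp: real_integrable_def)
  have "enn2real ((\<integral>\<^sup>+\<omega>. ennreal (?f \<omega>) \<partial>M) + (\<integral>\<^sup>+\<omega>. ennreal (- W (X \<omega>) \<omega>) \<partial>M))
      = enn2real ((\<integral>\<^sup>+\<omega>. ennreal (- ?f \<omega>) \<partial>M) + (\<integral>\<^sup>+\<omega>. ennreal (W (X \<omega>) \<omega>) \<partial>M))"
    by (simp only: sum)
  then show "(\<integral>\<omega>. ?f \<omega> \<partial>M) = (\<integral>\<omega>. W (X \<omega>) \<omega> \<partial>M)"
    using pos neg W_fin by (simp add: real_lebesgue_integral_def f W enn2real_plus)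
qed

end

section \<open>The recursion and the optimal strategy\<close>

lemma gen_expectation_integrable:
  assumes "integrable M f"
  shows "gen_expectation M f = ereal (\<integral>\<omega>. f \<omega> \<partial>M)"
proof -
  have "(\<integral>\<^sup>+\<omega>. ennreal (f \<omega>) \<partial>M) < \<infinity>" "(\<integral>\<^sup>+\<omega>. ennreal (- f \<omega>) \<partial>M) < \<infinity>"
    using assms by (auto simp: real_integrable_def top.not_eq_extremum)
  then show ?thesis
    unfolding gen_expectation_def real_lebesgue_integral_def[OF assms]
    by (cases "\<integral>\<^sup>+\<omega>. ennreal (f \<omega>) \<partial>M"; cases "\<integral>\<^sup>+\<omega>. ennreal (- f \<omega>) \<partial>M") auto
qed

lemma wealth_Suc:
  "wealth S c \<phi> (Suc t) \<omega> = wealth S c \<phi> t \<omega> + \<phi> (Suc t) \<omega> \<bullet> price_increment S (Suc t) \<omega>"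
  by (simp add: wealth_def)

lemma wealth_0: "wealth S c \<phi> 0 \<omega> = c"
  by (simp add: wealth_def)

lemma strategies_Suc:
  assumes "\<phi> \<in> strategies F T" "t < T"
  shows "\<phi> (Suc t) \<in> borel_measurable (F t)"
proof -
  have "\<forall>t\<in>{1..T}. \<phi> t \<in> borel_measurable (F (t - 1))"
    using assms(1) by (simp add: strategies_def)
  from bspec[OF this, of "Suc t"] show ?thesis using assms(2) by simp
qed

context market
begin

lemma subalgebra_F: "s \<le> t \<Longrightarrow> t \<le> T \<Longrightarrow> subalgebra (F t) (F s)"
  using filtration_subalgebra[of s] filtration_subalgebra[of t] filtration_mono[of s t]
  by (auto simp: subalgebra_def)

lemma borel_measurable_price_increment:
  assumes "t < T"
  shows "price_increment S (Suc t) \<in> borel_measurable (F (Suc t))"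
proof -
  have [measurable]: "S t \<in> borel_measurable (F (Suc t))" "S (Suc t) \<in> borel_measurable (F (Suc t))"
    using assms adapted[of t] adapted[of "Suc t"] measurable_from_subalg[OF subalgebra_F[of t "Suc t"]]
    by auto
  have "(\<lambda>\<omega>. S (Suc t) \<omega> - S t \<omega>) \<in> borel_measurable (F (Suc t))"
    by measurable
  then show ?thesis by (simp add: price_increment_def[abs_def])
qed

lemma borel_measurable_wealth:
  assumes "\<phi> \<in> strategies F T" "t \<le> T"
  shows "wealth S c \<phi> t \<in> borel_measurable (F t)"
  using \<open>t \<le> T\<close>
proof (induction t)
  case 0
  then show ?case by (simp add: wealth_def[abs_def])
next
  case (Suc t)
  have "\<phi> (Suc t) \<in> borel_measurable (F t)"
    using assms(1) Suc.prems by (intro strategies_Suc) auto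
  then have [measurable]: "\<phi> (Suc t) \<in> borel_measurable (F (Suc t))" "wealth S c \<phi> t \<in> borel_measurable (F (Suc t))"
    using Suc measurable_from_subalg[OF subalgebra_F[of t "Suc t"]] by auto
  have [measurable]: "price_increment S (Suc t) \<in> borel_measurable (F (Suc t))"
    using Suc.prems by (intro borel_measurable_price_increment) auto
  show ?case unfolding wealth_Suc[abs_def] by measurable
qed

text \<open>A strategy trading only in the period after \<open>t\<close> has the one-step gain as
  its terminal wealth.\<close>

lemma no_arbitrage_one_step:
  assumes NA: "no_arbitrage M F T S" and t: "t < T" and \<xi>: "\<xi> \<in> borel_measurable (F t)"
    and nonneg: "AE \<omega> in M. 0 \<le> \<xi> \<omega> \<bullet> price_increment S (Suc t) \<omega>"
  shows "AE \<omega> in M. \<xi> \<omega> \<bullet> price_increment S (Suc t) \<omega> = 0"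
proof -
  define \<phi> where "\<phi> s \<omega> = (if s = Suc t then \<xi> \<omega> else 0)" for s \<omega>
  have "\<phi> \<in> strategies F T"
    unfolding strategies_def
  proof safe
    fix s show "\<phi> s \<in> borel_measurable (F (s - 1))"
      using \<xi> by (cases "s = Suc t") (simp_all add: \<phi>_def[abs_def])
  qed
  then have "(AE \<omega> in M. 0 \<le> wealth S 0 \<phi> T \<omega>) \<longrightarrow> (AE \<omega> in M. wealth S 0 \<phi> T \<omega> = 0)"
    using NA unfolding no_arbitrage_def by blast
  moreover have "wealth S 0 \<phi> T \<omega> = \<xi> \<omega> \<bullet> price_increment S (Suc t) \<omega>" for \<omega>
  proof -
    have "\<phi> i \<omega> \<bullet> price_increment S i \<omega> = (if i = Suc t then \<xi> \<omega> \<bullet> price_increment S i \<omega> else 0)" for i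
      by (simp add: \<phi>_def)
    then have "wealth S 0 \<phi> T \<omega> = (\<Sum>i = 1..T. if i = Suc t then \<xi> \<omega> \<bullet> price_increment S i \<omega> else 0)"
      by (simp only: wealth_def add_0)
    also have "\<dots> = \<xi> \<omega> \<bullet> price_increment S (Suc t) \<omega>"
      using t by (subst sum.delta) auto
    finally show ?thesis .
  qed
  ultimately show ?thesis
    using nonneg by simp
qed

end

text \<open>At constant capital, losses are controlled backwards from
  \<open>V_terminal_lower\<close> and gains forwards from \<open>V_initial\<close>.\<close>

locale utility_recursion = market M F T S
  for M :: "'a measure" and F :: "nat \<Rightarrow> 'a measure" and T :: nat and S :: "nat \<Rightarrow> 'a \<Rightarrow> real ^ 'd" +
  fixes V :: "nat \<Rightarrow> real \<Rightarrow> 'a \<Rightarrow> real" and p q C :: real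
  assumes step: "\<And>t. t < T \<Longrightarrow> utility_step M (F t) (price_increment S (Suc t)) (V (Suc t)) (V t) p q C"
    and V_measurable: "\<And>t x. t \<le> T \<Longrightarrow> V t x \<in> borel_measurable M"
    and V_initial: "\<And>x. (\<integral>\<^sup>+\<omega>. ennreal (V 0 x \<omega>) \<partial>M) < \<infinity>"
    and V_terminal_lower: "\<And>x. \<exists>l\<ge>0. AE \<omega> in M. - l \<le> V T x \<omega>"
begin

lemma V_lower:
  assumes "t \<le> T"
  shows "\<exists>l\<ge>0. AE \<omega> in M. - l \<le> V t x \<omega>"
  using assms
proof (induction rule: inc_induct)
  case base
  show ?case by (rule V_terminal_lower)
next
  case (step t)
  interpret utility_step M "F t" "price_increment S (Suc t)" "V (Suc t)" "V t" p q C
    using step by (intro utility_recursion.step[OF utility_recursion_axioms]) simp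
  show ?case using step W_lower by blast
qed

lemma V_neg_part_finite:
  assumes "t \<le> T"
  shows "(\<integral>\<^sup>+\<omega>. ennreal (- V t x \<omega>) \<partial>M) < \<infinity>"
proof -
  obtain l where l: "AE \<omega> in M. - l \<le> V t x \<omega>"
    using V_lower[OF assms] by blast
  have "(\<integral>\<^sup>+\<omega>. ennreal (- V t x \<omega>) \<partial>M) \<le> (\<integral>\<^sup>+\<omega>. ennreal l \<partial>M)"
    using l by (intro nn_integral_mono_AE) (auto elim!: eventually_mono intro: ennreal_leI)
  also have "\<dots> < \<infinity>" by (simp add: emeasure_space_1)
  finally show ?thesis .
qed

text \<open>Holding nothing for one period shows that the expected value at fixed capital does not
  increase with time, so finiteness at time \<open>0\<close> is passed forwards; finite negative
  parts allow the parts to be separated.\<close>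

lemma V_pos_part_finite:
  assumes "t \<le> T"
  shows "(\<integral>\<^sup>+\<omega>. ennreal (V t x \<omega>) \<partial>M) < \<infinity>"
  using assms
proof (induction t)
  case 0
  show ?case by (rule V_initial)
next
  case (Suc t)
  interpret utility_step M "F t" "price_increment S (Suc t)" "V (Suc t)" "V t" p q C
    using Suc by (intro step) simp
  have payoff: "payoff (\<lambda>_. x) (\<lambda>_. 0) = V (Suc t) x"
    by (simp add: payoff_def fun_eq_iff)
  have "(\<integral>\<^sup>+\<omega>. ennreal (V (Suc t) x \<omega>) \<partial>M) + (\<integral>\<^sup>+\<omega>. ennreal (- V t x \<omega>) \<partial>M)
      \<le> (\<integral>\<^sup>+\<omega>. ennreal (- V (Suc t) x \<omega>) \<partial>M) + (\<integral>\<^sup>+\<omega>. ennreal (V t x \<omega>) \<partial>M)"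
    using payoff_upper_step(2)[of "\<lambda>_. x" "\<lambda>_. 0"] V_neg_part_finite[OF Suc.prems, of x]
    by (simp add: payoff)
  also have "\<dots> < \<infinity>"
    using V_neg_part_finite[OF Suc.prems] Suc by simp
  finally show ?case by simp
qed

definition optimal_at :: "real \<Rightarrow> (nat \<Rightarrow> 'a \<Rightarrow> real ^ 'd) \<Rightarrow> nat \<Rightarrow> bool" where
  "optimal_at c \<phi> t \<longleftrightarrow> (AE \<omega> in M. ereal (V t (wealth S c \<phi> t \<omega>) \<omega>)
     = gen_cond_exp M (F t) (\<lambda>\<omega>. V (Suc t) (wealth S c \<phi> (Suc t) \<omega>) \<omega>) \<omega>)"

lemma optimal_strategy_exists:
  assumes "n \<le> T"
  shows "\<exists>\<phi>\<in>strategies F T. \<forall>t<n. optimal_at c \<phi> t"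
  using assms
proof (induction n)
  case 0
  have "(\<lambda>_ _. 0) \<in> strategies F T" by (simp add: strategies_def)
  then show ?case by blast
next
  case (Suc n)
  then obtain \<phi> where \<phi>: "\<phi> \<in> strategies F T" and opt: "\<And>t. t < n \<Longrightarrow> optimal_at c \<phi> t"
    by auto
  interpret utility_step M "F n" "price_increment S (Suc n)" "V (Suc n)" "V n" p q C
    using Suc by (intro step) simp
  have "wealth S c \<phi> n \<in> borel_measurable (F n)"
    using Suc.prems \<phi> by (intro borel_measurable_wealth) auto
  from optimal_step[OF this] obtain \<xi> where \<xi>: "\<xi> \<in> borel_measurable (F n)"
    and \<xi>_opt: "AE \<omega> in M. ereal (V n (wealth S c \<phi> n \<omega>) \<omega>) = gen_cond_exp M (F n) (payoff (wealth S c \<phi> n) \<xi>) \<omega>"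
    by blast
  \<comment> \<open>Wealth up to time \<open>n\<close> does not involve the position held from
    \<open>n\<close> to \<open>n + 1\<close>, so the equalities already obtained survive the
    update.\<close>
  define \<psi> where "\<psi> = \<phi>(Suc n := \<xi>)"
  have \<psi>: "\<psi> \<in> strategies F T"
    using \<phi> \<xi> by (auto simp: \<psi>_def strategies_def)
  have same: "wealth S c \<psi> t = wealth S c \<phi> t" if "t \<le> n" for t
    using that by (auto simp: wealth_def \<psi>_def fun_eq_iff intro!: sum.cong)
  have "optimal_at c \<psi> t" if "t < Suc n" for t
  proof (cases "t = n")
    case True
    have "(\<lambda>\<omega>. V (Suc n) (wealth S c \<psi> (Suc n) \<omega>) \<omega>) = payoff (wealth S c \<phi> n) \<xi>"
      by (simp add: payoff_def fun_eq_iff wealth_Suc same) (simp add: \<psi>_def)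
    then show ?thesis
      using \<xi>_opt by (simp add: True optimal_at_def same)
  next
    case False
    then show ?thesis
      using that opt[of t] by (simp add: optimal_at_def same)
  qed
  then show ?case using \<psi> by blast
qed

lemma optimal_strategy_integrable:
  assumes \<phi>: "\<phi> \<in> strategies F T" and opt: "\<And>t. t < T \<Longrightarrow> optimal_at c \<phi> t" and "t \<le> T"
  shows "integrable M (\<lambda>\<omega>. V t (wealth S c \<phi> t \<omega>) \<omega>) \<and>
    (\<integral>\<omega>. V t (wealth S c \<phi> t \<omega>) \<omega> \<partial>M) = (\<integral>\<omega>. V 0 c \<omega> \<partial>M)"
  using \<open>t \<le> T\<close>
proof (induction t)
  case 0
  have "integrable M (V 0 c)"
    using V_pos_part_finite[of 0 c] V_neg_part_finite[of 0 c] V_measurable[of 0 c]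
    by (simp add: real_integrable_def less_top)
  then show ?case by (simp add: wealth_0)
next
  case (Suc t)
  interpret utility_step M "F t" "price_increment S (Suc t)" "V (Suc t)" "V t" p q C
    using Suc by (intro step) simp
  let ?X = "wealth S c \<phi> t"
  have X [measurable]: "?X \<in> borel_measurable (F t)"
    using Suc.prems \<phi> by (intro borel_measurable_wealth) auto
  have \<phi>_meas: "\<phi> (Suc t) \<in> borel_measurable (F t)"
    using \<phi> Suc.prems by (intro strategies_Suc) auto
  have payoff: "payoff ?X (\<phi> (Suc t)) = (\<lambda>\<omega>. V (Suc t) (wealth S c \<phi> (Suc t) \<omega>) \<omega>)"
    by (simp add: payoff_def fun_eq_iff wealth_Suc)
  have IH: "integrable M (\<lambda>\<omega>. V t (?X \<omega>) \<omega>)"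
    using Suc by simp
  have [measurable]: "V t 0 \<in> borel_measurable M"
    using Suc.prems by (intro V_measurable) simp
  have [measurable]: "(\<lambda>\<omega>. V t (?X \<omega>) \<omega>) \<in> borel_measurable M"
    using IH by auto
  \<comment> \<open>Half the wealth is at most the larger of \<open>0\<close> and the wealth itself,
    so monotonicity reduces the requirement to constant capital \<open>0\<close> and the induction
    hypothesis.\<close>
  have "(\<integral>\<^sup>+\<omega>. ennreal (V t (?X \<omega> / 2) \<omega>) \<partial>M) \<le> (\<integral>\<^sup>+\<omega>. ennreal (V t 0 \<omega>) + ennreal (V t (?X \<omega>) \<omega>) \<partial>M)"
  proof (rule nn_integral_mono)
    fix \<omega>
    show "ennreal (V t (?X \<omega> / 2) \<omega>) \<le> ennreal (V t 0 \<omega>) + ennreal (V t (?X \<omega>) \<omega>)"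
    proof (cases "?X \<omega> \<le> 0")
      case True
      then have "ennreal (V t (?X \<omega> / 2) \<omega>) \<le> ennreal (V t 0 \<omega>)"
        by (intro ennreal_leI W_le) simp
      then show ?thesis by (simp add: add_increasing2)
    next
      case False
      then have "ennreal (V t (?X \<omega> / 2) \<omega>) \<le> ennreal (V t (?X \<omega>) \<omega>)"
        by (intro ennreal_leI W_le) simp
      then show ?thesis by (simp add: add_increasing)
    qed
  qed
  also have "\<dots> = (\<integral>\<^sup>+\<omega>. ennreal (V t 0 \<omega>) \<partial>M) + (\<integral>\<^sup>+\<omega>. ennreal (V t (?X \<omega>) \<omega>) \<partial>M)"
    by (rule nn_integral_add) auto
  also have "\<dots> < \<infinity>"
    using IH V_pos_part_finite[of t 0] Suc.prems by (auto simp: real_integrable_def top.not_eq_extremum)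
  finally have half: "(\<integral>\<^sup>+\<omega>. ennreal (V t (?X \<omega> / 2) \<omega>) \<partial>M) < \<infinity>" .
  have opt': "AE \<omega> in M. ereal (V t (?X \<omega>) \<omega>) = gen_cond_exp M (F t) (payoff ?X (\<phi> (Suc t))) \<omega>"
    using opt[of t] Suc.prems by (simp add: optimal_at_def payoff)
  show ?case
    using optimal_payoff_integrable[OF X \<phi>_meas opt' IH half] Suc by (simp add: payoff)
qed

text \<open>If the terminal losses have infinite mean, admissibility makes the expected utility
  minus infinity. Otherwise finite expected losses propagate backwards to time \<open>0\<close>,
  where the gains are finite too.\<close>

lemma expected_utility_upper_bound:
  assumes \<phi>: "\<phi> \<in> strategies F T"
    and dfd: "expectation_defined M (\<lambda>\<omega>. V T (wealth S c \<phi> T \<omega>) \<omega>)"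
  shows "gen_expectation M (\<lambda>\<omega>. V T (wealth S c \<phi> T \<omega>) \<omega>) \<le> ereal (\<integral>\<omega>. V 0 c \<omega> \<partial>M)"
proof -
  define P where "P t = (\<integral>\<^sup>+\<omega>. ennreal (V t (wealth S c \<phi> t \<omega>) \<omega>) \<partial>M)" for t
  define N where "N t = (\<integral>\<^sup>+\<omega>. ennreal (- V t (wealth S c \<phi> t \<omega>) \<omega>) \<partial>M)" for t
  have gen: "gen_expectation M (\<lambda>\<omega>. V T (wealth S c \<phi> T \<omega>) \<omega>) = enn2ereal (P T) - enn2ereal (N T)"
    by (simp add: gen_expectation_def P_def N_def)
  show ?thesis
  proof (cases "N T < \<infinity>")
    case False
    then have "P T < \<infinity>"
      using dfd by (auto simp: expectation_defined_def P_def N_def)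
    then show ?thesis
      using False unfolding gen by (cases "P T"; cases "N T") auto
  next
    case True
    \<comment> \<open>This is \<open>P T - N T \<le> P t - N t\<close> written without differences,
      since the gains \<open>P t\<close> of an arbitrary strategy may be infinite before the
      comparison reaches time \<open>0\<close>.\<close>
    have "N t < \<infinity> \<and> P T + N t \<le> N T + P t" if "t \<le> T" for t
      using that
    proof (induction rule: inc_induct)
      case base
      show ?case using True by (simp add: add.commute)
    next
      case (step t)
      interpret utility_step M "F t" "price_increment S (Suc t)" "V (Suc t)" "V t" p q C
        using step by (intro utility_recursion.step[OF utility_recursion_axioms]) simp
      let ?X = "wealth S c \<phi> t"
      have X: "?X \<in> borel_measurable (F t)"
        using step \<phi> by (intro borel_measurable_wealth) auto
      have \<phi>_meas: "\<phi> (Suc t) \<in> borel_measurable (F t)"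
        using \<phi> step by (intro strategies_Suc) auto
      have payoff: "payoff ?X (\<phi> (Suc t)) = (\<lambda>\<omega>. V (Suc t) (wealth S c \<phi> (Suc t) \<omega>) \<omega>)"
        by (simp add: payoff_def fun_eq_iff wealth_Suc)
      have fin: "N (Suc t) < \<infinity>" using step.IH by simp
      have one: "N t < \<infinity>" "P (Suc t) + N t \<le> N (Suc t) + P t"
        using payoff_upper_step[OF X \<phi>_meas] fin unfolding payoff N_def P_def by auto
      \<comment> \<open>The finite quantity \<open>N (Suc t)\<close> is added on both sides so that
        the induction hypothesis and the one-step inequality chain in \<open>ennreal\<close>; it is
        cancelled at the end.\<close>
      have "N (Suc t) + (P T + N t) = (P T + N (Suc t)) + N t"
        by (simp add: ac_simps)
      also have "\<dots> \<le> (N T + P (Suc t)) + N t"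
        using step.IH by (intro add_right_mono) simp
      also have "\<dots> = N T + (P (Suc t) + N t)"
        by (simp add: ac_simps)
      also have "\<dots> \<le> N T + (N (Suc t) + P t)"
        by (intro add_left_mono one)
      also have "\<dots> = N (Suc t) + (N T + P t)"
        by (simp add: ac_simps)
      finally have "P T + N t \<le> N T + P t"
        using fin by (auto simp: ennreal_add_left_cancel_le)
      then show ?case using one by simp
    qed
    from this[of 0] have le: "P T + N 0 \<le> N T + P 0" by simp
    have fin0: "P 0 < \<infinity>" "N 0 < \<infinity>"
      using V_pos_part_finite[of 0 c] V_neg_part_finite[of 0 c] by (auto simp: P_def N_def wealth_0)
    have int: "integrable M (V 0 c)"
      using fin0 V_measurable[of 0 c] by (simp add: real_integrable_def P_def N_def wealth_0 less_top)
    have "P T \<le> N T + P 0"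
      using le by (metis add.commute add_increasing2 le_iff_add order_trans zero_le)
    also have "\<dots> < \<infinity>" using True fin0 by simp
    finally have "P T < \<infinity>" .
    moreover have "(\<integral>\<omega>. V 0 c \<omega> \<partial>M) = enn2real (P 0) - enn2real (N 0)"
      using int by (simp add: real_lebesgue_integral_def P_def N_def wealth_0)
    ultimately show ?thesis
      using le fin0 True unfolding gen
      by (cases "P T"; cases "N T"; cases "P 0"; cases "N 0") (auto simp flip: ennreal_plus)
  qed
qed

end

section \<open>From well-posedness to the recursion\<close>

lemma (in sigma_finite_subalgebra) cond_exp_defined_cong:
  assumes f: "cond_exp_defined M F f" and [measurable]: "g \<in> borel_measurable M" and eq: "AE \<omega> in M. f \<omega> = g \<omega>"
  shows "cond_exp_defined M F g"
proof -
  have [measurable]: "f \<in> borel_measurable M"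
    using f by (simp add: cond_exp_defined_def)
  have "AE \<omega> in M. cpos f \<omega> = cpos g \<omega>" "AE \<omega> in M. cneg f \<omega> = cneg g \<omega>"
    using eq by (intro nn_cond_exp_cong; auto elim!: eventually_mono)+
  moreover have "AE \<omega> in M. cpos f \<omega> < \<infinity> \<or> cneg f \<omega> < \<infinity>"
    using f by (simp add: cond_exp_defined_def)
  ultimately have "AE \<omega> in M. cpos g \<omega> < \<infinity> \<or> cneg g \<omega> < \<infinity>"
    by eventually_elim simp
  then show ?thesis by (simp add: cond_exp_defined_def)
qed

lemma is_ess_sup_cong:
  assumes sup: "is_ess_sup M (f ` I) Z" and eq: "\<And>i. i \<in> I \<Longrightarrow> AE \<omega> in M. f i \<omega> = g i \<omega>"
    and Z': "AE \<omega> in M. Z \<omega> = Z' \<omega>" "Z' \<in> borel_measurable M"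
  shows "is_ess_sup M (g ` I) Z'"
  unfolding is_ess_sup_def
proof (intro conjI ballI impI Z')
  fix X assume "X \<in> g ` I"
  then obtain i where i: "i \<in> I" "X = g i" by auto
  have "AE \<omega> in M. f i \<omega> \<le> Z \<omega>"
    using sup i by (auto simp: is_ess_sup_def)
  then show "AE \<omega> in M. X \<omega> \<le> Z' \<omega>"
    using eq[OF i(1)] Z'(1) unfolding i(2) by eventually_elim simp
next
  fix Y :: "'a \<Rightarrow> ereal" assume Y: "Y \<in> borel_measurable M" and le: "\<forall>X\<in>g ` I. AE \<omega> in M. X \<omega> \<le> Y \<omega>"
  have "AE \<omega> in M. f i \<omega> \<le> Y \<omega>" if "i \<in> I" for i
  proof -
    have "AE \<omega> in M. g i \<omega> \<le> Y \<omega>" using le that by blast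
    then show ?thesis using eq[OF that] by eventually_elim simp
  qed
  then have "AE \<omega> in M. Z \<omega> \<le> Y \<omega>"
    using sup Y by (auto simp: is_ess_sup_def)
  then show "AE \<omega> in M. Z' \<omega> \<le> Y \<omega>"
    using Z'(1) by eventually_elim simp
qed

text \<open>Well-posedness supplies the value functions, but not their unboundedness below or the
  halving inequalities; these are generated backwards from \<open>U\<close>. The hypothesis
  \<open>nonzero\<close> excludes the constant utility, which is bounded below.\<close>

lemma (in market) well_posed_recursion:
  assumes B: "B \<in> borel_measurable M" and bdd: "bounded (B ` space M)"
    and NA: "no_arbitrage M F T S" and wp: "well_posed M F T S U B"
    and growth: "growth_at_plus_infinity U \<or> growth_at_minus_infinity U" and nonzero: "U u \<noteq> 0"
  shows "\<exists>V p q C. utility_recursion M F T S V p q C \<and> (\<forall>x \<omega>. V T x \<omega> = U (x - B \<omega>))"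
proof -
  note B[measurable]
  have conc: "concave_on UNIV U" and mono: "mono U" and U0: "U 0 = 0"
    using growth unfolding growth_at_plus_infinity_def growth_at_minus_infinity_def by blast+
  have U_meas [measurable]: "U \<in> borel_measurable borel"
    by (rule borel_measurable_mono[OF mono])
  obtain b where b: "0 \<le> b" "\<And>\<omega>. \<omega> \<in> space M \<Longrightarrow> \<bar>B \<omega>\<bar> \<le> b"
  proof -
    obtain b where "\<And>\<omega>. \<omega> \<in> space M \<Longrightarrow> \<bar>B \<omega>\<bar> \<le> b"
      using bdd by (auto simp: bounded_iff)
    then show ?thesis using that[of "max 0 b"] by (simp add: le_max_iff_disj)
  qed
  have "\<exists>p q C. 0 \<le> p \<and> p < q \<and> 0 \<le> C \<and> (\<forall>x \<beta>. \<bar>\<beta>\<bar> \<le> b \<longrightarrow>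
      p * U (x - \<beta>) - C \<le> U (x / 2 - \<beta>) \<and> q * U (x - \<beta>) - C \<le> U (x / 2 - \<beta>))"
    using growth growth_plus_halving[OF _ b(1)] growth_minus_halving[OF _ b(1)] by blast
  then obtain p q C where pqC: "0 \<le> p" "p < q" "0 \<le> C"
    and halving: "\<And>x \<beta>. \<bar>\<beta>\<bar> \<le> b \<Longrightarrow>
      p * U (x - \<beta>) - C \<le> U (x / 2 - \<beta>) \<and> q * U (x - \<beta>) - C \<le> U (x / 2 - \<beta>)"
    by blast
  obtain V0 where V0_T: "\<And>x \<omega>. V0 T x \<omega> = U (x - B \<omega>)"
    and V0_def: "\<And>t x \<xi>. t < T \<Longrightarrow> \<xi> \<in> borel_measurable (F t) \<Longrightarrow> cond_exp_defined M (F t)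
              (\<lambda>\<omega>. V0 (Suc t) (x + \<xi> \<omega> \<bullet> price_increment S (Suc t) \<omega>) \<omega>)"
    and V0_meas: "\<And>t x. t < T \<Longrightarrow> V0 t x \<in> borel_measurable (F t)"
    and V0_sup: "\<And>t x. t < T \<Longrightarrow> is_ess_sup M
              ((\<lambda>\<xi>. gen_cond_exp M (F t)
                  (\<lambda>\<omega>. V0 (Suc t) (x + \<xi> \<omega> \<bullet> price_increment S (Suc t) \<omega>) \<omega>))
                ` borel_measurable (F t)) (\<lambda>\<omega>. ereal (V0 t x \<omega>))"
    and V0_good: "\<And>t. t < T \<Longrightarrow> AE \<omega> in M. mono (\<lambda>x. V0 t x \<omega>) \<and> concave_on UNIV (\<lambda>x. V0 t x \<omega>)"
    and V0_0: "\<And>x. expectation_defined M (V0 0 x) \<and> gen_expectation M (V0 0 x) < \<infinity>"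
    using wp unfolding well_posed_def by blast
  have "\<forall>t. \<exists>N. t < T \<longrightarrow> N \<in> null_sets M \<and>
      (\<forall>\<omega>\<in>space M - N. mono (\<lambda>x. V0 t x \<omega>) \<and> concave_on UNIV (\<lambda>x. V0 t x \<omega>))"
  proof
    fix t
    show "\<exists>N. t < T \<longrightarrow> N \<in> null_sets M \<and>
      (\<forall>\<omega>\<in>space M - N. mono (\<lambda>x. V0 t x \<omega>) \<and> concave_on UNIV (\<lambda>x. V0 t x \<omega>))"
    proof (cases "t < T")
      case True
      from AE_E3[OF V0_good[OF True]] obtain N where
        "\<And>\<omega>. \<omega> \<in> space M - N \<Longrightarrow> mono (\<lambda>x. V0 t x \<omega>) \<and> concave_on UNIV (\<lambda>x. V0 t x \<omega>)"
        "N \<in> null_sets M"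
        by blast
      then show ?thesis by blast
    qed simp
  qed
  from choice[OF this] obtain N where N: "\<And>t. t < T \<Longrightarrow> N t \<in> null_sets M"
    and N_good: "\<And>t \<omega>. t < T \<Longrightarrow> \<omega> \<in> space M - N t \<Longrightarrow> mono (\<lambda>x. V0 t x \<omega>) \<and> concave_on UNIV (\<lambda>x. V0 t x \<omega>)"
    by blast
  \<comment> \<open>The modification makes regularity hold everywhere; it stays adapted because \<open>F 0\<close> contains the null sets.\<close>
  define V where "V t x \<omega> = (if t < T \<and> \<omega> \<notin> space M - N t then 0 else V0 t x \<omega>)" for t x \<omega>
  have V_T: "V T x \<omega> = U (x - B \<omega>)" for x \<omega>
    by (simp add: V_def V0_T)
  have V_eq: "AE \<omega> in M. \<forall>x. V0 t x \<omega> = V t x \<omega>" if "t \<le> T" for t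
  proof (cases "t = T")
    case False
    then have "AE \<omega> in M. \<omega> \<notin> N t"
      using N[of t] that by (intro AE_not_in) auto
    then show ?thesis using AE_space by eventually_elim (simp add: V_def)
  qed (simp add: V_def)
  have V_meas_F: "V t x \<in> borel_measurable (F t)" if "t < T" for t x
  proof -
    have "N t \<in> sets (F t)"
      using N[OF that] null_sets_F0 filtration_mono[of 0 t] that by auto
    then have [measurable]: "N t \<in> sets (F t)" .
    have [measurable]: "V0 t x \<in> borel_measurable (F t)" by (rule V0_meas[OF that])
    have "space (F t) = space M"
      using filtration_subalgebra[of t] that by (simp add: subalgebra_def)
    then have "V t x \<omega> = (if \<omega> \<in> N t then 0 else V0 t x \<omega>)" if "\<omega> \<in> space (F t)" for \<omega>
      using \<open>t < T\<close> that by (auto simp: V_def)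
    moreover have "(\<lambda>\<omega>. if \<omega> \<in> N t then 0 else V0 t x \<omega>) \<in> borel_measurable (F t)"
      by measurable
    ultimately show ?thesis
      by (simp cong: measurable_cong)
  qed
  have V_meas: "V t x \<in> borel_measurable M" if "t \<le> T" for t x
  proof (cases "t = T")
    case True
    have "(\<lambda>\<omega>. U (x - B \<omega>)) \<in> borel_measurable M" by measurable
    then show ?thesis by (simp add: True V_T[abs_def])
  next
    case False
    then show ?thesis
      using that V_meas_F[of t x] measurable_from_subalg[OF filtration_subalgebra[of t]] by auto
  qed
  have V_good: "mono (\<lambda>x. V t x \<omega>) \<and> concave_on UNIV (\<lambda>x. V t x \<omega>)" if "t \<le> T" for t \<omega>
  proof (cases "t = T")
    case True
    have "concave_on UNIV (\<lambda>x. U (x - B \<omega>))"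
      unfolding concave_on_iff
    proof (intro conjI allI ballI impI)
      fix x y s r :: real
      assume "0 \<le> s" "0 \<le> r" "s + r = 1"
      then have "s * U (x - B \<omega>) + r * U (y - B \<omega>) \<le> U (s * (x - B \<omega>) + r * (y - B \<omega>))"
        using conc unfolding concave_on_iff by auto
      moreover have "s * (x - B \<omega>) + r * (y - B \<omega>) = s * x + r * y - (s + r) * B \<omega>"
        by (simp add: algebra_simps)
      ultimately show "s * U (x - B \<omega>) + r * U (y - B \<omega>) \<le> U (s *\<^sub>R x + r *\<^sub>R y - B \<omega>)"
        using \<open>s + r = 1\<close> by simp
    qed simp
    then show ?thesis
      by (auto simp: True V_T mono_def intro!: monoD[OF mono])
  next
    case False
    then show ?thesis
    proof (cases "\<omega> \<in> space M - N t")
      case True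
      then show ?thesis using N_good[of t \<omega>] False that by (simp add: V_def)
    next
      case bad: False
      then have "V t x \<omega> = 0" for x using False that by (auto simp: V_def)
      then show ?thesis by (simp add: mono_def concave_on_iff)
    qed
  qed
  have bound_B: "- b \<le> - B \<omega>" if "\<omega> \<in> space M" for \<omega>
    using b(2)[OF that] by simp
  \<comment> \<open>These two properties are the conclusions of one step and premises of the next.
    Hence \<open>step\<close> is proved under \<open>good (Suc t)\<close>, and the induction
    alternates between the two.\<close>
  define good where "good t \<longleftrightarrow> (AE \<omega> in M. \<forall>a. \<exists>x. V t x \<omega> < a) \<and>
    (AE \<omega> in M. \<forall>x. p * V t x \<omega> - C \<le> V t (x / 2) \<omega> \<and> q * V t x \<omega> - C \<le> V t (x / 2) \<omega>)" for t
  have step: "utility_step M (F t) (price_increment S (Suc t)) (V (Suc t)) (V t) p q C"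
    if t: "t < T" and good: "good (Suc t)" for t
  proof -
    interpret finite_measure_subalgebra M "F t"
      using filtration_subalgebra[of t] t by unfold_locales simp
    have [measurable]: "price_increment S (Suc t) \<in> borel_measurable M"
      using borel_measurable_price_increment[OF t] filtration_subalgebra[of "Suc t"] t
      by (intro measurable_from_subalg[of M "F (Suc t)"]) auto
    let ?f = "\<lambda>V x \<xi> \<omega>. V (Suc t) (x + \<xi> \<omega> \<bullet> price_increment S (Suc t) \<omega>) \<omega>"
    have f_meas: "?f V x \<xi> \<in> borel_measurable M" if "\<xi> \<in> borel_measurable (F t)" for x \<xi>
    proof (rule borel_measurable_random_function[where V = "V (Suc t)"])
      show "(\<lambda>\<omega>. x + \<xi> \<omega> \<bullet> price_increment S (Suc t) \<omega>) \<in> borel_measurable M"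
        using measurable_F_imp_M[OF that] by measurable
    qed (use V_meas V_good t in auto)
    have f0_meas: "?f V0 x \<xi> \<in> borel_measurable M" if "\<xi> \<in> borel_measurable (F t)" for x \<xi>
      using V0_def[OF t that] by (simp add: cond_exp_defined_def)
    have f_eq: "AE \<omega> in M. ?f V0 x \<xi> \<omega> = ?f V x \<xi> \<omega>" for x \<xi>
      using V_eq[of "Suc t"] t by (auto elim!: eventually_mono)
    show ?thesis
    proof
      show "cond_exp_defined M (F t) (?f V x \<xi>)" if "\<xi> \<in> borel_measurable (F t)" for x \<xi>
        by (rule cond_exp_defined_cong[OF V0_def[OF t that] f_meas[OF that] f_eq])
      show "is_ess_sup M ((\<lambda>\<xi>. gen_cond_exp M (F t) (?f V x \<xi>)) ` borel_measurable (F t)) (\<lambda>\<omega>. ereal (V t x \<omega>))" for x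
      proof (rule is_ess_sup_cong[OF V0_sup[OF t]])
        show "AE \<omega> in M. gen_cond_exp M (F t) (?f V0 x \<xi>) \<omega> = gen_cond_exp M (F t) (?f V x \<xi>) \<omega>"
          if "\<xi> \<in> borel_measurable (F t)" for \<xi>
          by (rule gen_cond_exp_cong[OF f0_meas[OF that] f_meas[OF that] f_eq])
        show "AE \<omega> in M. ereal (V0 t x \<omega>) = ereal (V t x \<omega>)"
          using V_eq[of t] t by (auto elim!: eventually_mono)
        show "(\<lambda>\<omega>. ereal (V t x \<omega>)) \<in> borel_measurable M"
          using V_meas[of t x] t by simp
      qed
      show "AE \<omega> in M. \<xi> \<omega> \<bullet> price_increment S (Suc t) \<omega> = 0"
        if "\<xi> \<in> borel_measurable (F t)" "AE \<omega> in M. 0 \<le> \<xi> \<omega> \<bullet> price_increment S (Suc t) \<omega>" for \<xi>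
        by (rule no_arbitrage_one_step[OF NA t that])
    qed (use t V_meas V_meas_F V_good good pqC in \<open>auto simp: good_def\<close>)
  qed
  have good: "good t" if "t \<le> T" for t
    using that
  proof (induction rule: inc_induct)
    case base
    have "\<exists>x. V T x \<omega> < a" for a \<omega>
    proof -
      obtain x where "U x < a"
        using concave_mono_unbounded_below[OF conc mono, of u 0] nonzero U0 by auto
      then show ?thesis by (intro exI[of _ "x + B \<omega>"]) (simp add: V_T)
    qed
    moreover have "AE \<omega> in M. \<forall>x. p * V T x \<omega> - C \<le> V T (x / 2) \<omega> \<and> q * V T x \<omega> - C \<le> V T (x / 2) \<omega>"
      using AE_space by eventually_elim (use halving b in \<open>simp add: V_T\<close>)
    ultimately show ?case by (simp add: good_def)
  next
    case (step t)
    interpret utility_step M "F t" "price_increment S (Suc t)" "V (Suc t)" "V t" p q C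
      using step by (intro \<open>\<And>t. t < T \<Longrightarrow> good (Suc t) \<Longrightarrow> _\<close>) auto
    show ?case unfolding good_def using W_unbounded W_growth by simp
  qed
  have "utility_recursion M F T S V p q C"
  proof (intro utility_recursion.intro utility_recursion_axioms.intro market_axioms)
    show "utility_step M (F t) (price_increment S (Suc t)) (V (Suc t)) (V t) p q C" if "t < T" for t
      using step[OF that good] that by simp
    show "V t x \<in> borel_measurable M" if "t \<le> T" for t x
      using V_meas[OF that] .
    show "(\<integral>\<^sup>+\<omega>. ennreal (V 0 x \<omega>) \<partial>M) < \<infinity>" for x
    proof -
      have "(\<integral>\<^sup>+\<omega>. ennreal (V0 0 x \<omega>) \<partial>M) < \<infinity>"
        using V0_0[of x] unfolding expectation_defined_def gen_expectation_def
        by (cases "\<integral>\<^sup>+\<omega>. ennreal (V0 0 x \<omega>) \<partial>M"; cases "\<integral>\<^sup>+\<omega>. ennreal (- V0 0 x \<omega>) \<partial>M") auto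
      also have "(\<integral>\<^sup>+\<omega>. ennreal (V0 0 x \<omega>) \<partial>M) = (\<integral>\<^sup>+\<omega>. ennreal (V 0 x \<omega>) \<partial>M)"
        using V_eq[of 0] by (intro nn_integral_cong_AE) (auto elim!: eventually_mono)
      finally show ?thesis .
    qed
    show "\<exists>l\<ge>0. AE \<omega> in M. - l \<le> V T x \<omega>" for x
    proof (intro exI conjI)
      \<comment> \<open>The bound on the claim makes this lower bound for the terminal utility
        deterministic.\<close>
      show "AE \<omega> in M. - \<bar>U (x - b)\<bar> \<le> V T x \<omega>"
        using AE_space
      proof eventually_elim
        case (elim \<omega>)
        have "U (x - b) \<le> U (x - B \<omega>)"
          using bound_B[OF elim] by (intro monoD[OF mono]) simp
        then show ?case by (simp add: V_T)
      qed
    qed simp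
  qed
  then show ?thesis using V_T by blast
qed

theorem theorem2p10:
  fixes M :: "'a measure"
    and F :: "nat \<Rightarrow> 'a measure"
    and T :: nat
    and S :: "nat \<Rightarrow> 'a \<Rightarrow> real ^ 'd"
    and U :: "real \<Rightarrow> real"
    and B :: "'a \<Rightarrow> real"
  assumes "market M F T S"
    and "B \<in> borel_measurable M"
    and "bounded (B ` space M)"
    and "no_arbitrage M F T S"
    and "well_posed M F T S U B"
    and "growth_at_plus_infinity U \<or> growth_at_minus_infinity U"
  shows "\<forall>c::real. \<exists>\<phi>\<in>admissible_strategies M F T S U c B.
           optimal_utility M F T S U B c = expected_utility M T S U c B \<phi> \<and>
           expected_utility M T S U c B \<phi> < \<infinity>"
proof
  fix c :: real
  interpret market M F T S by fact
  show "\<exists>\<phi>\<in>admissible_strategies M F T S U c B.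
           optimal_utility M F T S U B c = expected_utility M T S U c B \<phi> \<and>
           expected_utility M T S U c B \<phi> < \<infinity>"
  proof -
    have "\<exists>\<phi> e. \<phi> \<in> admissible_strategies M F T S U c B \<and> expected_utility M T S U c B \<phi> = ereal e \<and>
      (\<forall>\<psi>\<in>admissible_strategies M F T S U c B. expected_utility M T S U c B \<psi> \<le> ereal e)"
    proof (cases "\<exists>u. U u \<noteq> 0")
      case False
      \<comment> \<open>Without unboundedness below the recursion argument does not apply, but every
        strategy then has expected utility \<open>0\<close>, in particular the zero
        strategy.\<close>
      then have "U = (\<lambda>_. 0)" by auto
      then show ?thesis
        by (intro exI[of _ "\<lambda>_ _. 0"] exI[of _ 0])
          (auto simp: admissible_strategies_def strategies_def expected_utility_def
            expectation_defined_def gen_expectation_def)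
    next
      case True
      then obtain u where "U u \<noteq> 0" ..
      from well_posed_recursion[OF assms(2-6) this] obtain V p q C
        where rec: "utility_recursion M F T S V p q C" and V_T: "\<And>x \<omega>. V T x \<omega> = U (x - B \<omega>)"
        by blast
      interpret utility_recursion M F T S V p q C by fact
      obtain \<phi> where \<phi>: "\<phi> \<in> strategies F T" and opt: "\<And>t. t < T \<Longrightarrow> optimal_at c \<phi> t"
        using optimal_strategy_exists[of T c] by auto
      define e where "e = (\<integral>\<omega>. V 0 c \<omega> \<partial>M)"
      have int: "integrable M (\<lambda>\<omega>. U (wealth S c \<phi> T \<omega> - B \<omega>))"
        and e: "(\<integral>\<omega>. U (wealth S c \<phi> T \<omega> - B \<omega>) \<partial>M) = e"
        using optimal_strategy_integrable[OF \<phi> opt, where t = T] by (auto simp: V_T e_def)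
      have "expectation_defined M (\<lambda>\<omega>. U (wealth S c \<phi> T \<omega> - B \<omega>))"
        using int by (auto simp: expectation_defined_def real_integrable_def less_top)
      moreover have "expected_utility M T S U c B \<phi> = ereal e"
        unfolding expected_utility_def gen_expectation_integrable[OF int] e ..
      moreover have "expected_utility M T S U c B \<psi> \<le> ereal e"
        if "\<psi> \<in> admissible_strategies M F T S U c B" for \<psi>
        using that expected_utility_upper_bound[of \<psi> c]
        by (simp add: admissible_strategies_def expected_utility_def V_T e_def)
      ultimately show ?thesis
        using \<phi> by (intro exI[of _ \<phi>] exI[of _ e]) (simp add: admissible_strategies_def)
    qed
    then obtain \<phi> e where \<phi>: "\<phi> \<in> admissible_strategies M F T S U c B"
      and e: "expected_utility M T S U c B \<phi> = ereal e"
      and le: "\<And>\<psi>. \<psi> \<in> admissible_strategies M F T S U c B \<Longrightarrow> expected_utility M T S U c B \<psi> \<le> ereal e"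
      by blast
    have "optimal_utility M F T S U B c = expected_utility M T S U c B \<phi>"
      unfolding optimal_utility_def
    proof (rule antisym)
      show "(SUP \<psi>\<in>admissible_strategies M F T S U c B. expected_utility M T S U c B \<psi>) \<le> expected_utility M T S U c B \<phi>"
        unfolding e by (intro SUP_least le)
      show "expected_utility M T S U c B \<phi> \<le> (SUP \<psi>\<in>admissible_strategies M F T S U c B. expected_utility M T S U c B \<psi>)"
        by (rule SUP_upper[OF \<phi>])
    qed
    then show ?thesis using e by (intro bexI[OF _ \<phi>]) simp
  qed
qed

end
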